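(* Let $0<\alpha<\infty$, let $F$ be a probability distribution function on $[0,1]$ with right edge $b=b(F)$, and set $n=\lfloor \alpha m\rfloor$, $H=H(m,n,F)$. Then the limit $$c=c(\alpha,F)=\lim_{m\to\infty}\frac{H}{m}$$ exists almost surely. If $b=1$, then $c(\alpha,F)=1$ for all $\alpha$. If $b<1$, then $$ c(\alpha,F)= \begin{cases} b+\alpha(1-b)\left\langle \dfrac{p}{b-p}\right\rangle, & \text{if } \alpha\le \alpha_c',\\[2mm] a+\alpha(1-a)\left\langle \dfrac{p}{a-p}\right\rangle, & \text{if } \alpha_c'\le\alpha\le\alpha_c,\\[2mm] 1, & \text{if } \alpha_c\le\alpha, \end{cases} $$ where $a=a(\alpha,F)\in[b,1]$ is the unique solution to $$\alpha\left\langle\frac{p(1-p)}{(a-p)^2}\right\rangle=1 .$$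
   Context: Setup. $p$ denotes a generic random variable with distribution function $F(s)=P(p\le s)$ on $[0,1]$, and $\langle\,\cdot\,\rangle$ denotes integration (expectation) with respect to $dF$. Put $b=b(F)=\min\{s: F(s)=1\}$. The environment $p_1,p_2,\dots$ is i.i.d. with distribution $F$. Given the environment, $(\varepsilon_{i,j})_{i,j\ge1}$ are independent Bernoulli variables with $P(\varepsilon_{i,j}=1)=p_j$ (row index $i$ counted from the bottom, column index $j$ from the left); all matrices below are built from this one infinite array on one probability space. For $m,n\ge 1$, $A=A(F)$ is the $m\times n$ matrix $(\varepsilon_{i,j})_{1\le i\le m,1\le j\le n}$. An increasing path in $A$ is a sequence of positions whose entries are all 1, whose column indices are nondecreasing and whose row indices are strictly increasing. $H=H(m,n,F)$ is the length (number of 1's) of a longest increasing path in $A$. Critical values: $$\alpha_c=\left\langle\frac{p}{1-p}\right\rangle^{-1},\qquad \alpha_c'=\left\langle\frac{p(1-p)}{(b-p)^2}\right\rangle^{-1},$$ with the conventions $1/\infty=0$, $1/0=\infty$ (and $0/0=0$ inside expectations). One has $\alpha_c'\le\alpha_c$. *)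

theory Defs
  imports "HOL-Probability.Probability"
begin

definition unit_cdf :: "(real \<Rightarrow> real) \<Rightarrow> bool" where
  "unit_cdf F \<longleftrightarrow> mono F \<and> (\<forall>s. continuous (at_right s) F) \<and>
     (\<forall>s<0. F s = 0) \<and> (\<forall>s\<ge>1. F s = 1)"

definition right_edge :: "(real \<Rightarrow> real) \<Rightarrow> real" where
  "right_edge F = (LEAST s. F s = 1)"

text \<open>
  Expectations with respect to dF are taken in the extended nonnegative reals.  There
  x / 0 is infinite for x > 0, while 0 / 0 = 0, inverse 0 is infinite and the inverse of
  infinity is 0, so the library operations realise the usual conventions for these
  quotients.  Since \<^term>\<open>ennreal\<close> sends negative reals to 0, the integrands below are
  as intended only for arguments in [0, right_edge F], which carries all the mass.
\<close>

definition dF_mean :: "(real \<Rightarrow> real) \<Rightarrow> (real \<Rightarrow> ennreal) \<Rightarrow> ennreal" where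
  "dF_mean F g = (\<integral>\<^sup>+ s. g s \<partial>interval_measure F)"

definition alpha_c :: "(real \<Rightarrow> real) \<Rightarrow> ennreal" where
  "alpha_c F = inverse (dF_mean F (\<lambda>s. ennreal s / ennreal (1 - s)))"

definition alpha_c' :: "(real \<Rightarrow> real) \<Rightarrow> ennreal" where
  "alpha_c' F =
     inverse (dF_mean F (\<lambda>s. ennreal (s * (1 - s)) / ennreal ((right_edge F - s)\<^sup>2)))"

text \<open>
  The environment \<open>p\<close> and the array \<open>\<epsilon>\<close> (row index first, \<^term>\<open>True\<close> for the entry 1)
  are indexed from 1; values at index 0 are irrelevant.  The last assumption says that, conditionally
  on the sigma-algebra generated by the whole environment, the entries are independent and the
  entry in column \<open>j\<close> is Bernoulli with parameter \<open>p j\<close>.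
\<close>

definition env_algebra :: "'w measure \<Rightarrow> (nat \<Rightarrow> 'w \<Rightarrow> real) \<Rightarrow> 'w measure" where
  "env_algebra M p =
     vimage_algebra (space M) (\<lambda>\<omega>. \<lambda>j\<in>{1..}. p j \<omega>) (PiM {1..} (\<lambda>_. borel))"

locale random_environment_array = prob_space M
  for M :: "'w measure" +
  fixes F :: "real \<Rightarrow> real"
    and p :: "nat \<Rightarrow> 'w \<Rightarrow> real"
    and \<epsilon> :: "nat \<Rightarrow> nat \<Rightarrow> 'w \<Rightarrow> bool"
  assumes env_indep: "indep_vars (\<lambda>_. borel) p {1..}"
    and env_cdf: "\<And>j s. 1 \<le> j \<Longrightarrow> cdf (distr M borel (p j)) s = F s"
    and entry_measurable:
      "\<And>i j. 1 \<le> i \<Longrightarrow> 1 \<le> j \<Longrightarrow> \<epsilon> i j \<in> measurable M (count_space UNIV)"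
    and entry_cond_law:
      "\<And>K e. finite K \<Longrightarrow> K \<subseteq> {1..} \<times> {1..} \<Longrightarrow>
         AE \<omega> in M.
           real_cond_exp M (env_algebra M p)
             (indicator {\<omega> \<in> space M. \<forall>(i, j)\<in>K. \<epsilon> i j \<omega> = e i j}) \<omega>
           = (\<Prod>(i, j)\<in>K. pmf (bernoulli_pmf (p j \<omega>)) (e i j))"

definition increasing_path ::
    "(nat \<Rightarrow> nat \<Rightarrow> bool) \<Rightarrow> nat \<Rightarrow> nat \<Rightarrow> (nat \<times> nat) list \<Rightarrow> bool" where
  "increasing_path A m n \<pi> \<longleftrightarrow>
     set \<pi> \<subseteq> {1..m} \<times> {1..n} \<and> (\<forall>(i, j)\<in>set \<pi>. A i j) \<and>
     sorted_wrt (\<lambda>(i, j) (i', j'). i < i' \<and> j \<le> j') \<pi>"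

text \<open>The empty path is allowed, so the length is 0 if there are no entries 1 (or if \<open>n = 0\<close>).\<close>

definition longest_path :: "(nat \<Rightarrow> nat \<Rightarrow> bool) \<Rightarrow> nat \<Rightarrow> nat \<Rightarrow> nat" where
  "longest_path A m n = Max {length \<pi> |\<pi>. increasing_path A m n \<pi>}"

end

theory Submission
  imports Defs "HOL-Real_Asymp.Real_Asymp"
begin

text \<open>
  Put \<open>\<phi> a = a + \<alpha> (1 - a) \<langle>p / (a - p)\<rangle>\<close> for \<open>b < a < 1\<close>, where \<open>b < 1\<close> is the right edge.  The three cases of the
  formula say that the limit is the infimum of the convex function \<open>\<phi>\<close>: it is approached at \<open>b\<close>, attained at the
  zero \<open>a\<close> of the derivative \<open>1 - \<alpha> \<langle>p (1 - p) / (a - p)\<^sup>2\<rangle>\<close>, or approached at 1.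

  The lengths of longest paths satisfy a last-passage recursion (\<open>longest_path_eq_lpp0\<close>), and a column of the array acts
  as a discrete-time queue on the vertical increments of this recursion.  Put independent Bernoulli(\<open>a\<close>) increments on
  the left edge and independent geometric increments, in equilibrium with \<open>a\<close> and \<open>p j\<close>, on the bottom edge.  By the
  Burke property (\<open>burke_column\<close>) every column then has independent Bernoulli(\<open>a\<close>) increments, so the value at the
  corner is a sum of two concentrated terms, with mean \<open>a m + (\<Sum>j=1..n. p j (1 - a) / (a - p j))\<close> for a fixed
  environment.  The recursion is nonexpansive, so the random boundary sums can be replaced by their means.  The outcome
  is \<open>det_lpp\<close>, a function of the environment and the array whose value grows like \<open>\<phi> a * m\<close> almost surely (\<open>det_lpp_limit\<close>).

  Nonnegative boundary values only help a path, whence the upper bound \<open>\<phi> a\<close> for every \<open>a\<close> (\<open>path_rate_upper\<close>).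
  For the lower bound suppose that \<open>a\<close> is the critical point of \<open>\<phi>\<close>.  A path which follows one of the boundaries over a
  length proportional to \<open>\<eta> m\<close> would gain of the order of \<open>\<tau> \<eta> m\<close> after a change of \<open>a\<close> by \<open>\<tau>\<close>, but \<open>\<phi>\<close>
  changes only to order \<open>\<tau>\<^sup>2\<close>.  Hence optimal paths leave the boundary near the corner, and the boundary contributes
  a negligible amount (\<open>path_rate_lower_critical\<close>).  This comparison takes the place of a subadditive limit theorem
  and proves the existence of the limit at the same time.

  If \<open>\<alpha>\<close> is smaller than the critical direction of every \<open>a > b\<close>, a path climbs one very good column in the rows that
  are left over (\<open>path_rate_lower_concat\<close>), and letting \<open>a\<close> decrease to \<open>b\<close> gives the linear piece.  If \<open>\<alpha>\<close> exceeds all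
  critical directions, monotonicity in the number of columns and \<open>\<phi> a \<ge> a\<close> give the value 1.
  If \<open>b = 1\<close>, climbing one column whose parameter is close to 1 already collects nearly one entry per row.
\<close>

section \<open>Last-passage recursion with boundary values\<close>

text \<open>
  The value at \<open>(i, j)\<close> of the heaviest up-right path that first runs along the left edge (collecting
  \<open>\<beta>\<close>) or along the bottom edge (collecting \<open>\<sigma>\<close>) and then collects entries 1 of \<open>A\<close>, at most one per
  row.  In max-plus algebra the recursion is linear in the boundary values; this gives monotonicity,
  shift equivariance, preservation of maxima and, as a consequence, that it is nonexpansive for the
  supremum norm.
\<close>

fun lpp :: "(nat \<Rightarrow> real) \<Rightarrow> (nat \<Rightarrow> real) \<Rightarrow> (nat \<Rightarrow> nat \<Rightarrow> bool) \<Rightarrow> nat \<Rightarrow> nat \<Rightarrow> real" where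
  "lpp \<beta> \<sigma> A 0 j = \<sigma> j"
| "lpp \<beta> \<sigma> A (Suc i) 0 = \<beta> (Suc i)"
| "lpp \<beta> \<sigma> A (Suc i) (Suc j) =
     max (lpp \<beta> \<sigma> A (Suc i) j) (lpp \<beta> \<sigma> A i (Suc j) + of_bool (A (Suc i) (Suc j)))"

lemma lpp_mono_boundary:
  assumes "\<And>k. k \<le> i \<Longrightarrow> \<beta> k \<le> \<beta>' k" "\<And>l. l \<le> j \<Longrightarrow> \<sigma> l \<le> \<sigma>' l"
  shows "lpp \<beta> \<sigma> A i j \<le> lpp \<beta>' \<sigma>' A i j"
  using assms
proof (induction \<beta> \<sigma> A i j rule: lpp.induct)
  case (3 \<beta> \<sigma> A i j)
  have "lpp \<beta> \<sigma> A (Suc i) j \<le> lpp \<beta>' \<sigma>' A (Suc i) j"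
    using 3 by simp
  moreover have "lpp \<beta> \<sigma> A i (Suc j) \<le> lpp \<beta>' \<sigma>' A i (Suc j)"
    using 3 by simp
  ultimately show ?case by auto
qed auto

lemma lpp_add_const:
  "lpp (\<lambda>k. \<beta> k + c) (\<lambda>l. \<sigma> l + c) A i j = lpp \<beta> \<sigma> A i j + c"
  by (induction \<beta> \<sigma> A i j rule: lpp.induct) auto

text \<open>
  Max-plus linearity, the source of the comparison between different boundary parameters below.
\<close>

lemma lpp_max:
  "lpp (\<lambda>k. max (\<beta> k) (\<beta>' k)) (\<lambda>l. max (\<sigma> l) (\<sigma>' l)) A i j =
     max (lpp \<beta> \<sigma> A i j) (lpp \<beta>' \<sigma>' A i j)"
  by (induction \<beta> \<sigma> A i j rule: lpp.induct) auto

lemma lpp_nonexpansive: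
  assumes "\<And>k. k \<le> i \<Longrightarrow> \<bar>\<beta> k - \<beta>' k\<bar> \<le> d" "\<And>l. l \<le> j \<Longrightarrow> \<bar>\<sigma> l - \<sigma>' l\<bar> \<le> d"
  shows "\<bar>lpp \<beta> \<sigma> A i j - lpp \<beta>' \<sigma>' A i j\<bar> \<le> d"
proof -
  have "lpp \<beta> \<sigma> A i j \<le> lpp (\<lambda>k. \<beta>' k + d) (\<lambda>l. \<sigma>' l + d) A i j"
    using assms by (intro lpp_mono_boundary) (force simp: abs_le_iff)+
  moreover have "lpp \<beta>' \<sigma>' A i j \<le> lpp (\<lambda>k. \<beta> k + d) (\<lambda>l. \<sigma> l + d) A i j"
    using assms by (intro lpp_mono_boundary) (force simp: abs_le_iff)+
  ultimately show ?thesis by (simp add: lpp_add_const abs_le_iff)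
qed

abbreviation lpp0 :: "(nat \<Rightarrow> nat \<Rightarrow> bool) \<Rightarrow> nat \<Rightarrow> nat \<Rightarrow> real" where
  "lpp0 \<equiv> lpp (\<lambda>_. 0) (\<lambda>_. 0)"

lemma lpp0_nonneg: "0 \<le> lpp0 A i j"
proof (induction i arbitrary: j)
  case (Suc i)
  show ?case
  proof (cases j)
    case (Suc j')
    then show ?thesis using Suc.IH[of "Suc j'"]
      by (simp add: le_max_iff_disj)
  qed simp
qed simp

lemma lpp0_mono_col: "j \<le> j' \<Longrightarrow> lpp0 A i j \<le> lpp0 A i j'"
proof (induction rule: dec_induct)
  case (step n)
  have "lpp0 A i n \<le> lpp0 A i (Suc n)" by (cases i) auto
  with step show ?case by linarith
qed simp

text \<open>
  From \<open>(i, j)\<close> a path may continue upwards inside column \<open>j\<close> and collect every 1 it meets there.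
\<close>

lemma lpp0_column_path:
  assumes "1 \<le> j" "i \<le> i'"
  shows "lpp0 A i j + (\<Sum>k\<in>{i<..i'}. of_bool (A k j)) \<le> lpp0 A i' j"
  using assms(2)
proof (induction rule: dec_induct)
  case (step n)
  have "{i<..Suc n} = insert (Suc n) {i<..n}" using step by auto
  then have "(\<Sum>k\<in>{i<..Suc n}. of_bool (A k j)) =
      (\<Sum>k\<in>{i<..n}. of_bool (A k j)) + (of_bool (A (Suc n) j) :: real)"
    by (subst \<open>_ = _\<close>, subst sum.insert) auto
  moreover have "lpp0 A n j + of_bool (A (Suc n) j) \<le> lpp0 A (Suc n) j"
    using assms(1) by (cases j) auto
  ultimately show ?case using step.IH by linarith
qed simp

lemma lpp0_ge_column:
  assumes "n' < j" "j \<le> n" "m' \<le> m"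
  shows "lpp0 A m' n' + (\<Sum>k\<in>{m'<..m}. of_bool (A k j)) \<le> lpp0 A m n"
proof -
  have "lpp0 A m' n' \<le> lpp0 A m' j" using assms by (intro lpp0_mono_col) auto
  also have "\<dots> + (\<Sum>k\<in>{m'<..m}. of_bool (A k j)) \<le> lpp0 A m j"
    using assms by (intro lpp0_column_path) auto
  also have "lpp0 A m j \<le> lpp0 A m n" using assms by (intro lpp0_mono_col) auto
  finally show ?thesis by simp
qed

lemma lpp0_le_rows: "lpp0 A i j \<le> real i"
proof (induction i arbitrary: j)
  case (Suc i)
  show ?case
  proof (induction j)
    case (Suc j)
    have "lpp0 A i (Suc j) \<le> real i" by fact
    then show ?case using Suc by auto
  qed simp
qed simp

section \<open>Longest increasing paths\<close>

lemma increasing_path_snoc: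
  "increasing_path A m n (\<pi> @ [(i, j)]) \<longleftrightarrow>
     increasing_path A m n \<pi> \<and> 1 \<le> i \<and> i \<le> m \<and> 1 \<le> j \<and> j \<le> n \<and> A i j \<and>
     (\<forall>(i', j')\<in>set \<pi>. i' < i \<and> j' \<le> j)"
  unfolding increasing_path_def by (auto simp: sorted_wrt_append)

lemma increasing_path_mono:
  "increasing_path A m n \<pi> \<Longrightarrow> m \<le> m' \<Longrightarrow> n \<le> n' \<Longrightarrow> increasing_path A m' n' \<pi>"
  unfolding increasing_path_def by fastforce

lemma increasing_path_shrink:
  "increasing_path A m n \<pi> \<Longrightarrow> (\<And>i j. (i, j) \<in> set \<pi> \<Longrightarrow> i \<le> m' \<and> j \<le> n') \<Longrightarrow>
   increasing_path A m' n' \<pi>"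
  unfolding increasing_path_def by fastforce

text \<open>
  Induction on the last position \<open>(i, j)\<close> of the path: everything before it lies strictly below row \<open>i\<close> and
  weakly left of column \<open>j\<close>.
\<close>

lemma increasing_path_length_le_lpp0:
  "increasing_path A m n \<pi> \<Longrightarrow> real (length \<pi>) \<le> lpp0 A m n"
proof (induction \<pi> arbitrary: m n rule: rev_induct)
  case Nil
  then show ?case by (simp add: lpp0_nonneg)
next
  case (snoc x \<pi>)
  obtain i j where x: "x = (i, j)" by (cases x)
  have *: "increasing_path A m n \<pi>" "1 \<le> i" "i \<le> m" "1 \<le> j" "j \<le> n" "A i j"
    "\<And>i' j'. (i', j') \<in> set \<pi> \<Longrightarrow> i' < i \<and> j' \<le> j"
    using snoc.prems unfolding x increasing_path_snoc by auto
  obtain i0 where i0: "i = Suc i0" using *(2) by (cases i) auto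
  obtain j0 where j0: "j = Suc j0" using *(4) by (cases j) auto
  have "increasing_path A i0 j \<pi>"
    by (rule increasing_path_shrink[OF *(1)]) (use *(7) i0 in force)
  then have "real (length \<pi>) \<le> lpp0 A i0 j" by (rule snoc.IH)
  then have "real (length (\<pi> @ [x])) \<le> lpp0 A i j"
    using *(6) unfolding i0 j0 by simp
  also have "lpp0 A i j \<le> lpp0 A m n"
    using lpp0_column_path[of j i m A] lpp0_mono_col[of j n A m] * 
      sum_nonneg[of "{i<..m}" "\<lambda>k. of_bool (A k j) :: real"] by simp
  finally show ?case .
qed

lemma lpp0_attained: "\<exists>\<pi>. increasing_path A m n \<pi> \<and> real (length \<pi>) = lpp0 A m n"
proof (induction m arbitrary: n)
  case 0
  show ?case by (intro exI[of _ "[]"]) (simp add: increasing_path_def)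
next
  case (Suc m)
  note IH = Suc
  show ?case
  proof (induction n)
    case 0
    show ?case by (intro exI[of _ "[]"]) (simp add: increasing_path_def)
  next
    case (Suc n)
    have "lpp0 A (Suc m) (Suc n) = lpp0 A (Suc m) n \<or>
        lpp0 A (Suc m) (Suc n) = lpp0 A m (Suc n) + of_bool (A (Suc m) (Suc n))"
      by (simp add: max_def)
    then consider "lpp0 A (Suc m) (Suc n) = lpp0 A (Suc m) n"
      | "\<not> A (Suc m) (Suc n)" "lpp0 A (Suc m) (Suc n) = lpp0 A m (Suc n)"
      | "A (Suc m) (Suc n)" "lpp0 A (Suc m) (Suc n) = lpp0 A m (Suc n) + 1"
      by (cases "A (Suc m) (Suc n)") (auto simp del: lpp.simps)
    then show ?case
    proof cases
      case 1
      then show ?thesis using Suc increasing_path_mono[of A "Suc m" n _ "Suc m" "Suc n"] by auto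
    next
      case 2
      then show ?thesis using IH[of "Suc n"] increasing_path_mono[of A m "Suc n" _ "Suc m" "Suc n"]
        by auto
    next
      case 3
      obtain \<pi> where \<pi>: "increasing_path A m (Suc n) \<pi>" "real (length \<pi>) = lpp0 A m (Suc n)"
        using IH by blast
      have "increasing_path A (Suc m) (Suc n) (\<pi> @ [(Suc m, Suc n)])"
        unfolding increasing_path_snoc
        using \<pi>(1) 3 increasing_path_mono[OF \<pi>(1), of "Suc m" "Suc n"]
        by (auto simp: increasing_path_def)
      then show ?thesis using \<pi>(2) 3 by (intro exI[of _ "\<pi> @ [(Suc m, Suc n)]"]) simp
    qed
  qed
qed

lemma longest_path_eq_lpp0: "real (longest_path A m n) = lpp0 A m n"
proof -
  let ?L = "{length \<pi> |\<pi>. increasing_path A m n \<pi>}"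
  have le: "real l \<le> lpp0 A m n" if "l \<in> ?L" for l
    using that increasing_path_length_le_lpp0 by blast
  obtain \<pi> where \<pi>: "increasing_path A m n \<pi>" "real (length \<pi>) = lpp0 A m n"
    using lpp0_attained by blast
  have "?L \<subseteq> {..length \<pi>}" using le \<pi>(2) by force
  then have "Max ?L = length \<pi>"
    using \<pi>(1) le \<pi>(2) by (intro Max_eqI) (auto intro: finite_subset)
  then show ?thesis using \<pi>(2) unfolding longest_path_def by simp
qed

section \<open>The Burke property of a column\<close>

text \<open>
  One column viewed as a discrete-time queue.  Going up row by row, \<open>q\<close> is the queue length, the entry \<open>e\<close>
  of the array is an arrival and the increment \<open>x\<close> coming from the column on the left is an offered
  service; if \<open>u\<close>, \<open>v\<close> are the last-passage values in two neighbouring columns, then \<open>q\<close> is the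
  horizontal difference \<open>v i - u i\<close>.  The result lists the vertical increments of the new column.
\<close>

fun column :: "nat \<Rightarrow> bool list \<Rightarrow> bool list \<Rightarrow> bool list" where
  "column q (x # xs) (e # es) =
     (if q = 0 then x \<or> e else e) # column (q + of_bool e - of_bool x) xs es"
| "column q _ _ = []"

context
  fixes a p r :: real
  assumes a: "0 < a" "a < 1" and p: "0 \<le> p" "p < a"
    and r_def: "r = p * (1 - a) / (a * (1 - p))"
begin

lemma load_bounds: "0 \<le> r" "r < 1" "r * (a * (1 - p)) = p * (1 - a)"
proof -
  have "0 < a * (1 - p)" using a p by simp
  then show "0 \<le> r" "r * (a * (1 - p)) = p * (1 - a)" using a p by (simp_all add: r_def)
  show "r < 1" using \<open>0 < a * (1 - p)\<close> a p unfolding r_def by (simp add: field_simps)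
qed

lemma pmf_bind_bernoulli:
  "0 \<le> x \<Longrightarrow> x \<le> 1 \<Longrightarrow>
   pmf (bind_pmf (bernoulli_pmf x) f) z = x * pmf (f True) z + (1 - x) * pmf (f False) z"
  by (simp add: pmf_bind)

text \<open>
  The local Burke property: for this ratio \<open>r\<close> the weight of a queue of length \<open>k\<close> balances an arrival without
  service against a service without arrival, and the resulting pair of vertical increment and queue length is
  again independent with the laws of the incoming pair.
\<close>

lemma burke_site:
  "do {q \<leftarrow> geometric_pmf (1 - r); x \<leftarrow> bernoulli_pmf a; e \<leftarrow> bernoulli_pmf p;
       return_pmf (if q = 0 then x \<or> e else e, q + of_bool e - of_bool x)} =
   pair_pmf (bernoulli_pmf a) (geometric_pmf (1 - r))" (is "?L = ?R")
proof (rule pmf_eqI)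
  fix z :: "bool \<times> nat"
  obtain y k where z: "z = (y, k)" by (cases z)
  let ?g = "\<lambda>k. (1 - r) * r ^ k"
  have g: "pmf (geometric_pmf (1 - r)) k = ?g k" for k
    using load_bounds by simp
  have L: "?L = do {x \<leftarrow> bernoulli_pmf a; e \<leftarrow> bernoulli_pmf p;
       map_pmf (\<lambda>q. (if q = 0 then x \<or> e else e, q + of_bool e - of_bool x)) (geometric_pmf (1 - r))}"
    unfolding map_pmf_def
    by (subst bind_commute_pmf, subst (2) bind_commute_pmf) simp
  have tt: "(\<lambda>q::nat. (if q = 0 then True \<or> True else True, q + of_bool True - of_bool True)) -` {(y, k)}
        = (if y then {k} else {})" by (auto split: if_splits)
  have tf: "(\<lambda>q::nat. (if q = 0 then True \<or> False else False, q + of_bool False - of_bool True)) -` {(y, k)}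
        = (if y then if k = 0 then {0} else {} else {Suc k})" by (auto split: if_splits)
  have ft: "(\<lambda>q::nat. (if q = 0 then False \<or> True else True, q + of_bool True - of_bool False)) -` {(y, k)}
        = (if y then if k = 0 then {} else {k - 1} else {})" by (auto split: if_splits)
  have ff: "(\<lambda>q::nat. (if q = 0 then False \<or> False else False, q + of_bool False - of_bool False)) -` {(y, k)}
        = (if y then {} else {k})" by (auto split: if_splits)
  have "pmf ?L z = a * (p * (if y then ?g k else 0) +
        (1 - p) * (if y then if k = 0 then ?g 0 else 0 else ?g (Suc k))) +
      (1 - a) * (p * (if y then if k = 0 then 0 else ?g (k - 1) else 0) +
        (1 - p) * (if y then 0 else ?g k))"
    unfolding L z using a p
    by (simp only: pmf_bind_bernoulli pmf_map tt tf ft ff less_imp_le order.trans[of p a 1])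
       (auto simp: measure_pmf_single g simp del: pmf_geometric)
  also have "\<dots> = (if y then a else 1 - a) * ?g k"
  proof (cases y)
    case True
    show ?thesis
    proof (cases k)
      case 0
      then show ?thesis using True by (simp add: algebra_simps)
    next
      case (Suc k')
      have "a * p * r + (1 - a) * p = a * r" using load_bounds(3) by (simp add: algebra_simps)
      then have "(a * p * r + (1 - a) * p) * ?g k' = a * r * ?g k'" by simp
      then show ?thesis using True Suc by (simp add: algebra_simps)
    qed
  next
    case False
    have "(r * (a * (1 - p)) + (1 - a) * (1 - p)) * ?g k = (1 - a) * ?g k"
      unfolding load_bounds(3) by (simp add: algebra_simps)
    then show ?thesis using False by (simp add: algebra_simps)
  qed
  also have "\<dots> = pmf ?R z"
    using a unfolding z pmf_pair g by (cases y) auto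
  finally show "pmf ?L z = pmf ?R z" .
qed

lemma burke_site_bind:
  "do {q \<leftarrow> geometric_pmf (1 - r); x \<leftarrow> bernoulli_pmf a; e \<leftarrow> bernoulli_pmf p;
       f (if q = 0 then x \<or> e else e) (q + of_bool e - of_bool x)} =
   do {x \<leftarrow> bernoulli_pmf a; q \<leftarrow> geometric_pmf (1 - r); f x q}"
  using arg_cong[OF burke_site, of "\<lambda>P. bind_pmf P (\<lambda>(x, q). f x q)"]
  by (simp add: bind_assoc_pmf bind_return_pmf pair_pmf_def)

text \<open>
  The product law at one site is handed on to the next site upwards, so a queue in equilibrium turns independent
  Bernoulli(\<open>a\<close>) increments into independent Bernoulli(\<open>a\<close>) increments.
\<close>

lemma burke_column:
  "do {q \<leftarrow> geometric_pmf (1 - r); xs \<leftarrow> replicate_pmf m (bernoulli_pmf a);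
       es \<leftarrow> replicate_pmf m (bernoulli_pmf p); return_pmf (column q xs es)} =
   replicate_pmf m (bernoulli_pmf a)"
proof (induction m)
  case 0
  show ?case by (simp add: bind_return_pmf)
next
  case (Suc m)
  let ?f = "\<lambda>x q. do {xs \<leftarrow> replicate_pmf m (bernoulli_pmf a);
       es \<leftarrow> replicate_pmf m (bernoulli_pmf p); return_pmf (x # column q xs es)}"
  have "do {q \<leftarrow> geometric_pmf (1 - r); xs \<leftarrow> replicate_pmf (Suc m) (bernoulli_pmf a);
       es \<leftarrow> replicate_pmf (Suc m) (bernoulli_pmf p); return_pmf (column q xs es)} =
     do {q \<leftarrow> geometric_pmf (1 - r); x \<leftarrow> bernoulli_pmf a;
       xs \<leftarrow> replicate_pmf m (bernoulli_pmf a); e \<leftarrow> bernoulli_pmf p;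
       es \<leftarrow> replicate_pmf m (bernoulli_pmf p); return_pmf (column q (x # xs) (e # es))}"
    by (simp add: bind_assoc_pmf bind_return_pmf)
  also have "\<dots> = do {q \<leftarrow> geometric_pmf (1 - r); x \<leftarrow> bernoulli_pmf a; e \<leftarrow> bernoulli_pmf p;
       ?f (if q = 0 then x \<or> e else e) (q + of_bool e - of_bool x)}"
    by (subst bind_commute_pmf[of "replicate_pmf m (bernoulli_pmf a)" "bernoulli_pmf p"]) simp
  also have "\<dots> = do {x \<leftarrow> bernoulli_pmf a; q \<leftarrow> geometric_pmf (1 - r); ?f x q}"
    by (rule burke_site_bind)
  also have "\<dots> = do {x \<leftarrow> bernoulli_pmf a; ys \<leftarrow> do {q \<leftarrow> geometric_pmf (1 - r);
       xs \<leftarrow> replicate_pmf m (bernoulli_pmf a);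
       es \<leftarrow> replicate_pmf m (bernoulli_pmf p); return_pmf (column q xs es)}; return_pmf (x # ys)}"
    by (simp add: bind_assoc_pmf bind_return_pmf)
  also have "\<dots> = replicate_pmf (Suc m) (bernoulli_pmf a)"
    unfolding Suc.IH by simp
  finally show ?case .
qed

end

text \<open>
  The vertical increments along column \<open>j\<close>, when \<open>xs\<close> are those along column 0 and \<open>J\<close> the horizontal ones along row 0.
\<close>

fun outputs :: "bool list \<Rightarrow> (nat \<Rightarrow> nat) \<Rightarrow> (nat \<Rightarrow> bool list) \<Rightarrow> nat \<Rightarrow> bool list" where
  "outputs xs J c 0 = xs"
| "outputs xs J c (Suc j) = column (J (Suc j)) (outputs xs J c j) (c (Suc j))"

lemma outputs_cong:
  "(\<And>i. 1 \<le> i \<Longrightarrow> i \<le> j \<Longrightarrow> J i = J' i) \<Longrightarrow> (\<And>i. 1 \<le> i \<Longrightarrow> i \<le> j \<Longrightarrow> c i = c' i) \<Longrightarrow>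
   outputs xs J c j = outputs xs J' c' j"
  by (induction j) auto

text \<open>
  The ratio of the geometric equilibrium law of a queue with arrival rate \<open>p\<close> and service rate \<open>a\<close>.
\<close>

definition load :: "real \<Rightarrow> real \<Rightarrow> real" where
  "load a p = p * (1 - a) / (a * (1 - p))"

definition bottom_pmf :: "real \<Rightarrow> (nat \<Rightarrow> real) \<Rightarrow> nat \<Rightarrow> (nat \<Rightarrow> nat) pmf" where
  "bottom_pmf a q n = Pi_pmf {1..n} 0 (\<lambda>j. geometric_pmf (1 - load a (q j)))"

definition array_pmf :: "nat \<Rightarrow> (nat \<Rightarrow> real) \<Rightarrow> nat \<Rightarrow> (nat \<Rightarrow> bool list) pmf" where
  "array_pmf m q n = Pi_pmf {1..n} [] (\<lambda>j. replicate_pmf m (bernoulli_pmf (q j)))"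

lemma burke_outputs:
  assumes a: "0 < a" "a < 1" and q: "\<And>j. 1 \<le> j \<Longrightarrow> j \<le> n \<Longrightarrow> 0 \<le> q j \<and> q j < a"
  shows "do {xs \<leftarrow> replicate_pmf m (bernoulli_pmf a); J \<leftarrow> bottom_pmf a q n; c \<leftarrow> array_pmf m q n;
       return_pmf (outputs xs J c n)} = replicate_pmf m (bernoulli_pmf a)"
  using q
proof (induction n)
  case 0
  show ?case by (simp add: bottom_pmf_def array_pmf_def bind_return_pmf bind_return_pmf')
next
  case (Suc n)
  have ins: "{1..Suc n} = insert (Suc n) {1..n}" by auto
  let ?g = "geometric_pmf (1 - load a (q (Suc n)))"
  let ?e = "replicate_pmf m (bernoulli_pmf (q (Suc n)))"
  let ?a = "replicate_pmf m (bernoulli_pmf a)"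
  have J: "bottom_pmf a q (Suc n) = do {y \<leftarrow> ?g; J \<leftarrow> bottom_pmf a q n; return_pmf (J(Suc n := y))}"
    unfolding bottom_pmf_def ins by (subst Pi_pmf_insert') auto
  have c: "array_pmf m q (Suc n) = do {es \<leftarrow> ?e; c \<leftarrow> array_pmf m q n; return_pmf (c(Suc n := es))}"
    unfolding array_pmf_def ins by (subst Pi_pmf_insert') auto
  have upd: "outputs xs (J(Suc n := y)) (c(Suc n := es)) n = outputs xs J c n" for xs J y c es
    by (rule outputs_cong) auto
  have "do {xs \<leftarrow> ?a; J \<leftarrow> bottom_pmf a q (Suc n); c \<leftarrow> array_pmf m q (Suc n);
        return_pmf (outputs xs J c (Suc n))} =
    do {xs \<leftarrow> ?a; y \<leftarrow> ?g; J \<leftarrow> bottom_pmf a q n; es \<leftarrow> ?e; c \<leftarrow> array_pmf m q n;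
        return_pmf (column y (outputs xs J c n) es)}"
    unfolding J c by (simp add: bind_assoc_pmf bind_return_pmf upd)
  also have "\<dots> = do {xs \<leftarrow> ?a; y \<leftarrow> ?g; J \<leftarrow> bottom_pmf a q n; c \<leftarrow> array_pmf m q n; es \<leftarrow> ?e; 
        return_pmf (column y (outputs xs J c n) es)}"
    by (subst (2) bind_commute_pmf) simp
  also have "\<dots> = do {xs \<leftarrow> ?a; J \<leftarrow> bottom_pmf a q n; c \<leftarrow> array_pmf m q n; y \<leftarrow> ?g; es \<leftarrow> ?e; 
        return_pmf (column y (outputs xs J c n) es)}"
    by (subst (2) bind_commute_pmf, subst (3) bind_commute_pmf) simp
  also have "\<dots> = do {zs \<leftarrow> do {xs \<leftarrow> ?a; J \<leftarrow> bottom_pmf a q n; c \<leftarrow> array_pmf m q n;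
        return_pmf (outputs xs J c n)}; y \<leftarrow> ?g; es \<leftarrow> ?e; return_pmf (column y zs es)}"
    by (simp add: bind_assoc_pmf bind_return_pmf)
  also have "\<dots> = do {zs \<leftarrow> ?a; y \<leftarrow> ?g; es \<leftarrow> ?e; return_pmf (column y zs es)}"
    by (subst Suc.IH) (use Suc.prems in auto)
  also have "\<dots> = do {y \<leftarrow> ?g; zs \<leftarrow> ?a; es \<leftarrow> ?e; return_pmf (column y zs es)}"
    by (subst bind_commute_pmf) simp
  also have "\<dots> = ?a"
    by (rule burke_column) (use a Suc.prems in \<open>auto simp: load_def\<close>)
  finally show ?case .
qed

section \<open>Concentration for a fixed environment\<close>

lemma exp_le_quadratic:
  fixes x :: real assumes "\<bar>x\<bar> \<le> 1" shows "exp x \<le> 1 + x + x\<^sup>2"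
proof (cases "0 \<le> x")
  case True
  then show ?thesis using assms by (intro exp_bound) auto
next
  case False
  define y where "y = - x"
  have y: "0 < y" "y \<le> 1" using False assms by (auto simp: y_def)
  have "exp x = 1 / exp y" by (simp add: y_def exp_minus field_simps)
  also have "\<dots> \<le> 1 / (1 + y)" using y by (intro divide_left_mono) auto
  also have "\<dots> \<le> 1 - y + y\<^sup>2"
  proof -
    have "1 \<le> (1 - y + y\<^sup>2) * (1 + y)" using y by (simp add: algebra_simps power2_eq_square)
    then show ?thesis using y by (simp add: pos_divide_le_eq)
  qed
  finally show ?thesis by (simp add: y_def)
qed

lemma geometric_mgf:
  fixes r \<theta> :: real
  assumes "0 \<le> r" "r < 1" "r * exp \<theta> < 1"
  shows "(\<integral>\<^sup>+ k. exp (\<theta> * real k) \<partial>geometric_pmf (1 - r)) = ennreal ((1 - r) / (1 - r * exp \<theta>))"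
proof -
  have "(\<integral>\<^sup>+ k. exp (\<theta> * real k) \<partial>geometric_pmf (1 - r)) =
      (\<Sum>k. ennreal ((1 - r) * (r * exp \<theta>) ^ k))"
    using assms
  proof (subst nn_integral_measure_pmf, subst nn_integral_count_space_nat, intro suminf_cong)
    fix k
    have "pmf (geometric_pmf (1 - r)) k * exp (\<theta> * real k) = (1 - r) * (r * exp \<theta>) ^ k"
      using assms by (simp add: power_mult_distrib exp_of_nat2_mult)
    then show "ennreal (pmf (geometric_pmf (1 - r)) k) * ennreal (exp (\<theta> * real k)) =
        ennreal ((1 - r) * (r * exp \<theta>) ^ k)"
      by (metis ennreal_mult' pmf_nonneg)
  qed
  also have "(\<lambda>k. (1 - r) * (r * exp \<theta>) ^ k) sums ((1 - r) * (1 / (1 - r * exp \<theta>)))"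
    using assms by (intro sums_mult geometric_sums) auto
  then have "(\<Sum>k. ennreal ((1 - r) * (r * exp \<theta>) ^ k)) = ennreal ((1 - r) / (1 - r * exp \<theta>))"
    using assms by (intro suminf_ennreal_eq) auto
  finally show ?thesis .
qed

text \<open>
  Writing \<open>\<mu> = r / (1 - r)\<close>, the moment generating function is \<open>1 / (1 - u)\<close> with \<open>u = \<mu> (exp \<theta> - 1)\<close>, and
  \<open>- ln (1 - u) \<le> u + 2 u\<^sup>2\<close>.  The bound depends on \<open>r\<close> only through the bound \<open>K\<close> for the mean; this
  makes all later estimates uniform over the environments.
\<close>

lemma geometric_centered_mgf:
  fixes r \<theta> K :: real
  defines "\<mu> \<equiv> r / (1 - r)"
  assumes r: "0 \<le> r" "r < 1" and K: "\<mu> \<le> K" "1 \<le> K" and \<theta>: "4 * K * \<bar>\<theta>\<bar> \<le> 1"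
  shows "(\<integral>\<^sup>+ k. exp (\<theta> * (real k - \<mu>)) \<partial>geometric_pmf (1 - r)) \<le> ennreal (exp (9 * K\<^sup>2 * \<theta>\<^sup>2))"
proof -
  define u where "u = \<mu> * (exp \<theta> - 1)"
  have \<mu>: "0 \<le> \<mu>" using r by (simp add: \<mu>_def)
  have "1 * \<bar>\<theta>\<bar> \<le> K * \<bar>\<theta>\<bar>" using K by (intro mult_right_mono) auto
  with \<theta> have \<theta>1: "\<bar>\<theta>\<bar> \<le> 1/4" by simp
  have up: "exp \<theta> - 1 \<le> \<theta> + \<theta>\<^sup>2" using exp_le_quadratic[of \<theta>] \<theta>1 by simp
  have "\<theta>\<^sup>2 \<le> \<bar>\<theta>\<bar>" using \<theta>1 mult_right_mono[of "\<bar>\<theta>\<bar>" 1 "\<bar>\<theta>\<bar>"]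
    by (simp add: power2_eq_square)
  then have ab: "\<bar>exp \<theta> - 1\<bar> \<le> 2 * \<bar>\<theta>\<bar>"
    using up exp_ge_add_one_self[of \<theta>] by linarith
  have "\<bar>u\<bar> \<le> \<mu> * (2 * \<bar>\<theta>\<bar>)"
    unfolding u_def abs_mult using ab \<mu> by (intro mult_mono) auto
  also have "\<dots> \<le> K * (2 * \<bar>\<theta>\<bar>)" using K by (intro mult_right_mono) auto
  finally have u: "\<bar>u\<bar> \<le> K * (2 * \<bar>\<theta>\<bar>)" .
  with \<theta> have u2: "\<bar>u\<bar> \<le> 1/2" by simp
  have eq: "1 - r * exp \<theta> = (1 - r) * (1 - u)"
    using r by (simp add: u_def \<mu>_def field_simps)
  have "0 < (1 - r) * (1 - u)" using r u2 by (intro mult_pos_pos) auto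
  then have lt: "r * exp \<theta> < 1" using eq by linarith
  have "(1 - r) / (1 - r * exp \<theta>) = exp (- ln (1 + - u))"
  proof -
    have "(1 - r) / ((1 - r) * (1 - u)) = 1 / (1 - u)" using r by simp
    also have "\<dots> = exp (- ln (1 + - u))"
      using u2 by (simp add: exp_minus inverse_eq_divide)
    finally show ?thesis by (simp add: eq)
  qed
  also have "\<dots> \<le> exp (u + 2 * u\<^sup>2)"
    using abs_ln_one_plus_x_minus_x_bound[of "-u"] u2 by (auto simp: abs_le_iff)
  also have "u + 2 * u\<^sup>2 \<le> \<mu> * \<theta> + 9 * K\<^sup>2 * \<theta>\<^sup>2"
  proof -
    have "u \<le> \<mu> * (\<theta> + \<theta>\<^sup>2)" unfolding u_def using \<mu> up by (intro mult_left_mono) auto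
    moreover have "u\<^sup>2 \<le> (K * (2 * \<bar>\<theta>\<bar>))\<^sup>2" using u by (metis abs_ge_zero power2_abs power_mono)
    moreover have "\<mu> * \<theta>\<^sup>2 \<le> K\<^sup>2 * \<theta>\<^sup>2"
      using K \<mu> mult_mono[of \<mu> K 1 K] by (intro mult_right_mono) (auto simp: power2_eq_square)
    ultimately show ?thesis by (simp add: power_mult_distrib algebra_simps)
  qed
  finally have bd: "(1 - r) / (1 - r * exp \<theta>) \<le> exp (\<mu> * \<theta> + 9 * K\<^sup>2 * \<theta>\<^sup>2)" by simp
  have "(\<integral>\<^sup>+ k. exp (\<theta> * (real k - \<mu>)) \<partial>geometric_pmf (1 - r)) =
      (\<integral>\<^sup>+ k. ennreal (exp (- \<theta> * \<mu>)) * ennreal (exp (\<theta> * real k)) \<partial>geometric_pmf (1 - r))"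
    by (intro nn_integral_cong) (simp add: ennreal_mult[symmetric] exp_add[symmetric] algebra_simps)
  also have "\<dots> = ennreal (exp (- \<theta> * \<mu>)) * ennreal ((1 - r) / (1 - r * exp \<theta>))"
    by (subst nn_integral_cmult) (auto simp: geometric_mgf[OF r lt])
  also have "\<dots> \<le> ennreal (exp (- \<theta> * \<mu>)) * ennreal (exp (\<mu> * \<theta> + 9 * K\<^sup>2 * \<theta>\<^sup>2))"
    by (intro mult_left_mono ennreal_leI bd) auto
  also have "\<dots> = ennreal (exp (9 * K\<^sup>2 * \<theta>\<^sup>2))"
    by (simp add: ennreal_mult[symmetric] exp_add[symmetric] mult.commute)
  finally show ?thesis .
qed

text \<open>
  The mean of the geometric equilibrium law; its expectation over the environment is the linear term of the limit.
\<close>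

definition queue_mean :: "real \<Rightarrow> real \<Rightarrow> real" where
  "queue_mean a p = p * (1 - a) / (a - p)"

lemma load_equilibrium:
  assumes "0 < a" "a < 1" "0 \<le> p" "p < a"
  shows "0 \<le> load a p" "load a p < 1"
    "load a p / (1 - load a p) = queue_mean a p"
proof -
  let ?r = "load a p"
  have pos: "0 < a * (1 - p)" using assms by simp
  show "0 \<le> ?r" "?r < 1"
    using load_bounds[OF assms refl] by (auto simp: load_def)
  have "1 - ?r = (a * (1 - p) - p * (1 - a)) / (a * (1 - p))"
    using assms unfolding load_def diff_divide_distrib by simp
  also have "a * (1 - p) - p * (1 - a) = a - p" by algebra
  finally have "1 - ?r = (a - p) / (a * (1 - p))" .
  then show "?r / (1 - ?r) = queue_mean a p"
    using pos assms by (simp add: load_def queue_mean_def)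
qed

text \<open>
  Chernoff bound; the sign \<open>s\<close> selects the upper or the lower tail.
\<close>

lemma bottom_upper_tail:
  assumes a: "0 < a" "a < 1" and q: "\<And>j. 1 \<le> j \<Longrightarrow> j \<le> n \<Longrightarrow> 0 \<le> q j \<and> q j < a \<and> queue_mean a (q j) \<le> K"
    and K: "1 \<le> K" and \<theta>: "4 * K * \<theta> \<le> 1" "0 < \<theta>" and l: "l \<le> n" and s: "\<bar>s\<bar> = 1"
  shows "measure_pmf.prob (bottom_pmf a q n)
      {J. t \<le> s * (\<Sum>j=1..l. real (J j) - queue_mean a (q j))} \<le> exp (9 * K\<^sup>2 * \<theta>\<^sup>2 * real l - \<theta> * t)"
proof -
  let ?P = "bottom_pmf a q n"
  let ?\<mu> = "\<lambda>j. queue_mean a (q j)"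
  let ?h = "\<lambda>j k. if j \<le> l then ennreal (exp (s * \<theta> * (real k - ?\<mu> j))) else 1"
  let ?X = "\<lambda>J. s * (\<Sum>j=1..l. real (J j) - ?\<mu> j)"
  have int: "(\<integral>\<^sup>+ J. ennreal (exp (\<theta> * ?X J)) \<partial>?P) \<le> ennreal (exp (9 * K\<^sup>2 * \<theta>\<^sup>2 * real l))"
  proof -
    have "(\<integral>\<^sup>+ J. ennreal (exp (\<theta> * ?X J)) \<partial>?P) = (\<integral>\<^sup>+ J. (\<Prod>j\<in>{1..n}. ?h j (J j)) \<partial>?P)"
    proof (intro nn_integral_cong)
      fix J
      have "ennreal (exp (\<theta> * ?X J)) = (\<Prod>j=1..l. ennreal (exp (s * \<theta> * (real (J j) - ?\<mu> j))))"
        by (simp add: prod_ennreal exp_sum[symmetric] sum_distrib_left mult_ac)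
      also have "\<dots> = (\<Prod>j\<in>{1..n}. ?h j (J j))"
        using l by (intro prod.mono_neutral_cong_left) auto
      finally show "ennreal (exp (\<theta> * ?X J)) = \<dots>" .
    qed
    also have "\<dots> = (\<Prod>j\<in>{1..n}. \<integral>\<^sup>+ k. ?h j k \<partial>geometric_pmf (1 - load a (q j)))"
      unfolding bottom_pmf_def by (subst nn_integral_prod_Pi_pmf) auto
    also have "\<dots> \<le> (\<Prod>j\<in>{1..n}. if j \<le> l then ennreal (exp (9 * K\<^sup>2 * \<theta>\<^sup>2)) else 1)"
    proof (intro prod_mono_ennreal)
      fix j assume j: "j \<in> {1..n}"
      note qr = load_equilibrium[OF a, of "q j"]
      have st: "4 * K * \<bar>s * \<theta>\<bar> \<le> 1" using s \<theta> by (simp add: abs_mult)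
      have "(s * \<theta>)\<^sup>2 = \<theta>\<^sup>2" using s by (metis abs_mult mult_1 power2_abs)
      then show "(\<integral>\<^sup>+ k. ?h j k \<partial>geometric_pmf (1 - load a (q j))) \<le>
        (if j \<le> l then ennreal (exp (9 * K\<^sup>2 * \<theta>\<^sup>2)) else 1)"
        using geometric_centered_mgf[OF qr(1,2), of K "s * \<theta>"] q[of j] j K st qr(3) by auto
    qed
    also have "\<dots> = (\<Prod>j\<in>{1..l}. ennreal (exp (9 * K\<^sup>2 * \<theta>\<^sup>2)))"
      using l by (intro prod.mono_neutral_cong_right) auto
    also have "\<dots> = ennreal (exp (9 * K\<^sup>2 * \<theta>\<^sup>2 * real l))"
      by (simp add: ennreal_power exp_of_nat_mult[symmetric] mult_ac)
    finally show ?thesis .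
  qed
  have "emeasure ?P {J. t \<le> ?X J} \<le> emeasure ?P {J. 1 \<le> ennreal (exp (- \<theta> * t)) * ennreal (exp (\<theta> * ?X J))}"
    using \<theta> by (intro emeasure_mono) (auto simp: ennreal_mult[symmetric] exp_add[symmetric] simp del: ennreal_1 simp flip: ennreal_1)
  also have "\<dots> = emeasure ?P ({J\<in>space ?P. 1 \<le> ennreal (exp (- \<theta> * t)) * ennreal (exp (\<theta> * ?X J))} \<inter> space ?P)"
    by simp
  also have "\<dots> \<le> ennreal (exp (- \<theta> * t)) * (\<integral>\<^sup>+ J. ennreal (exp (\<theta> * ?X J)) * indicator (space ?P) J \<partial>?P)"
    by (intro order.trans[OF _ nn_integral_Markov_inequality]) auto
  also have "\<dots> \<le> ennreal (exp (- \<theta> * t)) * ennreal (exp (9 * K\<^sup>2 * \<theta>\<^sup>2 * real l))"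
    using int by (intro mult_left_mono) auto
  also have "\<dots> = ennreal (exp (9 * K\<^sup>2 * \<theta>\<^sup>2 * real l - \<theta> * t))"
    by (simp add: ennreal_mult[symmetric] exp_add[symmetric])
  finally show ?thesis by (simp add: measure_pmf.emeasure_eq_measure)
qed

lemma bottom_tail:
  assumes a: "0 < a" "a < 1" and q: "\<And>j. 1 \<le> j \<Longrightarrow> j \<le> n \<Longrightarrow> 0 \<le> q j \<and> q j < a \<and> queue_mean a (q j) \<le> K"
    and K: "1 \<le> K" and \<theta>: "4 * K * \<theta> \<le> 1" "0 < \<theta>" and l: "l \<le> n"
  shows "measure_pmf.prob (bottom_pmf a q n)
      {J. t \<le> \<bar>(\<Sum>j=1..l. real (J j)) - (\<Sum>j=1..l. queue_mean a (q j))\<bar>} \<le>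
      2 * exp (9 * K\<^sup>2 * \<theta>\<^sup>2 * real n - \<theta> * t)"
proof -
  let ?P = "bottom_pmf a q n"
  let ?E = "\<lambda>s. {J. t \<le> s * (\<Sum>j=1..l. real (J j) - queue_mean a (q j))}"
  have "measure_pmf.prob ?P {J. t \<le> \<bar>(\<Sum>j=1..l. real (J j)) - (\<Sum>j=1..l. queue_mean a (q j))\<bar>}
      \<le> measure_pmf.prob ?P (?E 1 \<union> ?E (-1))"
    by (intro measure_pmf.finite_measure_mono) (auto simp: sum_subtractf abs_if split: if_splits)
  also have "\<dots> \<le> measure_pmf.prob ?P (?E 1) + measure_pmf.prob ?P (?E (-1))"
    by (intro measure_Un_le) auto
  also have "\<dots> \<le> 2 * exp (9 * K\<^sup>2 * \<theta>\<^sup>2 * real l - \<theta> * t)"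
    using bottom_upper_tail[where s = 1 and q = q and t = t, OF a q K \<theta> l] bottom_upper_tail[where s = "-1" and q = q and t = t, OF a q K \<theta> l]
    by (simp add: add_mono)
  also have "\<dots> \<le> 2 * exp (9 * K\<^sup>2 * \<theta>\<^sup>2 * real n - \<theta> * t)"
    using l by (auto intro!: mult_left_mono)
  finally show ?thesis .
qed

definition ones :: "bool list \<Rightarrow> real" where "ones xs = real (length (filter id xs))"

lemma ones_simps [simp]: "ones [] = 0" "ones (x # xs) = of_bool x + ones xs"
  by (auto simp: ones_def)

lemma map_take_replicate_pmf:
  "k \<le> m \<Longrightarrow> map_pmf (take k) (replicate_pmf m p) = replicate_pmf k p"
proof -
  assume "k \<le> m"
  then obtain d where m: "m = k + d" using le_Suc_ex by blast
  have "map_pmf (take k) (replicate_pmf m p) =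
    do {xs \<leftarrow> replicate_pmf k p; ys \<leftarrow> replicate_pmf d p; return_pmf (take k (xs @ ys))}"
    by (simp add: m replicate_pmf_distrib map_bind_pmf)
  also have "\<dots> = do {xs \<leftarrow> replicate_pmf k p; ys \<leftarrow> replicate_pmf d p; return_pmf xs}"
    by (intro bind_pmf_cong refl) (auto simp: set_replicate_pmf)
  finally show ?thesis by (simp add: bind_return_pmf')
qed

lemma ones_tail:
  assumes a: "0 \<le> a" "a \<le> 1" and k: "k \<le> m" and t: "0 < t"
  shows "measure_pmf.prob (replicate_pmf m (bernoulli_pmf a)) {xs. t \<le> \<bar>ones (take k xs) - a * real k\<bar>}
    \<le> 2 * exp (- 2 * t\<^sup>2 / real m)"
proof (cases "k = 0")
  case True
  then show ?thesis using t by simp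
next
  case False
  interpret binomial_distribution k a by unfold_locales (use a in auto)
  have "measure_pmf.prob (replicate_pmf m (bernoulli_pmf a)) {xs. t \<le> \<bar>ones (take k xs) - a * real k\<bar>} =
    measure_pmf.prob (map_pmf (length \<circ> filter id) (map_pmf (take k) (replicate_pmf m (bernoulli_pmf a))))
      {x. \<bar>real x - real k * a\<bar> \<ge> t}"
    by (simp add: pmf.map_comp vimage_def ones_def mult.commute)
  also have "\<dots> = measure_pmf.prob (binomial_pmf k a) {x. \<bar>real x - real k * a\<bar> \<ge> t}"
    using a by (simp add: map_take_replicate_pmf k binomial_pmf_altdef)
  also have "\<dots> \<le> 2 * exp (- 2 * t\<^sup>2 / real k)"
    using False t by (intro prob_abs_ge) auto
  also have "\<dots> \<le> 2 * exp (- 2 * t\<^sup>2 / real m)"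
    using False k by (auto simp: divide_left_mono)
  finally show ?thesis .
qed

definition entries :: "(nat \<Rightarrow> bool list) \<Rightarrow> nat \<Rightarrow> nat \<Rightarrow> bool" where
  "entries c i j = c j ! (i - 1)"

text \<open>
  Increments are conserved at every site: \<open>x\<close> plus the new queue length equals the old queue length plus the
  outgoing increment.  Hence the queue recursion and the last-passage recursion describe the same heights.
\<close>

lemma column_profile:
  assumes "length es = length xs" "\<And>i. i \<le> length xs \<Longrightarrow> u i = d + ones (take i xs)"
    "v 0 = d + real q" "\<And>i. i < length xs \<Longrightarrow> v (Suc i) = max (u (Suc i)) (v i + of_bool (es ! i))"
  shows "\<forall>i\<le>length xs. v i = d + real q + ones (take i (column q xs es))"
  using assms
proof (induction q xs es arbitrary: u v d rule: column.induct)
  case (1 q x xs e es)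
  let ?q = "q + of_bool e - of_bool x :: nat"
  have v1: "v 1 = d + of_bool x + real ?q"
    using 1(3)[of 1] 1(4) 1(5)[of 0] by (cases x; cases e; cases q) auto
  have "\<forall>i\<le>length xs. v (Suc i) = (d + of_bool x) + real ?q + ones (take i (column ?q xs es))"
  proof (rule 1(1))
    show "length es = length xs" using 1 by simp
    show "u (Suc i) = d + of_bool x + ones (take i xs)" if "i \<le> length xs" for i
      using 1(3)[of "Suc i"] that by simp
    show "v (Suc 0) = d + of_bool x + real ?q" using v1 by simp
    show "v (Suc (Suc i)) = max (u (Suc (Suc i))) (v (Suc i) + of_bool (es ! i))" if "i < length xs" for i
      using 1(5)[of "Suc i"] that by simp
  qed
  moreover have "of_bool x + real ?q = real q + of_bool (if q = 0 then x \<or> e else e)"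
    by (cases x; cases e; cases q) auto
  ultimately have *: "v (Suc i) = d + real q + of_bool (if q = 0 then x \<or> e else e) +
      ones (take i (column ?q xs es))" if "i \<le> length xs" for i
    using that by (metis (no_types, lifting) add.assoc)
  show ?case
  proof (intro allI impI)
    fix i assume "i \<le> length (x # xs)"
    then show "v i = d + real q + ones (take i (column q (x # xs) (e # es)))"
      using * 1(4) by (cases i) auto
  qed
qed auto

lemma length_column: "length es = length xs \<Longrightarrow> length (column q xs es) = length xs"
  by (induction q xs es rule: column.induct) auto

lemma length_outputs:
  "(\<And>j. 1 \<le> j \<Longrightarrow> j \<le> n \<Longrightarrow> length (c j) = length xs) \<Longrightarrow> length (outputs xs J c n) = length xs"
  by (induction n) (auto simp: length_column)

lemma lpp_eq_outputs:
  assumes "\<And>j. 1 \<le> j \<Longrightarrow> j \<le> n \<Longrightarrow> length (c j) = length xs"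
  shows "\<forall>i\<le>length xs. lpp (\<lambda>k. ones (take k xs)) (\<lambda>l. \<Sum>j=1..l. real (J j)) (entries c) i n =
     (\<Sum>j=1..n. real (J j)) + ones (take i (outputs xs J c n))"
  using assms
proof (induction n)
  case 0
  show ?case
  proof (intro allI impI)
    fix i
    show "lpp (\<lambda>k. ones (take k xs)) (\<lambda>l. \<Sum>j=1..l. real (J j)) (entries c) i 0 =
     (\<Sum>j=1..0. real (J j)) + ones (take i (outputs xs J c 0))"
      by (cases i) auto
  qed
next
  case (Suc n)
  let ?L = "lpp (\<lambda>k. ones (take k xs)) (\<lambda>l. \<Sum>j=1..l. real (J j)) (entries c)"
  have len: "length (outputs xs J c n) = length xs" using Suc.prems by (intro length_outputs) auto
  have "\<forall>i\<le>length (outputs xs J c n). ?L i (Suc n) = (\<Sum>j=1..n. real (J j)) + real (J (Suc n)) +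
      ones (take i (column (J (Suc n)) (outputs xs J c n) (c (Suc n))))"
  proof (rule column_profile)
    show "length (c (Suc n)) = length (outputs xs J c n)" using Suc.prems len by simp
    show "?L i n = (\<Sum>j=1..n. real (J j)) + ones (take i (outputs xs J c n))"
      if "i \<le> length (outputs xs J c n)" for i using Suc that len by auto
  qed (auto simp: entries_def)
  then show ?case using len by simp
qed

text \<open>
  The stationary model with its random boundary sums replaced by their means.  It is a function of the array and
  of the environment alone, so that different values of \<open>a\<close> can be compared on one probability space
  without coupling the boundary variables.
\<close>

definition det_lpp :: "real \<Rightarrow> (nat \<Rightarrow> real) \<Rightarrow> (nat \<Rightarrow> nat \<Rightarrow> bool) \<Rightarrow> nat \<Rightarrow> nat \<Rightarrow> real" where
  "det_lpp a q = lpp (\<lambda>k. a * real k) (\<lambda>l. \<Sum>j=1..l. queue_mean a (q j))"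

text \<open>
  With stationary random boundary values the corner value is the sum of the geometric variables along the bottom
  and of the output of the last column, which is a sequence of independent Bernoulli(\<open>a\<close>) variables by the Burke
  property; both concentrate around their means.  The random boundary values are uniformly close to their
  means, and the recursion is nonexpansive, so the value with deterministic boundary is close to the same number.
  The three deviations of size at most \<open>\<delta> m\<close> are those of the boundary, of the bottom sum and of the output.
\<close>

theorem det_lpp_tail:
  assumes a: "0 < a" "a < 1" and q: "\<And>j. 1 \<le> j \<Longrightarrow> j \<le> n \<Longrightarrow> 0 \<le> q j \<and> q j < a \<and> queue_mean a (q j) \<le> K"
    and K: "1 \<le> K" and \<theta>: "4 * K * \<theta> \<le> 1" "0 < \<theta>" and m: "0 < m" and \<delta>: "0 < \<delta>"
  shows "measure_pmf.prob (array_pmf m q n)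
    {c. \<bar>det_lpp a q (entries c) m n - (a * real m + (\<Sum>j=1..n. queue_mean a (q j)))\<bar> > 3 * \<delta> * real m}
   \<le> 2 * (real m + 2) * exp (- 2 * \<delta>\<^sup>2 * real m) +
     2 * (real n + 1) * exp (9 * K\<^sup>2 * \<theta>\<^sup>2 * real n - \<theta> * \<delta> * real m)"
proof -
  define \<Omega> where "\<Omega> = pair_pmf (replicate_pmf m (bernoulli_pmf a)) (pair_pmf (bottom_pmf a q n) (array_pmf m q n))"
  let ?t = "\<delta> * real m"
  have t: "0 < ?t" using \<delta> m by simp
  define \<sigma> where "\<sigma> l = (\<Sum>j=1..l. queue_mean a (q j))" for l
  define Bad where "Bad = {c. \<bar>det_lpp a q (entries c) m n - (a * real m + \<sigma> n)\<bar> > 3 * ?t}"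
  define X where "X k = {xs. ?t \<le> \<bar>ones (take k xs) - a * real k\<bar>}" for k
  define Y where "Y l = {J :: nat \<Rightarrow> nat. ?t \<le> \<bar>(\<Sum>j=1..l. real (J j)) - \<sigma> l\<bar>}" for l
  let ?EX = "\<lambda>k. {\<omega>. fst \<omega> \<in> X k}" and ?EY = "\<lambda>l. {\<omega>. fst (snd \<omega>) \<in> Y l}"
  let ?EO = "{\<omega>. outputs (fst \<omega>) (fst (snd \<omega>)) (snd (snd \<omega>)) n \<in> X m}"
  have PX: "measure_pmf.prob \<Omega> (?EX k) \<le> 2 * exp (- 2 * \<delta>\<^sup>2 * real m)" if "k \<le> m" for k
  proof -
    have "measure_pmf.prob \<Omega> (?EX k) = measure_pmf.prob (map_pmf fst \<Omega>) (X k)"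
      by (simp add: vimage_def)
    also have "map_pmf fst \<Omega> = replicate_pmf m (bernoulli_pmf a)"
      by (simp add: \<Omega>_def map_fst_pair_pmf)
    also have "measure_pmf.prob \<dots> (X k) \<le> 2 * exp (- 2 * ?t\<^sup>2 / real m)"
      unfolding X_def using a that t by (intro ones_tail) auto
    finally show ?thesis using m by (simp add: power2_eq_square mult_ac)
  qed
  have PO: "measure_pmf.prob \<Omega> ?EO \<le> 2 * exp (- 2 * \<delta>\<^sup>2 * real m)"
  proof -
    have "measure_pmf.prob \<Omega> ?EO =
      measure_pmf.prob (map_pmf (\<lambda>\<omega>. outputs (fst \<omega>) (fst (snd \<omega>)) (snd (snd \<omega>)) n) \<Omega>) (X m)"
      by (simp add: vimage_def)
    also have "map_pmf (\<lambda>\<omega>. outputs (fst \<omega>) (fst (snd \<omega>)) (snd (snd \<omega>)) n) \<Omega> = replicate_pmf m (bernoulli_pmf a)"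
      using burke_outputs[OF a, of n q m] q
      by (simp add: \<Omega>_def map_pmf_def pair_pmf_def bind_assoc_pmf bind_return_pmf)
    also have "measure_pmf.prob \<dots> (X m) \<le> 2 * exp (- 2 * ?t\<^sup>2 / real m)"
      unfolding X_def using a t by (intro ones_tail) auto
    finally show ?thesis using m by (simp add: power2_eq_square mult_ac)
  qed
  have PY: "measure_pmf.prob \<Omega> (?EY l) \<le> 2 * exp (9 * K\<^sup>2 * \<theta>\<^sup>2 * real n - \<theta> * \<delta> * real m)" if "l \<le> n" for l
  proof -
    have "measure_pmf.prob \<Omega> (?EY l) = measure_pmf.prob (map_pmf fst (map_pmf snd \<Omega>)) (Y l)"
      by (simp add: vimage_def)
    also have "map_pmf fst (map_pmf snd \<Omega>) = bottom_pmf a q n"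
      by (simp add: \<Omega>_def map_fst_pair_pmf map_snd_pair_pmf)
    also have "measure_pmf.prob \<dots> (Y l) \<le> 2 * exp (9 * K\<^sup>2 * \<theta>\<^sup>2 * real n - \<theta> * ?t)"
      unfolding Y_def \<sigma>_def by (rule bottom_tail[OF a q K \<theta> that])
    finally show ?thesis by (simp add: mult_ac)
  qed
  have "measure_pmf.prob (array_pmf m q n) Bad = measure_pmf.prob (map_pmf snd (map_pmf snd \<Omega>)) Bad"
    by (simp add: \<Omega>_def map_snd_pair_pmf)
  also have "\<dots> = measure_pmf.prob \<Omega> {\<omega>. snd (snd \<omega>) \<in> Bad}"
    by (simp add: vimage_def)
  also have "\<dots> \<le> measure_pmf.prob \<Omega> ((\<Union>k\<in>{..m}. ?EX k) \<union> (\<Union>l\<in>{..n}. ?EY l) \<union> ?EO)"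
  proof (intro measure_pmf.finite_measure_mono_AE AE_pmfI impI)
    fix \<omega> assume \<omega>: "\<omega> \<in> set_pmf \<Omega>" and "\<omega> \<in> {\<omega>. snd (snd \<omega>) \<in> Bad}"
    obtain xs J c where \<omega>': "\<omega> = (xs, J, c)" by (cases \<omega>)
    have bad: "c \<in> Bad" using \<open>\<omega> \<in> {\<omega>. snd (snd \<omega>) \<in> Bad}\<close> \<omega>' by simp
    have xs: "length xs = m" using \<omega> by (auto simp: \<Omega>_def \<omega>' set_replicate_pmf)
    have c: "length (c j) = m" if "1 \<le> j" "j \<le> n" for j
      using \<omega> that by (auto simp: \<Omega>_def \<omega>' array_pmf_def set_Pi_pmf PiE_dflt_def set_replicate_pmf)
    show "\<omega> \<in> (\<Union>k\<in>{..m}. ?EX k) \<union> (\<Union>l\<in>{..n}. ?EY l) \<union> ?EO"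
    proof (rule ccontr)
      assume neg: "\<not> ?thesis"
      then have n1: "\<bar>ones (take k xs) - a * real k\<bar> \<le> ?t" if "k \<le> m" for k
        using that by (force simp: \<omega>' X_def)
      have n2: "\<bar>(\<Sum>j=1..l. real (J j)) - \<sigma> l\<bar> \<le> ?t" if "l \<le> n" for l
        using that neg by (force simp: \<omega>' Y_def)
      have n3: "\<bar>ones (take m (outputs xs J c n)) - a * real m\<bar> \<le> ?t"
        using neg by (force simp: \<omega>' X_def)
      let ?L = "lpp (\<lambda>k. ones (take k xs)) (\<lambda>l. \<Sum>j=1..l. real (J j)) (entries c) m n"
      have "?L = (\<Sum>j=1..n. real (J j)) + ones (take m (outputs xs J c n))"
        using lpp_eq_outputs[of n c xs J] c xs by simp
      moreover have "\<bar>?L - det_lpp a q (entries c) m n\<bar> \<le> ?t"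
        unfolding det_lpp_def using n1 n2 unfolding \<sigma>_def by (intro lpp_nonexpansive) auto
      ultimately have "\<bar>det_lpp a q (entries c) m n - (a * real m + \<sigma> n)\<bar> \<le> 3 * ?t"
        using n2[of n] n3 by (simp add: abs_le_iff)
      then show False using bad by (simp add: Bad_def)
    qed
  qed auto
  also have "\<dots> \<le> measure_pmf.prob \<Omega> (\<Union>k\<in>{..m}. ?EX k) + measure_pmf.prob \<Omega> (\<Union>l\<in>{..n}. ?EY l) +
      measure_pmf.prob \<Omega> ?EO"
    by (intro order.trans[OF measure_Un_le] add_mono order.refl) simp_all
  also have "\<dots> \<le> (\<Sum>k\<in>{..m}. measure_pmf.prob \<Omega> (?EX k)) + (\<Sum>l\<in>{..n}. measure_pmf.prob \<Omega> (?EY l)) +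
      measure_pmf.prob \<Omega> ?EO"
    by (intro add_mono measure_UNION_le order.refl) auto
  also have "\<dots> \<le> (\<Sum>k\<in>{..m}. 2 * exp (- 2 * \<delta>\<^sup>2 * real m)) +
      (\<Sum>l\<in>{..n}. 2 * exp (9 * K\<^sup>2 * \<theta>\<^sup>2 * real n - \<theta> * \<delta> * real m)) + 2 * exp (- 2 * \<delta>\<^sup>2 * real m)"
    using PX PY PO by (intro add_mono sum_mono) auto
  also have "\<dots> = 2 * (real m + 2) * exp (- 2 * \<delta>\<^sup>2 * real m) +
     2 * (real n + 1) * exp (9 * K\<^sup>2 * \<theta>\<^sup>2 * real n - \<theta> * \<delta> * real m)"
    by (simp add: algebra_simps)
  finally show ?thesis by (simp add: Bad_def \<sigma>_def mult.assoc)
qed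

section \<open>From fixed environments to the random array\<close>

lemma unit_cdf_real_distribution:
  assumes "unit_cdf F"
  shows "real_distribution (interval_measure F)"
    and "measure (interval_measure F) {..x} = F x"
proof -
  have 1: "\<And>x y. x \<le> y \<Longrightarrow> F x \<le> F y" and 2: "\<And>a. continuous (at_right a) F"
    using assms by (auto simp: unit_cdf_def mono_def)
  have "\<forall>\<^sub>F x in at_bot. 0 = F x"
    using assms by (auto simp: unit_cdf_def eventually_at_bot_linorder intro!: exI[of _ "-1"])
  then have 3: "(F \<longlongrightarrow> 0) at_bot"
    by (rule Lim_transform_eventually[OF tendsto_const])
  have "\<forall>\<^sub>F x in at_top. 1 = F x"
    using assms by (auto simp: unit_cdf_def eventually_at_top_linorder intro!: exI[of _ 1])
  then have 4: "(F \<longlongrightarrow> 1) at_top"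
    by (rule Lim_transform_eventually[OF tendsto_const])
  show "real_distribution (interval_measure F)"
    by (rule real_distribution_interval_measure[OF 1 2 3 4])
  show "measure (interval_measure F) {..x} = F x"
    by (rule measure_interval_measure_Iic[OF 1 2 3])
qed

text \<open>
  Right continuity makes the infimum of \<open>{s. F s = 1}\<close> a minimum.
\<close>

lemma right_edge:
  assumes "unit_cdf F"
  shows "F (right_edge F) = 1" "0 \<le> right_edge F" "right_edge F \<le> 1"
    "s < right_edge F \<Longrightarrow> F s < 1"
proof -
  have mono: "F x \<le> F y" if "x \<le> y" for x y
    using assms that by (auto simp: unit_cdf_def mono_def)
  have cont: "(F \<longlongrightarrow> F s) (at_right s)" for s
    using assms by (auto simp: unit_cdf_def continuous_within)
  have F0: "F s = 0" if "s < 0" for s using assms that by (auto simp: unit_cdf_def)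
  have F1: "F s = 1" if "1 \<le> s" for s using assms that by (auto simp: unit_cdf_def)
  let ?S = "{s. F s = 1}"
  define b where "b = Inf ?S"
  have lb: "0 \<le> s" if "s \<in> ?S" for s using F0[of s] that by force
  have ne: "?S \<noteq> {}" using F1[of 1] by auto
  have bdd: "bdd_below ?S" using lb by (auto simp: bdd_below_def)
  have above: "F s = 1" if bs: "b < s" for s
  proof -
    obtain s' where "F s' = 1" "s' < s" using cInf_lessD[OF ne, of s] bs unfolding b_def by blast
    then have "1 \<le> F s" using mono[of s' s] by simp
    moreover have "F s \<le> 1" using mono[of s "max s 1"] F1[of "max s 1"] by simp
    ultimately show ?thesis by simp
  qed
  have "\<forall>\<^sub>F s in at_right b. 1 = F s"
    using above by (auto simp: eventually_at_filter)
  then have "((\<lambda>_. 1) \<longlongrightarrow> F b) (at_right b)"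
    by (intro Lim_transform_eventually[OF cont]) (auto elim: eventually_mono)
  then have Fb: "F b = 1" by (simp add: tendsto_const_iff)
  have edge: "right_edge F = b"
    unfolding right_edge_def
    by (rule Least_equality) (use Fb bdd in \<open>auto simp: b_def intro!: cInf_lower\<close>)
  show "F (right_edge F) = 1" using Fb edge by simp
  show "0 \<le> right_edge F" unfolding edge b_def by (rule cInf_greatest[OF ne lb])
  show "right_edge F \<le> 1" unfolding edge b_def by (rule cInf_lower[OF _ bdd]) (use F1 in auto)
  show "F s < 1" if "s < right_edge F"
  proof -
    have "F s \<noteq> 1" using that cInf_lower[OF _ bdd, of s] unfolding edge b_def by auto
    moreover have "F s \<le> 1" using mono[of s "max s 1"] F1[of "max s 1"] by simp
    ultimately show ?thesis by simp
  qed
qed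

lemma AE_interval_measure_support:
  assumes "unit_cdf F"
  shows "AE s in interval_measure F. 0 \<le> s \<and> s \<le> right_edge F"
proof -
  interpret real_distribution "interval_measure F"
    by (rule unit_cdf_real_distribution[OF assms])
  have "AE s in interval_measure F. s \<in> {..right_edge F}"
    using unit_cdf_real_distribution(2)[OF assms] right_edge(1)[OF assms]
    by (intro AE_prob_1) auto
  moreover have "AE s in interval_measure F. s \<notin> {..- (1 / real (Suc n))}" for n
    using assms
    by (intro AE_not_in) (auto simp: null_sets_def emeasure_eq_measure unit_cdf_real_distribution unit_cdf_def)
  then have "AE s in interval_measure F. \<forall>n. s \<notin> {..- (1 / real (Suc n))}"
    by (simp add: AE_all_countable)
  ultimately show ?thesis
  proof eventually_elim
    case (elim s)
    have "0 \<le> s"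
    proof (rule ccontr)
      assume "\<not> 0 \<le> s"
      then obtain n where "inverse (real (Suc n)) < - s" using reals_Archimedean[of "- s"] by auto
      then have "s \<in> {..- (1 / real (Suc n))}" by (simp add: field_simps)
      then show False using elim by blast
    qed
    then show ?case using elim by simp
  qed
qed

lemma summable_linear_exp:
  fixes A B c :: real assumes "0 < c"
  shows "summable (\<lambda>m. (A * real m + B) * exp (- c * real m))"
proof -
  have e: "exp (- c * real m) = exp (- c) ^ m" for m
    by (rule exp_of_nat2_mult)
  have lt: "norm (exp (- c)) < 1" using assms by simp
  have "summable (\<lambda>m. exp (- c) ^ m * real m)"
    using geometric_sums_times_n[OF lt] by (rule sums_summable)
  moreover have "summable (\<lambda>m. exp (- c) ^ m)"
    by (rule summable_geometric[OF lt])
  ultimately have "summable (\<lambda>m. A * (exp (- c) ^ m * real m) + B * exp (- c) ^ m)"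
    by (intro summable_add summable_mult)
  then show ?thesis unfolding e by (simp add: algebra_simps)
qed

lemma measurable_lpp_environment:
  assumes [measurable]: "g \<in> borel_measurable borel"
  shows "(\<lambda>x. lpp \<beta> (\<lambda>l. \<Sum>j=1..l. g (x j)) A i j) \<in> borel_measurable (PiM {1..} (\<lambda>_. borel))"
proof (induction i arbitrary: j)
  case 0
  show ?case by simp
next
  case (Suc i)
  note IH = Suc
  show ?case
  proof (induction j)
    case (Suc j)
    show ?case
      unfolding lpp.simps
      by (intro borel_measurable_max borel_measurable_add borel_measurable_const IH Suc)
  qed simp
qed

lemma pmf_bernoulli_eq:
  "pmf (bernoulli_pmf q) e = (if e then min 1 (max 0 q) else 1 - min 1 (max 0 q))"
  by (simp add: bernoulli_pmf.rep_eq)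

lemma pmf_replicate_pmf:
  "length xs = m \<Longrightarrow> pmf (replicate_pmf m P) xs = (\<Prod>i<m. pmf P (xs ! i))"
proof (induction m arbitrary: xs)
  case (Suc m)
  then obtain y ys where xs: "xs = y # ys" "length ys = m" by (cases xs) auto
  have "replicate_pmf (Suc m) P = map_pmf (\<lambda>(x, xs). x # xs) (pair_pmf P (replicate_pmf m P))"
    by (simp add: map_pmf_def pair_pmf_def bind_assoc_pmf bind_return_pmf)
  moreover have "pmf (map_pmf (\<lambda>(x, xs). x # xs) (pair_pmf P (replicate_pmf m P))) ((\<lambda>(x, xs). x # xs) (y, ys)) =
      pmf (pair_pmf P (replicate_pmf m P)) (y, ys)"
    by (rule pmf_map_inj') (auto simp: inj_on_def)
  moreover have "(\<Prod>i<Suc m. pmf P (xs ! i)) = pmf P y * (\<Prod>i<m. pmf P (ys ! i))"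
    unfolding xs(1) prod.lessThan_Suc_shift by simp
  ultimately show ?case using Suc.IH[OF xs(2)]
    by (simp add: xs(1) pmf_pair del: replicate_pmf.simps prod.lessThan_Suc)
qed simp

lemma ones_take:
  "k \<le> length xs \<Longrightarrow> ones (take k xs) = (\<Sum>i=1..k. of_bool (xs ! (i - 1)))"
proof (induction k)
  case (Suc k)
  then have "take (Suc k) xs = take k xs @ [xs ! k]" by (simp add: take_Suc_conv_app_nth)
  then have "ones (take (Suc k) xs) = ones (take k xs) + of_bool (xs ! k)"
    by (simp add: ones_def)
  then show ?case using Suc by simp
qed simp

lemma lpp_cong_entries:
  "(\<And>i' j'. 1 \<le> i' \<Longrightarrow> i' \<le> i \<Longrightarrow> 1 \<le> j' \<Longrightarrow> j' \<le> j \<Longrightarrow> A i' j' = A' i' j') \<Longrightarrow>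
   lpp \<beta> \<sigma> A i j = lpp \<beta> \<sigma> A' i j"
proof (induction \<beta> \<sigma> A i j rule: lpp.induct)
  case (3 \<beta> \<sigma> A i j)
  then have "lpp \<beta> \<sigma> A (Suc i) j = lpp \<beta> \<sigma> A' (Suc i) j" "lpp \<beta> \<sigma> A i (Suc j) = lpp \<beta> \<sigma> A' i (Suc j)"
    by auto
  then show ?case using 3(3)[of "Suc i" "Suc j"] by simp
qed auto

context random_environment_array
begin

text \<open>
  The finite array in the encoding of \<open>array_pmf\<close>, with the default value of that product law outside the index range.
\<close>

definition array_cols :: "nat \<Rightarrow> nat \<Rightarrow> 'w \<Rightarrow> nat \<Rightarrow> bool list" where
  "array_cols m n \<omega> = (\<lambda>j. if j \<in> {1..n} then map (\<lambda>i. \<epsilon> i j \<omega>) [1..<Suc m] else [])"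

definition env :: "'w \<Rightarrow> nat \<Rightarrow> real" where "env \<omega> = (\<lambda>j\<in>{1..}. p j \<omega>)"

lemma p_measurable [measurable]: "1 \<le> j \<Longrightarrow> p j \<in> borel_measurable M"
  using env_indep by (auto simp: indep_vars_def)

lemma env_measurable [measurable]: "env \<in> measurable M (PiM {1..} (\<lambda>_. borel))"
  unfolding env_def by (intro measurable_restrict) auto

lemma env_algebra_eq:
  "env_algebra M p = vimage_algebra (space M) env (PiM {1..} (\<lambda>_. borel))"
  unfolding env_algebra_def env_def[abs_def] ..

lemma subalgebra_env: "subalgebra M (env_algebra M p)"
  unfolding subalgebra_def env_algebra_eq
proof (intro conjI subsetI)
  fix A assume A: "A \<in> sets (vimage_algebra (space M) env (PiM {1..} (\<lambda>_. borel)))"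
  have "(\<lambda>\<omega>. \<omega>) \<in> measurable M (vimage_algebra (space M) env (PiM {1..} (\<lambda>_. borel)))"
    by (rule measurable_vimage_algebra2[OF _ env_measurable]) simp
  from measurable_sets[OF this A] have "A \<inter> space M \<in> sets M" by simp
  also have "A \<inter> space M = A" using sets.sets_into_space[OF A] by auto
  finally show "A \<in> sets M" .
qed simp

lemma entries_array_cols:
  "1 \<le> i \<Longrightarrow> i \<le> m \<Longrightarrow> 1 \<le> j \<Longrightarrow> j \<le> n \<Longrightarrow> entries (array_cols m n \<omega>) i j = \<epsilon> i j \<omega>"
  using nth_upt[of 1 "i - 1" "Suc m"] by (simp add: entries_def array_cols_def del: upt_Suc)

text \<open>
  An event about the environment and a finite part of the array is a finite disjoint union of events of the form
  (environment event) and (fixed pattern of entries); on each of these the conditional law of the entries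
  applies.  The bound is required for every environment in the support, so no conditioning survives.
\<close>

lemma quenched_to_annealed:
  assumes Q: "\<And>c. Measurable.pred (PiM {1..} (\<lambda>_. borel)) (\<lambda>x. Q x c)"
    and bound: "\<And>x. (\<And>j. 1 \<le> j \<Longrightarrow> 0 \<le> x j \<and> x j \<le> b) \<Longrightarrow> measure_pmf.prob (array_pmf m x n) {c. Q x c} \<le> B"
    and env: "AE \<omega> in M. \<forall>j\<ge>1. 0 \<le> p j \<omega> \<and> p j \<omega> \<le> b"
  shows "{\<omega>\<in>space M. Q (env \<omega>) (array_cols m n \<omega>)} \<in> events"
    and "prob {\<omega>\<in>space M. Q (env \<omega>) (array_cols m n \<omega>)} \<le> B"
proof -
  interpret S: finite_measure_subalgebra M "env_algebra M p"
    by unfold_locales (rule subalgebra_env)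
  define C where "C = PiE_dflt {1..n} [] (\<lambda>_. {xs :: bool list. length xs = m})"
  have finC: "finite C"
    unfolding C_def using finite_lists_length_eq[of "UNIV :: bool set" m] by (intro finite_PiE_dflt) auto
  have cols_C: "array_cols m n \<omega> \<in> C" for \<omega>
    by (auto simp: array_cols_def C_def PiE_dflt_def simp del: upt_Suc)
  define K where "K = {1..m} \<times> {1..n}"
  have K: "finite K" "K \<subseteq> {1..} \<times> {1..}" by (auto simp: K_def)
  define E where "E c = {\<omega>\<in>space M. \<forall>(i, j)\<in>K. \<epsilon> i j \<omega> = entries c i j}" for c
  define G where "G c = {\<omega>\<in>space M. Q (env \<omega>) c}" for c
  have cols_eq: "array_cols m n \<omega> = c \<longleftrightarrow> (\<forall>(i, j)\<in>K. \<epsilon> i j \<omega> = entries c i j)" if "c \<in> C" for c \<omega>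
  proof
    assume "array_cols m n \<omega> = c"
    then show "\<forall>(i, j)\<in>K. \<epsilon> i j \<omega> = entries c i j"
      using entries_array_cols[where m=m and n=n and \<omega>=\<omega>] by (auto simp: K_def)
  next
    assume *: "\<forall>(i, j)\<in>K. \<epsilon> i j \<omega> = entries c i j"
    show "array_cols m n \<omega> = c"
    proof
      fix j
      show "array_cols m n \<omega> j = c j"
      proof (cases "j \<in> {1..n}")
        case True
        have len: "length (c j) = m" using that True by (auto simp: C_def PiE_dflt_def)
        show ?thesis
        proof (rule nth_equalityI)
          show "length (array_cols m n \<omega> j) = length (c j)"
            using True len by (simp add: array_cols_def del: upt_Suc)
          fix i assume "i < length (array_cols m n \<omega> j)"
          then have i: "i < m" using True by (simp add: array_cols_def del: upt_Suc)
          then have "\<epsilon> (Suc i) j \<omega> = entries c (Suc i) j" using * True by (auto simp: K_def)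
          then show "array_cols m n \<omega> j ! i = c j ! i"
            using i True by (simp add: array_cols_def entries_def del: upt_Suc)
        qed
      next
        case False
        then show ?thesis using that by (auto simp: array_cols_def C_def PiE_dflt_def)
      qed
    qed
  qed
  have E_meas [measurable]: "E c \<in> events" for c
  proof -
    have "{\<omega>\<in>space M. \<epsilon> (fst x) (snd x) \<omega> = entries c (fst x) (snd x)} \<in> events" if "x \<in> K" for x
    proof -
      have "\<epsilon> (fst x) (snd x) -` {entries c (fst x) (snd x)} \<inter> space M \<in> events"
        using that K(2) by (intro measurable_sets[OF entry_measurable]) auto
      also have "\<epsilon> (fst x) (snd x) -` {entries c (fst x) (snd x)} \<inter> space M =
          {\<omega>\<in>space M. \<epsilon> (fst x) (snd x) \<omega> = entries c (fst x) (snd x)}" by auto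
      finally show ?thesis .
    qed
    from sets.sets_Collect_finite_All[OF this K(1)] show ?thesis
      by (simp add: E_def case_prod_beta)
  qed
  have env_alg: "env \<in> measurable (env_algebra M p) (PiM {1..} (\<lambda>_. borel))"
    unfolding env_algebra_eq
    by (rule measurable_vimage_algebra1) (auto simp: env_def space_PiM)
  have G_alg: "G c \<in> sets (env_algebra M p)" for c
  proof -
    have "env -` {x \<in> space (PiM {1..} (\<lambda>_. borel)). Q x c} \<inter> space (env_algebra M p) \<in> sets (env_algebra M p)"
      using Q[of c] by (intro measurable_sets[OF env_alg]) (simp add: pred_def)
    also have "env -` {x \<in> space (PiM {1..} (\<lambda>_. borel)). Q x c} \<inter> space (env_algebra M p) = G c"
      by (auto simp: G_def env_algebra_eq env_def space_PiM)
    finally show ?thesis .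
  qed
  have G_meas [measurable]: "G c \<in> events" for c
    using G_alg subalgebra_env by (auto simp: subalgebra_def)
  define f where "f c \<omega> = (\<Prod>(i, j)\<in>K. pmf (bernoulli_pmf (p j \<omega>)) (entries c i j))" for c \<omega>
  have f_meas [measurable]: "f c \<in> borel_measurable M" for c
    unfolding f_def pmf_bernoulli_eq case_prod_beta
    by (intro borel_measurable_prod) (auto simp: K_def)
  have f_01: "0 \<le> f c \<omega>" "f c \<omega> \<le> 1" for c \<omega>
    unfolding f_def case_prod_beta by (auto intro!: prod_nonneg prod_le_1 pmf_le_1)
  have GE: "prob (G c \<inter> E c) = (\<integral>\<omega>. indicator (G c) \<omega> * f c \<omega> \<partial>M)" for c
  proof -
    have "prob (G c \<inter> E c) = (\<integral>\<omega>. indicator (G c) \<omega> * indicator (E c) \<omega> \<partial>M)"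
      by (simp flip: indicator_inter_arith)
    also have "\<dots> = (\<integral>\<omega>. indicator (G c) \<omega> * real_cond_exp M (env_algebra M p) (indicator (E c)) \<omega> \<partial>M)"
      by (rule S.real_cond_exp_intg(2)[symmetric])
         (use G_alg in \<open>auto simp flip: indicator_inter_arith simp: less_top[symmetric] intro!: integrable_real_indicator\<close>)
    also have "\<dots> = (\<integral>\<omega>. indicator (G c) \<omega> * f c \<omega> \<partial>M)"
    proof (rule integral_cong_AE)
      show "AE \<omega> in M. indicator (G c) \<omega> * real_cond_exp M (env_algebra M p) (indicator (E c)) \<omega> =
          indicator (G c) \<omega> * f c \<omega>"
        using entry_cond_law[OF K, of "entries c"] unfolding E_def f_def by eventually_elim simp
    qed auto
    finally show ?thesis .
  qed
  have eq: "{\<omega>\<in>space M. Q (env \<omega>) (array_cols m n \<omega>)} = (\<Union>c\<in>C. G c \<inter> E c)"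
  proof (intro set_eqI iffI)
    fix \<omega> assume "\<omega> \<in> {\<omega>\<in>space M. Q (env \<omega>) (array_cols m n \<omega>)}"
    then have "\<omega> \<in> G (array_cols m n \<omega>) \<inter> E (array_cols m n \<omega>)"
      using cols_eq[OF cols_C, of \<omega> \<omega>] by (simp add: G_def E_def)
    then show "\<omega> \<in> (\<Union>c\<in>C. G c \<inter> E c)" using cols_C by blast
  next
    fix \<omega> assume "\<omega> \<in> (\<Union>c\<in>C. G c \<inter> E c)"
    then obtain c where "c \<in> C" "\<omega> \<in> G c" "\<omega> \<in> E c" by blast
    then show "\<omega> \<in> {\<omega>\<in>space M. Q (env \<omega>) (array_cols m n \<omega>)}"
      using cols_eq[of c \<omega>] by (auto simp: G_def E_def)
  qed
  show "{\<omega>\<in>space M. Q (env \<omega>) (array_cols m n \<omega>)} \<in> events"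
    unfolding eq using finC by auto
  have disj: "disjoint_family_on (\<lambda>c. G c \<inter> E c) C"
    unfolding disjoint_family_on_def
  proof (intro ballI impI)
    fix c c' assume c: "c \<in> C" "c' \<in> C" "c \<noteq> c'"
    have "\<omega> \<notin> E c'" if "\<omega> \<in> E c" for \<omega>
      using that cols_eq[OF c(1), of \<omega>] cols_eq[OF c(2), of \<omega>] c(3) unfolding E_def mem_Collect_eq by metis
    then show "G c \<inter> E c \<inter> (G c' \<inter> E c') = {}" by blast
  qed
  have pmf_f: "pmf (array_pmf m (env \<omega>) n) c = f c \<omega>" if "c \<in> C" for c \<omega>
  proof -
    have "pmf (array_pmf m (env \<omega>) n) c = (\<Prod>j\<in>{1..n}. pmf (replicate_pmf m (bernoulli_pmf (env \<omega> j))) (c j))"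
      unfolding array_pmf_def using that by (subst pmf_Pi') (auto simp: C_def PiE_dflt_def)
    also have "\<dots> = (\<Prod>j\<in>{1..n}. \<Prod>i\<in>{1..m}. pmf (bernoulli_pmf (p j \<omega>)) (entries c i j))"
    proof (intro prod.cong refl)
      fix j assume j: "j \<in> {1..n}"
      then have "length (c j) = m" using that by (auto simp: C_def PiE_dflt_def)
      then have "pmf (replicate_pmf m (bernoulli_pmf (env \<omega> j))) (c j) =
          (\<Prod>i<m. pmf (bernoulli_pmf (p j \<omega>)) (c j ! i))"
        using j by (subst pmf_replicate_pmf) (auto simp: env_def)
      also have "\<dots> = (\<Prod>i\<in>{1..m}. pmf (bernoulli_pmf (p j \<omega>)) (entries c i j))"
        by (rule prod.reindex_bij_witness[of _ "\<lambda>i. i - 1" Suc]) (auto simp: entries_def)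
      finally show "pmf (replicate_pmf m (bernoulli_pmf (env \<omega> j))) (c j) = \<dots>" .
    qed
    also have "\<dots> = f c \<omega>"
      unfolding f_def K_def by (subst prod.swap) (simp add: prod.cartesian_product)
    finally show ?thesis .
  qed
  have "prob {\<omega>\<in>space M. Q (env \<omega>) (array_cols m n \<omega>)} = (\<Sum>c\<in>C. prob (G c \<inter> E c))"
    unfolding eq using finC disj by (intro finite_measure_finite_Union) auto
  also have "\<dots> = (\<Sum>c\<in>C. \<integral>\<omega>. indicator (G c) \<omega> * f c \<omega> \<partial>M)" by (simp add: GE)
  also have int: "integrable M (\<lambda>\<omega>. indicator (G c) \<omega> * f c \<omega>)" for c
    using f_01 by (intro integrable_const_bound[where B = 1]) (auto simp: abs_mult indicator_def)
  then have "(\<Sum>c\<in>C. \<integral>\<omega>. indicator (G c) \<omega> * f c \<omega> \<partial>M) = (\<integral>\<omega>. (\<Sum>c\<in>C. indicator (G c) \<omega> * f c \<omega>) \<partial>M)"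
    by (subst Bochner_Integration.integral_sum) auto
  also have "\<dots> \<le> B"
  proof (rule integral_le_const)
    show "integrable M (\<lambda>\<omega>. \<Sum>c\<in>C. indicator (G c) \<omega> * f c \<omega>)" using int by auto
    show "AE \<omega> in M. (\<Sum>c\<in>C. indicator (G c) \<omega> * f c \<omega>) \<le> B"
      using env AE_space
    proof eventually_elim
      case (elim \<omega>)
      have "(\<Sum>c\<in>C. indicator (G c) \<omega> * f c \<omega>) = (\<Sum>c\<in>{c\<in>C. Q (env \<omega>) c}. pmf (array_pmf m (env \<omega>) n) c)"
        using finC elim(2)
        by (intro sum.mono_neutral_cong_right) (auto simp: G_def pmf_f indicator_def)
      also have "\<dots> = measure_pmf.prob (array_pmf m (env \<omega>) n) {c\<in>C. Q (env \<omega>) c}"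
        using finC by (subst measure_measure_pmf_finite) auto
      also have "\<dots> \<le> measure_pmf.prob (array_pmf m (env \<omega>) n) {c. Q (env \<omega>) c}"
        by (intro measure_pmf.finite_measure_mono) auto
      also have "\<dots> \<le> B" using elim(1) by (intro bound) (auto simp: env_def)
      finally show ?case .
    qed
  qed
  finally show "prob {\<omega>\<in>space M. Q (env \<omega>) (array_cols m n \<omega>)} \<le> B" .
qed

lemma borel_cantelli_quenched:
  assumes Q: "\<And>m c. Measurable.pred (PiM {1..} (\<lambda>_. borel)) (\<lambda>x. Q m x c)"
    and bound: "\<And>m x. (\<And>j. 1 \<le> j \<Longrightarrow> 0 \<le> x j \<and> x j \<le> b) \<Longrightarrow> 
       measure_pmf.prob (array_pmf m x (n m)) {c. Q m x c} \<le> B m"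
    and B: "summable B"
    and env: "AE \<omega> in M. \<forall>j\<ge>1. 0 \<le> p j \<omega> \<and> p j \<omega> \<le> b"
  shows "AE \<omega> in M. \<forall>\<^sub>F m in sequentially. \<not> Q m (env \<omega>) (array_cols m (n m) \<omega>)"
proof -
  let ?E = "\<lambda>m. {\<omega>\<in>space M. Q m (env \<omega>) (array_cols m (n m) \<omega>)}"
  note t = quenched_to_annealed[where Q = "Q _" and n = "n _", OF Q bound env]
  have "AE \<omega> in M. \<forall>\<^sub>F m in sequentially. \<omega> \<in> space M - ?E m"
  proof (rule borel_cantelli_AE1)
    show "?E m \<in> events" for m by (rule t(1))
    show "emeasure M (?E m) < \<infinity>" for m by (simp add: less_top[symmetric])
    show "summable (\<lambda>m. prob (?E m))"
      using t(2) by (intro summable_comparison_test'[OF B]) auto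
  qed
  then show ?thesis
    by eventually_elim (auto elim: eventually_mono)
qed

end

section \<open>Laws of large numbers\<close>

lemma queue_mean_bounds:
  assumes "0 \<le> s" "s \<le> b" "b < a" "a < 1"
  shows "0 \<le> queue_mean a s" "queue_mean a s \<le> b * (1 - a) / (a - b)"
  unfolding queue_mean_def using assms by (auto intro!: frac_le mult_right_mono)

lemma queue_mean_measurable [measurable]: "queue_mean a \<in> borel_measurable borel"
  unfolding queue_mean_def[abs_def] by measurable

lemma nat_floor_bounds:
  assumes "0 < \<alpha>"
  shows "real (nat \<lfloor>\<alpha> * real m\<rfloor>) \<le> \<alpha> * real m" "\<alpha> * real m - 1 \<le> real (nat \<lfloor>\<alpha> * real m\<rfloor>)"
  using assms by (auto simp: of_nat_nat)

lemma nat_floor_ratio: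
  assumes "0 < \<alpha>"
  shows "(\<lambda>m. real (nat \<lfloor>\<alpha> * real m\<rfloor>) / real m) \<longlonglongrightarrow> \<alpha>"
proof (rule real_tendsto_sandwich)
  show "\<forall>\<^sub>F m in sequentially. \<alpha> - 1 / real m \<le> real (nat \<lfloor>\<alpha> * real m\<rfloor>) / real m"
    using eventually_gt_at_top[of 0]
  proof eventually_elim
    case (elim m)
    then have "\<alpha> - 1 / real m = (\<alpha> * real m - 1) / real m" by (simp add: diff_divide_distrib)
    also have "\<dots> \<le> real (nat \<lfloor>\<alpha> * real m\<rfloor>) / real m"
      using nat_floor_bounds(2)[OF assms, of m] by (rule divide_right_mono) simp
    finally show ?case .
  qed
  show "\<forall>\<^sub>F m in sequentially. real (nat \<lfloor>\<alpha> * real m\<rfloor>) / real m \<le> \<alpha>"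
    using eventually_gt_at_top[of 0]
  proof eventually_elim
    case (elim m)
    then show ?case using nat_floor_bounds(1)[OF assms, of m] by (simp add: field_simps)
  qed
  have "(\<lambda>m. \<alpha> - 1 / real m) \<longlonglongrightarrow> \<alpha> - 0" by (intro tendsto_intros lim_1_over_n)
  then show "(\<lambda>m. \<alpha> - 1 / real m) \<longlonglongrightarrow> \<alpha>" by simp
qed (rule tendsto_const)

lemma nat_floor_at_top:
  assumes "0 < \<alpha>"
  shows "filterlim (\<lambda>m. nat \<lfloor>\<alpha> * real m\<rfloor>) at_top sequentially"
proof -
  have "filterlim (\<lambda>m. real (nat \<lfloor>\<alpha> * real m\<rfloor>)) at_top sequentially"
  proof (rule filterlim_at_top_mono)
    show "filterlim (\<lambda>m. \<alpha> * real m - 1) at_top sequentially"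
      using assms by real_asymp
    show "\<forall>\<^sub>F m in sequentially. \<alpha> * real m - 1 \<le> real (nat \<lfloor>\<alpha> * real m\<rfloor>)"
      using nat_floor_bounds(2)[OF assms] by simp
  qed
  then show ?thesis by (simp add: filterlim_sequentially_iff_filterlim_real)
qed

lemma tendsto_of_eventually_close:
  fixes f :: "nat \<Rightarrow> real"
  assumes "\<And>k::nat. \<forall>\<^sub>F m in sequentially. \<bar>f m\<bar> \<le> C / real (Suc k)" and C: "0 < C"
  shows "f \<longlonglongrightarrow> 0"
proof (rule tendstoI)
  fix e :: real assume "0 < e"
  then obtain k where k: "inverse (real (Suc k)) < e / C" using reals_Archimedean C by (metis divide_pos_pos)
  from assms(1)[of k] show "\<forall>\<^sub>F m in sequentially. dist (f m) 0 < e"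
  proof eventually_elim
    case (elim m)
    also have "C / real (Suc k) < e" using k C by (simp add: field_simps)
    finally show ?case by simp
  qed
qed

lemma average_along_floor:
  assumes "0 < \<alpha>" "(\<lambda>n. S n / real n) \<longlonglongrightarrow> I"
  shows "(\<lambda>m. S (nat \<lfloor>\<alpha> * real m\<rfloor>) / real m) \<longlonglongrightarrow> \<alpha> * I"
proof -
  let ?n = "\<lambda>m. nat \<lfloor>\<alpha> * real m\<rfloor>"
  have "(\<lambda>m. (real (?n m) / real m) * (S (?n m) / real (?n m))) \<longlonglongrightarrow> \<alpha> * I"
    by (intro tendsto_mult nat_floor_ratio assms(1) filterlim_compose[OF assms(2) nat_floor_at_top])
  moreover have "\<forall>\<^sub>F m in sequentially. (real (?n m) / real m) * (S (?n m) / real (?n m)) = S (?n m) / real m"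
    using nat_floor_at_top[OF assms(1), unfolded filterlim_at_top, rule_format, of 1]
  proof eventually_elim
    case (elim m)
    define N where "N = ?n m"
    then show ?case using elim unfolding N_def[symmetric] by simp
  qed
  ultimately show ?thesis by (rule Lim_transform_eventually)
qed

lemma det_lpp_cong:
  "(\<And>j. 1 \<le> j \<Longrightarrow> q j = q' j) \<Longrightarrow>
   (\<And>i' j'. 1 \<le> i' \<Longrightarrow> i' \<le> i \<Longrightarrow> 1 \<le> j' \<Longrightarrow> j' \<le> j \<Longrightarrow> A i' j' = A' i' j') \<Longrightarrow>
   det_lpp a q A i j = det_lpp a q' A' i j"
  unfolding det_lpp_def using lpp_cong_entries[of i j A A'] by simp

context random_environment_array
begin

lemma env_distr:
  assumes F: "unit_cdf F" and j: "1 \<le> j"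
  shows "distr M borel (p j) = interval_measure F"
proof (rule cdf_unique)
  show "real_distribution (distr M borel (p j))"
    using j by (intro real_distribution_distr) auto
  show "real_distribution (interval_measure F)"
    by (rule unit_cdf_real_distribution[OF F])
  show "cdf (distr M borel (p j)) = cdf (interval_measure F)"
    using env_cdf[OF j] unit_cdf_real_distribution(2)[OF F] by (simp add: cdf_def fun_eq_iff)
qed

lemma env_support:
  assumes F: "unit_cdf F"
  shows "AE \<omega> in M. \<forall>j\<ge>1. 0 \<le> p j \<omega> \<and> p j \<omega> \<le> right_edge F"
proof -
  have "AE \<omega> in M. 1 \<le> j \<longrightarrow> 0 \<le> p j \<omega> \<and> p j \<omega> \<le> right_edge F" for j
  proof (cases "1 \<le> j")
    case True
    have "AE s in distr M borel (p j). 0 \<le> s \<and> s \<le> right_edge F"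
      unfolding env_distr[OF F True] by (rule AE_interval_measure_support[OF F])
    then have "AE \<omega> in M. 0 \<le> p j \<omega> \<and> p j \<omega> \<le> right_edge F"
      by (rule AE_distrD[rotated]) (use True in auto)
    then show ?thesis by simp
  qed simp
  then show ?thesis by (simp add: AE_all_countable)
qed

text \<open>
  Hoeffding's inequality and the Borel-Cantelli lemma give the strong law for bounded functions of the environment.
\<close>

lemma environment_lln:
  assumes F: "unit_cdf F" and f [measurable]: "f \<in> borel_measurable borel"
    and C: "\<And>s. 0 \<le> s \<Longrightarrow> s \<le> right_edge F \<Longrightarrow> \<bar>f s\<bar> \<le> C"
  shows "AE \<omega> in M. (\<lambda>n. (\<Sum>j=1..n. f (p j \<omega>)) / real n) \<longlonglongrightarrow> (\<integral>s. f s \<partial>interval_measure F)"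
proof -
  define D where "D = max C 1"
  let ?\<mu> = "\<integral>s. f s \<partial>interval_measure F"
  have mu: "expectation (\<lambda>\<omega>. f (p 1 \<omega>)) = ?\<mu>"
    unfolding env_distr[OF F order.refl, symmetric] by (subst integral_distr) auto
  have close: "AE \<omega> in M. \<forall>\<^sub>F n in sequentially. \<bar>(\<Sum>j=1..n. f (p j \<omega>)) / real n - ?\<mu>\<bar> \<le> 1 / real (Suc k)" for k
  proof -
    define e where "e = 1 / real (Suc k)"
    have e: "0 < e" by (simp add: e_def)
    define c where "c = e\<^sup>2 / (2 * D\<^sup>2)"
    have D: "1 \<le> D" by (simp add: D_def)
    have c: "0 < c" using e D by (simp add: c_def)
    let ?E = "\<lambda>n. {\<omega>\<in>space M. e \<le> \<bar>(\<Sum>j\<in>{1..Suc n}. f (p j \<omega>)) / real (Suc n) - ?\<mu>\<bar>}"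
    have pE: "prob (?E n) \<le> 2 * exp (- c * real (Suc n))" for n
    proof -
      interpret H: Hoeffding_ineq_iid M "{1..Suc n}" "\<lambda>j \<omega>. f (p j \<omega>)" "\<lambda>\<omega>. f (p 1 \<omega>)" "- D" D ?\<mu>
      proof unfold_locales
        show "indep_vars (\<lambda>_. borel) (\<lambda>j \<omega>. f (p j \<omega>)) {1..Suc n}"
          by (rule indep_vars_compose2[OF indep_vars_subset[OF env_indep]]) auto
        show "distr M borel (\<lambda>\<omega>. f (p i \<omega>)) = distr M borel (\<lambda>\<omega>. f (p 1 \<omega>))" if "i \<in> {1..Suc n}" for i
        proof -
          have "distr M borel (\<lambda>\<omega>. f (p i \<omega>)) = distr (distr M borel (p i)) borel f"
            using that by (subst distr_distr) (auto simp: o_def)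
          also have "distr M borel (p i) = distr M borel (p 1)"
            using that env_distr[OF F] by simp
          also have "distr \<dots> borel f = distr M borel (\<lambda>\<omega>. f (p 1 \<omega>))"
            by (subst distr_distr) (auto simp: o_def)
          finally show ?thesis .
        qed
        show "AE \<omega> in M. f (p 1 \<omega>) \<in> {- D..D}"
          using env_support[OF F]
        proof eventually_elim
          case (elim \<omega>)
          then have "\<bar>f (p 1 \<omega>)\<bar> \<le> D" using C[of "p 1 \<omega>"] by (auto simp: D_def)
          then show ?case by auto
        qed
        show "?\<mu> \<equiv> expectation (\<lambda>\<omega>. f (p 1 \<omega>))" by (simp only: mu)
      qed auto
      have ar: "- 2 * real (card {1..Suc n}) * e\<^sup>2 / (D - - D)\<^sup>2 = - c * real (Suc n)"
        using D by (simp add: c_def power2_eq_square field_simps)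
      show ?thesis
        using H.Hoeffding_ineq_abs_ge'[of e] e D unfolding ar by simp
    qed
    have "AE \<omega> in M. \<forall>\<^sub>F n in sequentially. \<omega> \<in> space M - ?E n"
    proof (rule borel_cantelli_AE1)
      show "?E n \<in> events" for n by measurable
      show "emeasure M (?E n) < \<infinity>" for n by (simp add: less_top[symmetric])
      have "summable (\<lambda>n. (0 * real n + 2) * exp (- c * real n))" by (rule summable_linear_exp[OF c])
      then have "summable (\<lambda>n. 2 * exp (- c * real (Suc n)))"
        by (subst (asm) summable_Suc_iff[symmetric]) simp
      then show "summable (\<lambda>n. prob (?E n))"
        by (rule summable_comparison_test'[where N = 0]) (use pE in simp)
    qed
    then show ?thesis
    proof eventually_elim
      case (elim \<omega>)
      then have "\<forall>\<^sub>F n in sequentially. \<bar>(\<Sum>j\<in>{1..Suc n}. f (p j \<omega>)) / real (Suc n) - ?\<mu>\<bar> \<le> 1 / real (Suc k)"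
        by (rule eventually_mono) (auto simp: e_def)
      then show ?case by (subst (asm) eventually_sequentially_Suc)
    qed
  qed
  then have "AE \<omega> in M. \<forall>k. \<forall>\<^sub>F n in sequentially. \<bar>(\<Sum>j=1..n. f (p j \<omega>)) / real n - ?\<mu>\<bar> \<le> 1 / real (Suc k)"
    by (simp add: AE_all_countable)
  then show ?thesis
  proof eventually_elim
    case (elim \<omega>)
    then have "(\<lambda>n. (\<Sum>j=1..n. f (p j \<omega>)) / real n - ?\<mu>) \<longlonglongrightarrow> 0"
      by (intro tendsto_of_eventually_close[where C = 1]) auto
    then show ?case by (rule LIM_zero_cancel)
  qed
qed

text \<open>
  The deviation bound is summable in \<open>m\<close> once the Chernoff parameter \<open>\<theta>\<close> is small compared with \<open>\<delta>\<close>; the remaining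
  average over the environment converges by the strong law.
\<close>

theorem det_lpp_limit:
  assumes F: "unit_cdf F" and a: "right_edge F < a" "a < 1" and \<alpha>: "0 < \<alpha>"
  shows "AE \<omega> in M. (\<lambda>m. det_lpp a (\<lambda>j. p j \<omega>) (\<lambda>i j. \<epsilon> i j \<omega>) m (nat \<lfloor>\<alpha> * real m\<rfloor>) / real m)
    \<longlonglongrightarrow> a + \<alpha> * (\<integral>s. queue_mean a s \<partial>interval_measure F)"
proof -
  define b where "b = right_edge F"
  have b: "0 \<le> b" "b < a" using right_edge(2)[OF F] a by (auto simp: b_def)
  have a0: "0 < a" using b by simp
  define K where "K = max 1 (b * (1 - a) / (a - b))"
  have K: "1 \<le> K" by (simp add: K_def)
  have qK: "0 \<le> queue_mean a s" "queue_mean a s \<le> K" if "0 \<le> s" "s \<le> b" for s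
    using queue_mean_bounds[OF that b(2) a(2)] by (auto simp: K_def)
  let ?n = "\<lambda>m. nat \<lfloor>\<alpha> * real m\<rfloor>"
  let ?D = "\<lambda>\<omega> m. det_lpp a (\<lambda>j. p j \<omega>) (\<lambda>i j. \<epsilon> i j \<omega>) m (?n m)"
  let ?S = "\<lambda>\<omega> n. \<Sum>j=1..n. queue_mean a (p j \<omega>)"
  have close: "AE \<omega> in M. \<forall>\<^sub>F m in sequentially. \<bar>?D \<omega> m / real m - (a + ?S \<omega> (?n m) / real m)\<bar> \<le> 3 / real (Suc k)" for k
  proof -
    define \<delta> where "\<delta> = 1 / real (Suc k)"
    have \<delta>: "0 < \<delta>" by (simp add: \<delta>_def)
    \<comment> \<open>The first bound is the range of the Chernoff estimate, the second makes the quadratic term at most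
      half of the linear one when there are at most \<open>\<alpha> m\<close> columns.\<close>
    define \<theta> where "\<theta> = min (1 / (4 * K)) (\<delta> / (18 * K\<^sup>2 * \<alpha>))"
    have \<theta>: "0 < \<theta>" "\<theta> \<le> 1 / (4 * K)" "\<theta> \<le> \<delta> / (18 * K\<^sup>2 * \<alpha>)"
      using \<delta> K \<alpha> by (auto simp: \<theta>_def)
    have \<theta>1: "4 * K * \<theta> \<le> 1" using \<theta>(2) K by (simp add: field_simps)
    have "\<theta> * (18 * K\<^sup>2 * \<alpha>) \<le> \<delta>" using \<theta>(3) K \<alpha> by (simp add: pos_le_divide_eq)
    then have \<theta>2: "9 * K\<^sup>2 * \<theta>\<^sup>2 * \<alpha> \<le> \<theta> * \<delta> / 2"
      using mult_left_mono[of "\<theta> * (18 * K\<^sup>2 * \<alpha>)" \<delta> "\<theta> / 2"] \<theta>(1) by (simp add: power2_eq_square mult_ac)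
    define Q where "Q m x c \<longleftrightarrow> 0 < m \<and> \<bar>det_lpp a x (entries c) m (?n m) -
        (a * real m + (\<Sum>j=1..?n m. queue_mean a (x j)))\<bar> > 3 * \<delta> * real m" for m x c
    define B where "B m = (2 * real m + 4) * exp (- (2 * \<delta>\<^sup>2) * real m) +
        (2 * \<alpha> * real m + 2) * exp (- (\<theta> * \<delta> / 2) * real m)" for m
    have "AE \<omega> in M. \<forall>\<^sub>F m in sequentially. \<not> Q m (env \<omega>) (array_cols m (?n m) \<omega>)"
    proof (rule borel_cantelli_quenched[where b = b])
      show "Measurable.pred (PiM {1..} (\<lambda>_. borel)) (\<lambda>x. Q m x c)" for m c
      proof -
        have [measurable]: "(\<lambda>x. det_lpp a x (entries c) m (?n m)) \<in> borel_measurable (PiM {1..} (\<lambda>_. borel))"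
          unfolding det_lpp_def by (rule measurable_lpp_environment) measurable
        have [measurable]: "(\<lambda>x. \<Sum>j=1..?n m. queue_mean a (x j)) \<in> borel_measurable (PiM {1..} (\<lambda>_. borel))"
          by (intro borel_measurable_sum measurable_compose[OF _ queue_mean_measurable]
                measurable_component_singleton) auto
        show ?thesis unfolding Q_def by measurable
      qed
      show "measure_pmf.prob (array_pmf m x (?n m)) {c. Q m x c} \<le> B m"
        if x: "\<And>j. 1 \<le> j \<Longrightarrow> 0 \<le> x j \<and> x j \<le> b" for m x
      proof (cases "m = 0")
        case True
        then show ?thesis by (simp add: Q_def B_def)
      next
        case False
        have "{c. Q m x c} = {c. \<bar>det_lpp a x (entries c) m (?n m) -
            (a * real m + (\<Sum>j=1..?n m. queue_mean a (x j)))\<bar> > 3 * \<delta> * real m}"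
          using False by (simp add: Q_def)
        also have "measure_pmf.prob (array_pmf m x (?n m)) \<dots> \<le>
            2 * (real m + 2) * exp (- 2 * \<delta>\<^sup>2 * real m) +
            2 * (real (?n m) + 1) * exp (9 * K\<^sup>2 * \<theta>\<^sup>2 * real (?n m) - \<theta> * \<delta> * real m)"
        proof (rule det_lpp_tail[OF a0 a(2) _ K \<theta>1 \<theta>(1) _ \<delta>])
          show "0 \<le> x j \<and> x j < a \<and> queue_mean a (x j) \<le> K" if "1 \<le> j" for j
            using x[OF that] b qK[of "x j"] by auto
        qed (use False in simp)
        also have "\<dots> \<le> B m"
        proof -
          note n = nat_floor_bounds(1)[OF \<alpha>, of m]
          have "9 * K\<^sup>2 * \<theta>\<^sup>2 * real (?n m) \<le> 9 * K\<^sup>2 * \<theta>\<^sup>2 * (\<alpha> * real m)"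
            using n by (intro mult_left_mono) auto
          also have "\<dots> \<le> (\<theta> * \<delta> / 2) * real m"
            using mult_right_mono[OF \<theta>2, of "real m"] by (simp add: mult_ac)
          finally have "9 * K\<^sup>2 * \<theta>\<^sup>2 * real (?n m) - \<theta> * \<delta> * real m \<le> - (\<theta> * \<delta> / 2) * real m"
            by simp
          then have "2 * (real (?n m) + 1) * exp (9 * K\<^sup>2 * \<theta>\<^sup>2 * real (?n m) - \<theta> * \<delta> * real m) \<le>
              (2 * \<alpha> * real m + 2) * exp (- (\<theta> * \<delta> / 2) * real m)"
            using n \<alpha> by (intro mult_mono) auto
          then show ?thesis by (simp add: B_def algebra_simps)
        qed
        finally show ?thesis .
      qed
      show "summable B"
        unfolding B_def using \<delta> \<theta>(1) by (intro summable_add summable_linear_exp) auto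
      show "AE \<omega> in M. \<forall>j\<ge>1. 0 \<le> p j \<omega> \<and> p j \<omega> \<le> b" unfolding b_def by (rule env_support[OF F])
    qed
    then show ?thesis
    proof eventually_elim
      case (elim \<omega>)
      from elim eventually_gt_at_top[of 0] show ?case
      proof eventually_elim
        case (elim m)
        have "det_lpp a (env \<omega>) (entries (array_cols m (?n m) \<omega>)) m (?n m) = ?D \<omega> m"
          by (rule det_lpp_cong) (auto simp: env_def entries_array_cols)
        moreover have "(\<Sum>j=1..?n m. queue_mean a (env \<omega> j)) = ?S \<omega> (?n m)"
          by (intro sum.cong) (auto simp: env_def)
        ultimately have "\<bar>?D \<omega> m - (a * real m + ?S \<omega> (?n m))\<bar> \<le> 3 * \<delta> * real m"
          using elim by (auto simp: Q_def)
        then have "\<bar>?D \<omega> m - (a * real m + ?S \<omega> (?n m))\<bar> / real m \<le> 3 * \<delta>"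
          using elim(2) by (simp add: pos_divide_le_eq)
        also have "\<bar>?D \<omega> m - (a * real m + ?S \<omega> (?n m))\<bar> / real m =
            \<bar>(?D \<omega> m - (a * real m + ?S \<omega> (?n m))) / real m\<bar>" by simp
        also have "(?D \<omega> m - (a * real m + ?S \<omega> (?n m))) / real m = ?D \<omega> m / real m - (a + ?S \<omega> (?n m) / real m)"
          using elim(2) by (simp add: diff_divide_distrib add_divide_distrib)
        finally show ?case by (simp add: \<delta>_def)
      qed
    qed
  qed
  have "AE \<omega> in M. (\<lambda>n. ?S \<omega> n / real n) \<longlonglongrightarrow> (\<integral>s. queue_mean a s \<partial>interval_measure F)"
    using qK by (intro environment_lln[where C = K] F) (auto simp: b_def)
  moreover have "AE \<omega> in M. \<forall>k. \<forall>\<^sub>F m in sequentially. \<bar>?D \<omega> m / real m - (a + ?S \<omega> (?n m) / real m)\<bar> \<le> 3 / real (Suc k)"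
    using close by (simp add: AE_all_countable)
  ultimately show ?thesis
  proof eventually_elim
    case (elim \<omega>)
    have "(\<lambda>m. (?D \<omega> m / real m - (a + ?S \<omega> (?n m) / real m)) + (a + ?S \<omega> (?n m) / real m)) \<longlonglongrightarrow>
        0 + (a + \<alpha> * (\<integral>s. queue_mean a s \<partial>interval_measure F))"
      using elim(2)
      by (intro tendsto_add tendsto_const average_along_floor[OF \<alpha> elim(1)]
            tendsto_of_eventually_close[where C = 3]) auto
    then show ?case by simp
  qed
qed

text \<open>
  Uniformity over all columns costs only a factor linear in \<open>m\<close>.  The function \<open>\<kappa>\<close> will be the identity and
  the height at which a path enters a column.
\<close>

lemma column_counts:
  assumes F: "unit_cdf F" and \<alpha>: "0 < \<alpha>" and \<delta>: "0 < \<delta>" and \<kappa>: "\<And>m. \<kappa> m \<le> m"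
  shows "AE \<omega> in M. \<forall>\<^sub>F m in sequentially. \<forall>j\<in>{1..nat \<lfloor>\<alpha> * real m\<rfloor>}.
    \<bar>(\<Sum>i=1..\<kappa> m. of_bool (\<epsilon> i j \<omega>)) - p j \<omega> * real (\<kappa> m)\<bar> \<le> \<delta> * real m"
proof -
  let ?n = "\<lambda>m. nat \<lfloor>\<alpha> * real m\<rfloor>"
  define Q where "Q m x c \<longleftrightarrow> 0 < m \<and> (\<exists>j\<in>{1..?n m}. \<bar>ones (take (\<kappa> m) (c j)) - x j * real (\<kappa> m)\<bar> > \<delta> * real m)"
    for m and x :: "nat \<Rightarrow> real" and c
  have "AE \<omega> in M. \<forall>\<^sub>F m in sequentially. \<not> Q m (env \<omega>) (array_cols m (?n m) \<omega>)"
  proof (rule borel_cantelli_quenched[where b = 1 and B = "\<lambda>m. (2 * \<alpha> * real m + 0) * exp (- (2 * \<delta>\<^sup>2) * real m)"])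
    show "Measurable.pred (PiM {1..} (\<lambda>_. borel)) (\<lambda>x. Q m x c)" for m c
    proof -
      have [measurable]: "(\<lambda>x. x j) \<in> borel_measurable (PiM {1..} (\<lambda>_. borel))" if "j \<in> {1..?n m}" for j
        using that by (intro measurable_component_singleton) auto
      show ?thesis unfolding Q_def by measurable
    qed
    show "measure_pmf.prob (array_pmf m x (?n m)) {c. Q m x c} \<le> (2 * \<alpha> * real m + 0) * exp (- (2 * \<delta>\<^sup>2) * real m)"
      if x: "\<And>j. 1 \<le> j \<Longrightarrow> 0 \<le> x j \<and> x j \<le> 1" for m x
    proof (cases "m = 0")
      case True
      then show ?thesis by (simp add: Q_def)
    next
      case False
      let ?A = "array_pmf m x (?n m)"
      let ?X = "\<lambda>j. {xs. \<delta> * real m \<le> \<bar>ones (take (\<kappa> m) xs) - x j * real (\<kappa> m)\<bar>}"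
      have "measure_pmf.prob ?A {c. Q m x c} \<le> measure_pmf.prob ?A (\<Union>j\<in>{1..?n m}. {c. c j \<in> ?X j})"
        by (intro measure_pmf.finite_measure_mono) (auto simp: Q_def)
      also have "\<dots> \<le> (\<Sum>j\<in>{1..?n m}. measure_pmf.prob ?A {c. c j \<in> ?X j})"
        by (rule measure_UNION_le) auto
      also have "\<dots> \<le> (\<Sum>j\<in>{1..?n m}. 2 * exp (- (2 * \<delta>\<^sup>2) * real m))"
      proof (rule sum_mono)
        fix j assume j: "j \<in> {1..?n m}"
        have "measure_pmf.prob ?A {c. c j \<in> ?X j} = measure_pmf.prob (map_pmf (\<lambda>c. c j) ?A) (?X j)"
          by (simp add: vimage_def)
        also have "map_pmf (\<lambda>c. c j) ?A = replicate_pmf m (bernoulli_pmf (x j))"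
          unfolding array_pmf_def using j by (subst Pi_pmf_component) auto
        also have "measure_pmf.prob \<dots> (?X j) \<le> 2 * exp (- 2 * (\<delta> * real m)\<^sup>2 / real m)"
          using x[of j] j \<kappa> \<delta> False by (intro ones_tail) auto
        also have "\<dots> = 2 * exp (- (2 * \<delta>\<^sup>2) * real m)" using False by (simp add: power2_eq_square mult_ac)
        finally show "measure_pmf.prob ?A {c. c j \<in> ?X j} \<le> \<dots>" .
      qed
      also have "\<dots> \<le> (2 * \<alpha> * real m + 0) * exp (- (2 * \<delta>\<^sup>2) * real m)"
        using nat_floor_bounds(1)[OF \<alpha>, of m] by (auto intro!: mult_right_mono)
      finally show ?thesis .
    qed
    show "summable (\<lambda>m. (2 * \<alpha> * real m + 0) * exp (- (2 * \<delta>\<^sup>2) * real m))"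
      using \<delta> by (intro summable_linear_exp) auto
    show "AE \<omega> in M. \<forall>j\<ge>1. 0 \<le> p j \<omega> \<and> p j \<omega> \<le> 1"
      using env_support[OF F] right_edge(3)[OF F] by (auto elim!: eventually_mono)
  qed
  then show ?thesis
  proof eventually_elim
    case (elim \<omega>)
    from elim eventually_gt_at_top[of 0] show ?case
    proof eventually_elim
      case (elim m)
      have "ones (take (\<kappa> m) (array_cols m (?n m) \<omega> j)) = (\<Sum>i=1..\<kappa> m. of_bool (\<epsilon> i j \<omega>))"
        if "j \<in> {1..?n m}" for j
      proof -
        have "ones (take (\<kappa> m) (array_cols m (?n m) \<omega> j)) =
            (\<Sum>i=1..\<kappa> m. of_bool (entries (array_cols m (?n m) \<omega>) i j))"
          unfolding entries_def using that \<kappa>[of m] by (intro ones_take) (simp add: array_cols_def del: upt_Suc)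
        also have "\<dots> = (\<Sum>i=1..\<kappa> m. of_bool (\<epsilon> i j \<omega>))"
        proof (rule sum.cong[OF refl])
          fix i assume "i \<in> {1..\<kappa> m}"
          then show "of_bool (entries (array_cols m (?n m) \<omega>) i j) = (of_bool (\<epsilon> i j \<omega>) :: real)"
            using that \<kappa>[of m] by (subst entries_array_cols) auto
        qed
        finally show ?thesis .
      qed
      with elim show ?case by (force simp: Q_def env_def)
    qed
  qed
qed

end

section \<open>The critical direction\<close>

lemma queue_mean_nonneg: "0 \<le> s \<Longrightarrow> s < a \<Longrightarrow> a < 1 \<Longrightarrow> 0 \<le> queue_mean a s"
  by (simp add: queue_mean_def)

text \<open>
  Along the left edge, \<open>a k\<close> is at most \<open>a k0\<close> below \<open>k0\<close> and at most \<open>a' k - (a' - a) k0\<close> above it; along the bottom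
  edge the same holds with the larger queue means of a smaller parameter \<open>a''\<close>.  Max-plus linearity turns these
  two boundary estimates into one for the values.  In terms of paths: the first term bounds those that
  leave the boundary near the corner, the other two those that follow it for long.
\<close>

lemma det_lpp_comparison:
  assumes q: "\<And>j. 1 \<le> j \<Longrightarrow> 0 \<le> q j \<and> q j < a''"
    and a: "a'' < a" "a < a'" "a' < 1" "0 < a" and k0: "0 \<le> k0"
  defines "S \<equiv> \<lambda>x l. \<Sum>j=1..l. queue_mean x (q j)"
  shows "det_lpp a q A m n \<le> max (lpp0 A m n + max (a * k0) (S a l0))
     (max (det_lpp a' q A m n - (a' - a) * k0) (det_lpp a'' q A m n - (S a'' l0 - S a l0)))"
proof -
  let ?c = "max (a * k0) (S a l0)"
  let ?d' = "(a' - a) * k0" and ?d'' = "S a'' l0 - S a l0"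
  have inc: "queue_mean a (q j) \<le> queue_mean a'' (q j)" "0 \<le> queue_mean a (q j)" if "1 \<le> j" for j
  proof -
    have "0 \<le> q j" "q j < a''" using q that by auto
    then have *: "queue_mean x (q j) = q j * ((1 - x) / (x - q j))" for x
      by (simp add: queue_mean_def)
    show "0 \<le> queue_mean a (q j)" using \<open>0 \<le> q j\<close> \<open>q j < a''\<close> a by (simp add: queue_mean_def)
    show "queue_mean a (q j) \<le> queue_mean a'' (q j)"
      unfolding * using \<open>0 \<le> q j\<close> \<open>q j < a''\<close> a by (intro mult_left_mono frac_le) auto
  qed
  have col: "a * real k \<le> max ?c (max (a' * real k + - ?d') (a'' * real k + - ?d''))" for k
  proof (cases "real k \<le> k0")
    case True
    then have "a * real k \<le> a * k0" using a by (intro mult_left_mono) auto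
    then show ?thesis by (simp add: le_max_iff_disj)
  next
    case False
    then have "0 \<le> (a' - a) * (real k - k0)" using a by simp
    then have "a * real k \<le> a' * real k + - ?d'" by (simp add: algebra_simps)
    then show ?thesis by (simp add: le_max_iff_disj)
  qed
  have row: "S a l \<le> max ?c (max (S a' l + - ?d') (S a'' l + - ?d''))" for l
  proof (cases "l \<le> l0")
    case True
    have "S a l \<le> S a l0"
      unfolding S_def using True inc by (intro sum_mono2) auto
    then show ?thesis by (simp add: le_max_iff_disj)
  next
    case False
    have "(\<Sum>j=1..l0. queue_mean a'' (q j) - queue_mean a (q j)) \<le> (\<Sum>j=1..l. queue_mean a'' (q j) - queue_mean a (q j))"
      using False inc by (intro sum_mono2) auto
    then have "S a l \<le> S a'' l + - ?d''" by (simp add: S_def sum_subtractf)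
    then show ?thesis by (simp add: le_max_iff_disj)
  qed
  have Sa: "(\<lambda>l. \<Sum>j=1..l. queue_mean a (q j)) = S a" by (simp add: S_def fun_eq_iff)
  have "det_lpp a q A m n \<le>
      lpp (\<lambda>k. max ?c (max (a' * real k + - ?d') (a'' * real k + - ?d'')))
          (\<lambda>l. max ?c (max (S a' l + - ?d') (S a'' l + - ?d''))) A m n"
    unfolding det_lpp_def Sa by (rule lpp_mono_boundary, rule col, rule row)
  also have "\<dots> = max (lpp (\<lambda>_. 0 + ?c) (\<lambda>_. 0 + ?c) A m n)
      (max (lpp (\<lambda>k. a' * real k + - ?d') (\<lambda>l. S a' l + - ?d') A m n)
        (lpp (\<lambda>k. a'' * real k + - ?d'') (\<lambda>l. S a'' l + - ?d'') A m n))"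
    by (simp add: lpp_max)
  also have "\<dots> = max (lpp0 A m n + ?c)
      (max (lpp (\<lambda>k. a' * real k) (S a') A m n + - ?d') (lpp (\<lambda>k. a'' * real k) (S a'') A m n + - ?d''))"
    by (simp only: lpp_add_const)
  finally show ?thesis unfolding det_lpp_def S_def by simp
qed

lemma lpp0_le_det_lpp:
  assumes "\<And>j. 1 \<le> j \<Longrightarrow> 0 \<le> q j \<and> q j < a" "0 < a" "a < 1"
  shows "lpp0 A m n \<le> det_lpp a q A m n"
  unfolding det_lpp_def using assms
  by (intro lpp_mono_boundary sum_nonneg)
     (auto intro!: queue_mean_nonneg)

definition mean_queue :: "(real \<Rightarrow> real) \<Rightarrow> real \<Rightarrow> real" where
  "mean_queue F a = (\<integral>s. queue_mean a s \<partial>interval_measure F)"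

text \<open>
  Minus the derivative of \<open>mean_queue F\<close>.
\<close>

definition slope :: "(real \<Rightarrow> real) \<Rightarrow> real \<Rightarrow> real" where
  "slope F a = (\<integral>s. s * (1 - s) / (a - s)\<^sup>2 \<partial>interval_measure F)"

lemma integrable_interval_measure:
  fixes f :: "real \<Rightarrow> real" and C :: real
  assumes F: "unit_cdf F" and [measurable]: "f \<in> borel_measurable borel"
    and C: "\<And>s. 0 \<le> s \<Longrightarrow> s \<le> right_edge F \<Longrightarrow> \<bar>f s\<bar> \<le> C"
  shows "integrable (interval_measure F) f"
proof -
  interpret real_distribution "interval_measure F" by (rule unit_cdf_real_distribution[OF F])
  have "AE s in interval_measure F. norm (f s) \<le> C"
    using AE_interval_measure_support[OF F] by eventually_elim (use C in auto)
  then show ?thesis by (intro integrable_const_bound[where B = C]) auto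
qed

lemma integrable_queue_mean:
  assumes F: "unit_cdf F" and a: "right_edge F < a" "a < 1"
  shows "integrable (interval_measure F) (queue_mean a)"
  using queue_mean_bounds[of _ "right_edge F" a] a
  by (intro integrable_interval_measure[OF F, where C = "right_edge F * (1 - a) / (a - right_edge F)"]) auto

lemma slope_integrand_bounds:
  fixes s b a :: real
  assumes "0 \<le> s" "s \<le> b" "b < a" "b \<le> 1"
  shows "0 \<le> s * (1 - s) / (a - s)\<^sup>2" "s * (1 - s) / (a - s)\<^sup>2 \<le> 1 / (a - b)\<^sup>2"
proof -
  show "0 \<le> s * (1 - s) / (a - s)\<^sup>2" using assms by simp
  have "s * (1 - s) \<le> 1 * 1" using assms by (intro mult_mono) auto
  then show "s * (1 - s) / (a - s)\<^sup>2 \<le> 1 / (a - b)\<^sup>2"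
    using assms by (intro frac_le power_mono) auto
qed

lemma integrable_slope:
  assumes F: "unit_cdf F" and a: "right_edge F < a"
  shows "integrable (interval_measure F) (\<lambda>s. s * (1 - s) / (a - s)\<^sup>2)"
  using slope_integrand_bounds[of _ "right_edge F" a] a right_edge[OF F]
  by (intro integrable_interval_measure[OF F, where C = "1 / (a - right_edge F)\<^sup>2"]) auto

text \<open>
  Since \<open>queue_mean a s = s (1 - s) / (a - s) - s\<close>, the dependence on \<open>a\<close> is that of \<open>1 / (a - s)\<close>, whose first-order
  Taylor remainder is explicit.
\<close>

lemma queue_mean_convex:
  fixes s b a x :: real
  assumes s: "0 \<le> s" "s \<le> b" and b: "b < a" "b < x" "b \<le> 1"
  defines "w \<equiv> s * (1 - s) / (a - s)\<^sup>2"
  shows "queue_mean a s + (a - x) * w \<le> queue_mean x s"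
    and "queue_mean x s \<le> queue_mean a s + (a - x) * w + (a - x)\<^sup>2 / (x - b) * w"
proof -
  have pos: "0 < a - s" "0 < x - s" "0 < x - b" using assms by auto
  have q: "queue_mean y s = s * (1 - s) / (y - s) - s" if "y \<noteq> s" for y
    using that by (simp add: queue_mean_def field_simps)
  have e1: "1 / (x - s) = 1 / (a - s) + (a - x) / (a - s)\<^sup>2 + (a - x)\<^sup>2 / ((x - s) * (a - s)\<^sup>2)"
  proof -
    have "1 / X = 1 / A + (A - X) / A\<^sup>2 + (A - X)\<^sup>2 / (X * A\<^sup>2)" if "0 < A" "0 < X" for A X :: real
      using that by (simp add: divide_simps) (simp add: power2_eq_square algebra_simps)
    from this[OF pos(1,2)] show ?thesis by simp
  qed
  have "queue_mean x s = s * (1 - s) * (1 / (x - s)) - s"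
    using pos by (subst q) auto
  also have "\<dots> = queue_mean a s + (a - x) * w + (a - x)\<^sup>2 / (x - s) * w"
    unfolding e1 w_def using pos by (subst q) (auto simp: distrib_left mult_ac)
  finally have eq: "queue_mean x s = queue_mean a s + (a - x) * w + (a - x)\<^sup>2 / (x - s) * w" .
  have w: "0 \<le> w" unfolding w_def using assms by simp
  show "queue_mean a s + (a - x) * w \<le> queue_mean x s" unfolding eq using w pos by simp
  show "queue_mean x s \<le> queue_mean a s + (a - x) * w + (a - x)\<^sup>2 / (x - b) * w"
    unfolding eq using w pos s by (intro add_left_mono mult_right_mono frac_le) auto
qed

lemma mean_queue_convex:
  assumes F: "unit_cdf F" and a: "right_edge F < a" "a < 1" and x: "right_edge F < x" "x < 1"
  shows "mean_queue F a + (a - x) * slope F a \<le> mean_queue F x"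
    and "mean_queue F x \<le> mean_queue F a + (a - x) * slope F a + (a - x)\<^sup>2 / (x - right_edge F) * slope F a"
proof -
  define W where "W = (\<lambda>s::real. s * (1 - s) / (a - s)\<^sup>2)"
  have W: "integrable (interval_measure F) W" "slope F a = (\<integral>s. W s \<partial>interval_measure F)"
    using integrable_slope[OF F a(1)] by (simp_all add: W_def slope_def)
  note [simp] = integrable_queue_mean[OF F a] integrable_queue_mean[OF F x] W(1)
  note q = queue_mean_convex[OF _ _ a(1) x(1) right_edge(3)[OF F], folded W_def]
  have "mean_queue F a + (a - x) * slope F a =
      (\<integral>s. queue_mean a s + (a - x) * W s \<partial>interval_measure F)"
    unfolding mean_queue_def W(2) by (subst Bochner_Integration.integral_add) auto
  also have "\<dots> \<le> mean_queue F x"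
    unfolding mean_queue_def
  proof (rule integral_mono_AE)
    show "AE s in interval_measure F. queue_mean a s + (a - x) * W s \<le> queue_mean x s"
      using AE_interval_measure_support[OF F] by eventually_elim (use q(1) in \<open>auto simp: W_def\<close>)
  qed auto
  finally show "mean_queue F a + (a - x) * slope F a \<le> mean_queue F x" .
  have "mean_queue F x \<le> (\<integral>s. queue_mean a s + (a - x) * W s + (a - x)\<^sup>2 / (x - right_edge F) * W s
      \<partial>interval_measure F)"
    unfolding mean_queue_def
  proof (rule integral_mono_AE)
    show "AE s in interval_measure F. queue_mean x s \<le> queue_mean a s + (a - x) * W s +
      (a - x)\<^sup>2 / (x - right_edge F) * W s"
      using AE_interval_measure_support[OF F] by eventually_elim (use q(2) in \<open>auto simp: W_def\<close>)
  qed auto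
  also have "\<dots> = mean_queue F a + (a - x) * slope F a + (a - x)\<^sup>2 / (x - right_edge F) * slope F a"
    unfolding mean_queue_def W(2)
    by (subst Bochner_Integration.integral_add, simp, simp, subst Bochner_Integration.integral_add) auto
  finally show "mean_queue F x \<le> \<dots>" .
qed

lemma mean_queue_nonneg:
  assumes F: "unit_cdf F" and a: "right_edge F < a" "a < 1"
  shows "0 \<le> mean_queue F a"
  unfolding mean_queue_def
proof (rule integral_nonneg_AE)
  show "AE s in interval_measure F. 0 \<le> queue_mean a s"
    using AE_interval_measure_support[OF F] by eventually_elim (use a queue_mean_nonneg in auto)
qed

text \<open>
  \<open>liminf f \<ge> v\<close> and, below, \<open>limsup f \<le> v\<close>, in the form in which eventual inequalities combine.
\<close>

definition liminf_ge :: "(nat \<Rightarrow> real) \<Rightarrow> real \<Rightarrow> bool" where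
  "liminf_ge f v \<longleftrightarrow> (\<forall>e>0. \<forall>\<^sub>F m in sequentially. v - e \<le> f m)"

definition limsup_le :: "(nat \<Rightarrow> real) \<Rightarrow> real \<Rightarrow> bool" where
  "limsup_le f v \<longleftrightarrow> (\<forall>e>0. \<forall>\<^sub>F m in sequentially. f m \<le> v + e)"

lemma liminf_ge_limit:
  assumes "\<And>k. \<forall>\<^sub>F m in sequentially. r k \<le> f m" "r \<longlonglongrightarrow> v"
  shows "liminf_ge f v"
  unfolding liminf_ge_def
proof (intro allI impI)
  fix e :: real assume "0 < e"
  then have "\<forall>\<^sub>F k in sequentially. v - e < r k" using assms(2) by (intro order_tendstoD) auto
  then obtain k where k: "v - e < r k" by (auto simp: eventually_sequentially)
  from assms(1)[of k] show "\<forall>\<^sub>F m in sequentially. v - e \<le> f m"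
    by eventually_elim (use k in simp)
qed

lemma liminf_ge_closed:
  assumes "\<And>k. liminf_ge f (r k)" "r \<longlonglongrightarrow> v"
  shows "liminf_ge f v"
proof (rule liminf_ge_limit)
  show "\<forall>\<^sub>F m in sequentially. r k - 1 / real (Suc k) \<le> f m" for k
    using assms(1)[of k] by (simp add: liminf_ge_def)
  have "(\<lambda>k. r k - 1 / real (Suc k)) \<longlonglongrightarrow> v - 0"
    by (intro tendsto_diff assms(2) LIMSEQ_Suc lim_1_over_n)
  then show "(\<lambda>k. r k - 1 / real (Suc k)) \<longlonglongrightarrow> v" by simp
qed

lemma limsup_le_iff_ge: "limsup_le f v \<longleftrightarrow> liminf_ge (\<lambda>m. - f m) (- v)"
proof -
  have "- v - e \<le> - f m \<longleftrightarrow> f m \<le> v + e" for e m by auto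
  then show ?thesis by (simp add: limsup_le_def liminf_ge_def)
qed

lemma limsup_le_closed:
  assumes "\<And>k. limsup_le f (r k)" "r \<longlonglongrightarrow> v"
  shows "limsup_le f v"
  using assms liminf_ge_closed[of "\<lambda>m. - f m" "\<lambda>k. - r k" "- v"]
  by (simp add: limsup_le_iff_ge tendsto_minus)

lemma liminf_ge_mono: "liminf_ge f v \<Longrightarrow> v' \<le> v \<Longrightarrow> liminf_ge f v'"
  unfolding liminf_ge_def by (meson diff_right_mono eventually_mono order.trans)

lemma tendsto_of_liminf_limsup:
  assumes "liminf_ge f v" "limsup_le f v"
  shows "f \<longlonglongrightarrow> v"
proof (rule tendstoI)
  fix e :: real assume e: "0 < e"
  have "\<forall>\<^sub>F m in sequentially. v - e / 2 \<le> f m" "\<forall>\<^sub>F m in sequentially. f m \<le> v + e / 2"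
    using assms e by (simp_all add: liminf_ge_def limsup_le_def)
  then show "\<forall>\<^sub>F m in sequentially. dist (f m) v < e"
    by eventually_elim (use e in \<open>auto simp: dist_real_def abs_less_iff\<close>)
qed

context random_environment_array
begin

definition path_rate :: "real \<Rightarrow> 'w \<Rightarrow> nat \<Rightarrow> real" where
  "path_rate \<alpha> \<omega> m = lpp0 (\<lambda>i j. \<epsilon> i j \<omega>) m (nat \<lfloor>\<alpha> * real m\<rfloor>) / real m"

lemma path_rate_upper:
  assumes F: "unit_cdf F" and a: "right_edge F < a" "a < 1" and \<alpha>: "0 < \<alpha>"
  shows "AE \<omega> in M. limsup_le (path_rate \<alpha> \<omega>) (a + \<alpha> * mean_queue F a)"
  using det_lpp_limit[OF F a \<alpha>] env_support[OF F]
proof eventually_elim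
  case (elim \<omega>)
  show ?case
    unfolding limsup_le_def
  proof (intro allI impI)
    fix e :: real assume e: "0 < e"
    have "\<forall>\<^sub>F m in sequentially. det_lpp a (\<lambda>j. p j \<omega>) (\<lambda>i j. \<epsilon> i j \<omega>) m (nat \<lfloor>\<alpha> * real m\<rfloor>) / real m
        < a + \<alpha> * mean_queue F a + e"
      using elim(1) e unfolding mean_queue_def by (intro order_tendstoD) auto
    then show "\<forall>\<^sub>F m in sequentially. path_rate \<alpha> \<omega> m \<le> a + \<alpha> * mean_queue F a + e"
    proof eventually_elim
      case (elim m)
      have "path_rate \<alpha> \<omega> m \<le> det_lpp a (\<lambda>j. p j \<omega>) (\<lambda>i j. \<epsilon> i j \<omega>) m (nat \<lfloor>\<alpha> * real m\<rfloor>) / real m"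
        unfolding path_rate_def using \<open>\<forall>j\<ge>1. _ j\<close> a right_edge(2)[OF F]
        by (intro divide_right_mono lpp0_le_det_lpp) force+
      with elim show ?case by simp
    qed
  qed
qed

text \<open>
  The condition says that \<open>a\<close> is a critical point of \<open>\<phi> x = x + \<alpha> mean_queue F x\<close>.  Moving the parameter by \<open>\<tau>\<close>
  raises \<open>\<phi>\<close> by at most a multiple of \<open>\<tau>\<^sup>2\<close>, while following either boundary over a length proportional to \<open>\<eta>\<close>
  gains \<open>\<tau> \<eta>\<close> in the comparison.  With \<open>\<tau>\<close> a small multiple of \<open>\<eta>\<close>, the terms for \<open>a + \<tau>\<close> and \<open>a - \<tau>\<close> cannot attain the
  maximum, so the path without boundary loses at most a multiple of \<open>\<eta>\<close>.
\<close>

theorem path_rate_lower_critical: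
  assumes F: "unit_cdf F" and a: "right_edge F < a" "a < 1" and \<alpha>: "0 < \<alpha>"
    and crit: "\<alpha> * slope F a = 1"
  shows "AE \<omega> in M. liminf_ge (path_rate \<alpha> \<omega>) (a + \<alpha> * mean_queue F a)"
proof -
  define b where "b = right_edge F"
  have b: "0 \<le> b" "b < a" using right_edge[OF F] a by (auto simp: b_def)
  define \<phi> where "\<phi> x = x + \<alpha> * mean_queue F x" for x
  have \<phi>a: "0 < \<phi> a" "a \<le> \<phi> a" "\<alpha> * mean_queue F a \<le> \<phi> a"
    using mean_queue_nonneg[OF F a] \<alpha> a b by (auto simp: \<phi>_def intro!: add_pos_nonneg)
  have main: "AE \<omega> in M. \<forall>\<^sub>F m in sequentially. \<phi> a - \<eta> * (\<phi> a + 1) \<le> path_rate \<alpha> \<omega> m" if \<eta>: "0 < \<eta>" "\<eta> < 1" for \<eta>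
  proof -
    \<comment> \<open>Keeps \<open>a + \<tau>\<close> below 1 and \<open>a - \<tau>\<close> away from the right edge, and makes the quadratic loss at most half
      of the gain \<open>\<tau> \<eta>\<close>.\<close>
    define \<tau> where "\<tau> = min ((1 - a) / 2) (\<eta> * (a - b) / 4)"
    have \<tau>: "0 < \<tau>" "\<tau> \<le> (1 - a) / 2" "\<tau> \<le> \<eta> * (a - b) / 4"
      using a b \<eta> unfolding \<tau>_def by (simp, intro min.cobounded1, intro min.cobounded2)
    have "\<eta> * (a - b) \<le> 1 * (a - b)" using \<eta> b by (intro mult_right_mono) auto
    with \<tau>(3) have \<tau>b: "\<tau> \<le> (a - b) / 4" by linarith
    define a' where "a' = a + \<tau>"
    define a'' where "a'' = a - \<tau>"
    have a'': "b < a''" "a'' < a" "a'' < 1" "(a - b) / 2 \<le> a'' - b" using \<tau> \<tau>b a b by (auto simp: a''_def)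
    have a': "b < a'" "a < a'" "a' < 1" "(a - b) / 2 \<le> a' - b" using \<tau> a b by (auto simp: a'_def)
    have quad: "\<phi> x \<le> \<phi> a + \<tau> * \<eta> / 2" if x: "\<bar>a - x\<bar> = \<tau>" "(a - b) / 2 \<le> x - b" "x < 1" for x
    proof -
      have xb: "b < x" using x(2) b by simp
      have "\<alpha> * mean_queue F x \<le> \<alpha> * (mean_queue F a + (a - x) * slope F a + (a - x)\<^sup>2 / (x - b) * slope F a)"
        using mean_queue_convex(2)[OF F a, of x] xb x(3) \<alpha> by (intro mult_left_mono) (auto simp: b_def)
      also have "\<dots> = \<alpha> * mean_queue F a + ((a - x) + (a - x)\<^sup>2 / (x - b)) * (\<alpha> * slope F a)"
        by (simp add: algebra_simps)
      finally have "\<phi> x \<le> \<phi> a + (a - x)\<^sup>2 / (x - b)" unfolding crit by (simp add: \<phi>_def)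
      also have "(a - x)\<^sup>2 = \<tau>\<^sup>2" using x(1) by (metis power2_abs)
      also have "\<tau>\<^sup>2 / (x - b) \<le> \<tau>\<^sup>2 / ((a - b) / 2)" using x(2) b by (intro divide_left_mono) auto
      also have "\<dots> = \<tau> * (2 * \<tau> / (a - b))" by (simp add: power2_eq_square)
      also have "\<dots> \<le> \<tau> * (\<eta> / 2)"
        using \<tau> b by (intro mult_left_mono) (auto simp: pos_divide_le_eq field_simps)
      finally show ?thesis by simp
    qed
    let ?n = "\<lambda>m. nat \<lfloor>\<alpha> * real m\<rfloor>"
    let ?l = "\<lambda>m. nat \<lfloor>(\<alpha> * \<eta>) * real m\<rfloor>"
    let ?D = "\<lambda>x \<omega> m. det_lpp x (\<lambda>j. p j \<omega>) (\<lambda>i j. \<epsilon> i j \<omega>) m (?n m)"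
    let ?S = "\<lambda>x \<omega> l. \<Sum>j=1..l. queue_mean x (p j \<omega>)"
    have D: "AE \<omega> in M. (\<lambda>m. ?D x \<omega> m / real m) \<longlonglongrightarrow> \<phi> x" if "b < x" "x < 1" for x
      using det_lpp_limit[OF F, of x \<alpha>] that \<alpha> by (simp add: b_def \<phi>_def mean_queue_def)
    have S: "AE \<omega> in M. (\<lambda>m. ?S x \<omega> (?l m) / real m) \<longlonglongrightarrow> (\<alpha> * \<eta>) * mean_queue F x" if x: "b < x" "x < 1" for x
    proof -
      have "AE \<omega> in M. (\<lambda>n. ?S x \<omega> n / real n) \<longlonglongrightarrow> mean_queue F x"
        unfolding mean_queue_def using queue_mean_bounds[of _ b x] x
        by (intro environment_lln[OF F, where C = "b * (1 - x) / (x - b)"]) (auto simp: b_def)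
      then show ?thesis
        by eventually_elim (rule average_along_floor, use \<alpha> \<eta> in auto)
    qed
    from D[OF b(2) a(2)] D[OF a'(1,3)] D[OF a''(1,3)] S[OF b(2) a(2)] S[OF a''(1,3)] env_support[OF F]
    show ?thesis
    proof eventually_elim
      case (elim \<omega>)
      have gain: "\<tau> * \<eta> \<le> (\<alpha> * \<eta>) * mean_queue F a'' - (\<alpha> * \<eta>) * mean_queue F a"
      proof -
        have "\<tau> * \<eta> = \<tau> * \<eta> * (\<alpha> * slope F a)" unfolding crit by simp
        also have "\<dots> = \<alpha> * \<eta> * (\<tau> * slope F a)" by (simp only: mult_ac)
        also have "\<dots> \<le> \<alpha> * \<eta> * (mean_queue F a'' - mean_queue F a)"
          using mean_queue_convex(1)[OF F a, of a''] a'' \<alpha> \<eta>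
          by (intro mult_left_mono) (auto simp: b_def a''_def)
        finally show ?thesis by (simp only: right_diff_distrib)
      qed
      define z where "z = \<tau> * \<eta>"
      have z: "0 < z" using \<tau> \<eta> by (simp add: z_def)
      \<comment> \<open>At most \<open>4 e\<close> of error enters the comparison, against a gain of \<open>z / 2\<close>.\<close>
      define e where "e = min (\<eta> / 2) (z / 8)"
      have e: "0 < e" "e \<le> \<eta> / 2" "e \<le> z / 8" using \<eta> z by (auto simp: e_def)
      have q': "\<phi> a' \<le> \<phi> a + z / 2" "\<phi> a'' \<le> \<phi> a + z / 2"
        using quad[of a'] quad[of a''] a' a'' \<tau>(1) by (auto simp: a'_def a''_def z_def)
      have g': "z \<le> (\<alpha> * \<eta>) * mean_queue F a'' - (\<alpha> * \<eta>) * mean_queue F a" using gain by (simp add: z_def)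
      have E1: "\<forall>\<^sub>F m in sequentially. \<phi> a - e < ?D a \<omega> m / real m"
        using elim(1) e by (intro order_tendstoD) auto
      have E2: "\<forall>\<^sub>F m in sequentially. ?D a' \<omega> m / real m < \<phi> a' + e"
        using elim(2) e by (intro order_tendstoD) auto
      have E3: "\<forall>\<^sub>F m in sequentially. ?D a'' \<omega> m / real m < \<phi> a'' + e"
        using elim(3) e by (intro order_tendstoD) auto
      have E4: "\<forall>\<^sub>F m in sequentially. ?S a \<omega> (?l m) / real m < (\<alpha> * \<eta>) * mean_queue F a + e"
        using elim(4) e by (intro order_tendstoD) auto
      have E5: "\<forall>\<^sub>F m in sequentially. (\<alpha> * \<eta>) * mean_queue F a'' - e < ?S a'' \<omega> (?l m) / real m"
        using elim(5) e by (intro order_tendstoD) auto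
      from E1 E2 E3 E4 E5 eventually_gt_at_top[of 0] show ?case
      proof eventually_elim
        case (elim m)
        let ?k = "\<eta> * real m"
        have qs: "0 \<le> p j \<omega> \<and> p j \<omega> < a''" if "1 \<le> j" for j
          using \<open>\<forall>j\<ge>1. _ j\<close> that a''(1) by (force simp: b_def)
        have cmp: "?D a \<omega> m \<le> max (lpp0 (\<lambda>i j. \<epsilon> i j \<omega>) m (?n m) + max (a * ?k) (?S a \<omega> (?l m)))
           (max (?D a' \<omega> m - (a' - a) * ?k) (?D a'' \<omega> m - (?S a'' \<omega> (?l m) - ?S a \<omega> (?l m))))"
          using qs a' a'' b \<eta> by (intro det_lpp_comparison) auto
        define H X X' X'' S S'' where "H = lpp0 (\<lambda>i j. \<epsilon> i j \<omega>) m (?n m)" and "X = ?D a \<omega> m"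
          and "X' = ?D a' \<omega> m" and "X'' = ?D a'' \<omega> m" and "S = ?S a \<omega> (?l m)" and "S'' = ?S a'' \<omega> (?l m)"
        note defs = H_def[symmetric] X_def[symmetric] X'_def[symmetric] X''_def[symmetric]
          S_def[symmetric] S''_def[symmetric]
        have r: "0 < real m" using elim(6) by simp
        have "X \<le> H + a * ?k \<or> X \<le> H + S \<or> X \<le> X' - (a' - a) * ?k \<or> X \<le> X'' - (S'' - S)"
          using cmp unfolding defs le_max_iff_disj max_add_distrib_right by blast
        then have "X / real m \<le> (H + a * ?k) / real m \<or> X / real m \<le> (H + S) / real m \<or>
            X / real m \<le> (X' - (a' - a) * ?k) / real m \<or> X / real m \<le> (X'' - (S'' - S)) / real m"
          using divide_right_mono[OF _ less_imp_le[OF r]] by blast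
        then have dis: "X / real m \<le> H / real m + a * \<eta> \<or> X / real m \<le> H / real m + S / real m \<or>
            X / real m \<le> X' / real m - z \<or> X / real m \<le> X'' / real m - (S'' / real m - S / real m)"
          using r by (simp add: add_divide_distrib diff_divide_distrib a'_def z_def)
        note el = elim(1-5)[unfolded defs]
        have "\<not> X / real m \<le> X' / real m - z"
          using el(1,2) q'(1) e(3) z by linarith
        moreover have "\<not> X / real m \<le> X'' / real m - (S'' / real m - S / real m)"
          using el(1,3,4,5) q'(2) g' e(3) z by linarith
        ultimately have "X / real m \<le> H / real m + a * \<eta> \<or> X / real m \<le> H / real m + S / real m"
          using dis by blast
        moreover have "a * \<eta> \<le> \<eta> * \<phi> a" using mult_right_mono[OF \<phi>a(2), of \<eta>] \<eta> by (simp only: mult.commute)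
        moreover have "(\<alpha> * \<eta>) * mean_queue F a \<le> \<eta> * \<phi> a"
          using mult_left_mono[OF \<phi>a(3), of \<eta>] \<eta> by (simp only: mult_ac)
        ultimately have "X / real m \<le> H / real m + (\<eta> * \<phi> a + e)"
          using el(4) e(1) by linarith
        then have "\<phi> a - \<eta> * \<phi> a - \<eta> \<le> H / real m" using el(1) e(2) by linarith
        then show ?case unfolding path_rate_def defs by (simp add: distrib_left)
      qed
    qed
  qed
  have "AE \<omega> in M. \<forall>k. \<forall>\<^sub>F m in sequentially. \<phi> a - 1 / real (k + 2) * (\<phi> a + 1) \<le> path_rate \<alpha> \<omega> m"
    unfolding AE_all_countable by (intro allI main) auto
  then show ?thesis
  proof eventually_elim
    case (elim \<omega>)
    have "(\<lambda>k. \<phi> a - 1 / real (k + 2) * (\<phi> a + 1)) \<longlonglongrightarrow> \<phi> a - 0 * (\<phi> a + 1)"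
      by (intro tendsto_diff tendsto_mult tendsto_const LIMSEQ_ignore_initial_segment lim_1_over_n)
    then show ?case
      using elim by (intro liminf_ge_limit[where r = "\<lambda>k. \<phi> a - 1 / real (k + 2) * (\<phi> a + 1)"]) (auto simp: \<phi>_def)
  qed
qed

end

section \<open>Directions other than the critical one\<close>

context random_environment_array
begin

text \<open>
  Use an optimal path in direction \<open>\<alpha>0\<close> for a proportion \<open>\<theta>\<close> of the rows and climb the remaining rows in a single column
  whose parameter is nearly the right edge.  Such a column exists among any positive fraction of the columns;
  shrinking \<open>\<theta>\<close> by the factor \<open>1 - \<eta>\<close> leaves a positive fraction of the columns free to the right of the first part.
\<close>

lemma path_rate_lower_concat:
  assumes F: "unit_cdf F" and \<alpha>: "0 < \<alpha>" and \<theta>: "0 \<le> \<theta>" "\<theta> \<le> 1" and \<alpha>0: "0 < \<alpha>0" "\<theta> * \<alpha>0 \<le> \<alpha>"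
    and base: "AE \<omega> in M. liminf_ge (path_rate \<alpha>0 \<omega>) v"
  shows "AE \<omega> in M. liminf_ge (path_rate \<alpha> \<omega>) (\<theta> * v + (1 - \<theta>) * right_edge F)"
proof -
  define b where "b = right_edge F"
  define t where "t \<eta> = (1 - \<eta>) * \<theta>" for \<eta> :: real
  define R where "R \<eta> = (v - \<eta>) * t \<eta> + (b - \<eta>) * (1 - t \<eta>) - 2 * \<eta>" for \<eta>
  let ?n = "\<lambda>m. nat \<lfloor>\<alpha> * real m\<rfloor>"
  have main: "AE \<omega> in M. \<forall>\<^sub>F m in sequentially. R \<eta> - \<eta> \<le> path_rate \<alpha> \<omega> m" if \<eta>: "0 < \<eta>" "\<eta> < 1" for \<eta>
  proof -
    have t: "0 \<le> t \<eta>" "t \<eta> \<le> 1" using \<eta> \<theta> by (auto simp: t_def intro: mult_le_one)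
    define m2 where "m2 m = nat \<lfloor>t \<eta> * real m\<rfloor>" for m
    have m2: "real (m2 m) \<le> t \<eta> * real m" for m
      using t by (simp add: m2_def of_nat_nat)
    have m2_le: "m2 m \<le> m" for m
      using m2[of m] mult_right_mono[OF t(2), of "real m"] by simp
    have m2_ratio: "(\<lambda>m. real (m2 m) / real m) \<longlonglongrightarrow> t \<eta>"
    proof (cases "t \<eta> = 0")
      case True
      then show ?thesis by (simp add: m2_def)
    next
      case False
      then show ?thesis unfolding m2_def using t by (intro nat_floor_ratio) auto
    qed
    let ?n' = "\<lambda>m. nat \<lfloor>\<alpha>0 * real (m2 m)\<rfloor>"
    let ?n1 = "\<lambda>m. nat \<lfloor>((1 - \<eta>) * \<alpha>) * real m\<rfloor>"
    have n'_le: "?n' m \<le> ?n1 m" for m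
    proof -
      have "\<alpha>0 * real (m2 m) \<le> \<alpha>0 * (t \<eta> * real m)" using \<alpha>0 m2[of m] by (intro mult_left_mono) auto
      also have "\<dots> = (1 - \<eta>) * (\<theta> * \<alpha>0) * real m" by (simp add: t_def)
      also have "\<dots> \<le> (1 - \<eta>) * \<alpha> * real m"
        using \<alpha>0 \<eta> by (intro mult_right_mono mult_left_mono) auto
      finally show ?thesis by (intro nat_mono floor_mono)
    qed
    have n1_le: "?n1 m \<le> ?n m" for m
    proof -
      have "(1 - \<eta>) * \<alpha> * real m \<le> \<alpha> * real m" using \<alpha> \<eta> by (intro mult_right_mono) auto
      then show ?thesis by (intro nat_mono floor_mono)
    qed
    let ?f = "indicator {b - \<eta><..} :: real \<Rightarrow> real"
    define q where "q = (\<integral>s. ?f s \<partial>interval_measure F)"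
    have q: "0 < q"
    proof -
      interpret D: real_distribution "interval_measure F" by (rule unit_cdf_real_distribution[OF F])
      have "q = D.prob {b - \<eta><..}" by (simp add: q_def)
      also have "{b - \<eta><..} = space (interval_measure F) - {..b - \<eta>}" by auto
      also have "D.prob \<dots> = 1 - F (b - \<eta>)"
        by (subst D.prob_compl) (auto simp: unit_cdf_real_distribution(2)[OF F])
      also have "\<dots> > 0" using right_edge(4)[OF F, of "b - \<eta>"] \<eta> by (simp add: b_def)
      finally show ?thesis .
    qed
    let ?T = "\<lambda>\<omega> n. \<Sum>j=1..n. ?f (p j \<omega>)"
    have T: "AE \<omega> in M. (\<lambda>n. ?T \<omega> n / real n) \<longlonglongrightarrow> q"
      unfolding q_def by (intro environment_lln[OF F, where C = 1]) (auto simp: indicator_def)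
    from T base column_counts[OF F \<alpha> \<eta>(1), of m2, OF m2_le] column_counts[OF F \<alpha> \<eta>(1), of "\<lambda>m. m", OF order.refl]
    show ?thesis
    proof eventually_elim
      case (elim \<omega>)
      have good: "\<forall>\<^sub>F m in sequentially. \<exists>j. ?n1 m < j \<and> j \<le> ?n m \<and> b - \<eta> < p j \<omega>"
      proof -
        have l1: "(\<lambda>m. ?T \<omega> (?n1 m) / real m) \<longlonglongrightarrow> ((1 - \<eta>) * \<alpha>) * q"
          by (rule average_along_floor) (use \<alpha> \<eta> elim(1) in auto)
        have l2: "(\<lambda>m. ?T \<omega> (?n m) / real m) \<longlonglongrightarrow> \<alpha> * q"
          by (rule average_along_floor) (use \<alpha> elim(1) in auto)
        define z where "z = (1 - \<eta> / 2) * (\<alpha> * q)"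
        have aq: "0 < \<alpha> * q" using \<alpha> q by simp
        have z1: "((1 - \<eta>) * \<alpha>) * q < z" 
          unfolding z_def mult.assoc using aq \<eta> by (intro mult_strict_right_mono) auto
        have z2: "z < \<alpha> * q" 
          using mult_strict_right_mono[of "1 - \<eta> / 2" 1 "\<alpha> * q"] aq \<eta> by (simp add: z_def)
        from order_tendstoD(2)[OF l1 z1] order_tendstoD(1)[OF l2 z2] eventually_gt_at_top[of 0]
        show ?thesis
        proof eventually_elim
          case (elim m)
          have lt: "?T \<omega> (?n1 m) < ?T \<omega> (?n m)"
          proof -
            have "?T \<omega> (?n1 m) / real m < ?T \<omega> (?n m) / real m" using elim by linarith
            then show ?thesis using elim(3) by (simp add: divide_less_cancel)
          qed
          show ?case
          proof (rule ccontr)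
            assume no: "\<not> ?thesis"
            have "?T \<omega> (?n m) = ?T \<omega> (?n1 m)"
              using n1_le[of m] no by (intro sum.mono_neutral_right) (auto simp: indicator_def not_less)
            then show False using lt by simp
          qed
        qed
      qed
      \<comment> \<open>For \<open>\<theta> = 0\<close> the first part of the path is empty.\<close>
      have first: "\<forall>\<^sub>F m in sequentially. (v - \<eta>) * real (m2 m) \<le> lpp0 (\<lambda>i j. \<epsilon> i j \<omega>) (m2 m) (?n' m)"
      proof (cases "t \<eta> = 0")
        case True
        then show ?thesis by (simp add: m2_def lpp0_nonneg)
      next
        case False
        have "\<forall>\<^sub>F m in sequentially. v - \<eta> \<le> path_rate \<alpha>0 \<omega> m"
          using elim(2) \<eta> by (simp add: liminf_ge_def)
        moreover have lim: "filterlim m2 at_top sequentially"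
          unfolding m2_def using False t by (intro nat_floor_at_top) auto
        ultimately have "\<forall>\<^sub>F m in sequentially. v - \<eta> \<le> path_rate \<alpha>0 \<omega> (m2 m)"
          by (rule eventually_compose_filterlim)
        moreover have "\<forall>\<^sub>F m in sequentially. 1 \<le> m2 m"
          using lim by (simp add: filterlim_at_top)
        ultimately show ?thesis
          by eventually_elim (simp add: path_rate_def pos_le_divide_eq)
      qed
      have lim: "(\<lambda>m. (v - \<eta>) * (real (m2 m) / real m) + (b - \<eta>) * (1 - real (m2 m) / real m) - 2 * \<eta>) \<longlonglongrightarrow> R \<eta>"
        unfolding R_def by (intro tendsto_intros m2_ratio)
      have "R \<eta> - \<eta> < R \<eta>" using \<eta> by simp
      from good first order_tendstoD(1)[OF lim this] elim(3,4) eventually_gt_at_top[of 0]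
      show ?case
      proof eventually_elim
        case (elim m)
        obtain j where j: "?n1 m < j" "j \<le> ?n m" "b - \<eta> < p j \<omega>" using elim(1) by blast
        let ?c = "\<lambda>k. \<Sum>i=1..k. of_bool (\<epsilon> i j \<omega>) :: real"
        have jr: "j \<in> {1..?n m}" using j by auto
        have c1: "\<bar>?c (m2 m) - p j \<omega> * real (m2 m)\<bar> \<le> \<eta> * real m" using elim(4) jr by blast
        have c2: "\<bar>?c m - p j \<omega> * real m\<bar> \<le> \<eta> * real m" using elim(5) jr by blast
        have split: "(\<Sum>i\<in>{m2 m<..m}. of_bool (\<epsilon> i j \<omega>)) = ?c m - ?c (m2 m)"
        proof -
          have "{1..m} = {1..m2 m} \<union> {m2 m<..m}" using m2_le[of m] by auto
          then have "?c m = ?c (m2 m) + (\<Sum>i\<in>{m2 m<..m}. of_bool (\<epsilon> i j \<omega>))"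
            by (simp only:) (rule sum.union_disjoint, auto)
          then show ?thesis by simp
        qed
        have "(b - \<eta>) * (real m - real (m2 m)) \<le> p j \<omega> * (real m - real (m2 m))"
          using j(3) m2_le[of m] by (intro mult_right_mono) auto
        then have "(b - \<eta>) * (real m - real (m2 m)) - 2 * \<eta> * real m \<le> ?c m - ?c (m2 m)"
          using c1 c2 unfolding right_diff_distrib abs_le_iff by linarith
        moreover have "lpp0 (\<lambda>i j. \<epsilon> i j \<omega>) (m2 m) (?n' m) + (\<Sum>i\<in>{m2 m<..m}. of_bool (\<epsilon> i j \<omega>)) \<le>
            lpp0 (\<lambda>i j. \<epsilon> i j \<omega>) m (?n m)"
          using n'_le[of m] j m2_le[of m] by (intro lpp0_ge_column) auto
        ultimately have "(v - \<eta>) * real (m2 m) + (b - \<eta>) * (real m - real (m2 m)) - 2 * \<eta> * real m \<le>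
            lpp0 (\<lambda>i j. \<epsilon> i j \<omega>) m (?n m)"
          using elim(2) split by linarith
        from divide_right_mono[OF this, of "real m"] elim(6)
        have "(v - \<eta>) * (real (m2 m) / real m) + (b - \<eta>) * (1 - real (m2 m) / real m) - 2 * \<eta> \<le> path_rate \<alpha> \<omega> m"
          by (simp add: path_rate_def add_divide_distrib diff_divide_distrib right_diff_distrib)
        then show ?case using elim(3) by linarith
      qed
    qed
  qed
  have "AE \<omega> in M. \<forall>k. \<forall>\<^sub>F m in sequentially. R (1 / real (k + 2)) - 1 / real (k + 2) \<le> path_rate \<alpha> \<omega> m"
    unfolding AE_all_countable by (intro allI main) auto
  then show ?thesis
  proof eventually_elim
    case (elim \<omega>)
    have "(\<lambda>k. 1 / real (k + 2)) \<longlonglongrightarrow> 0"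
      by (intro LIMSEQ_ignore_initial_segment lim_1_over_n)
    then have "(\<lambda>k. R (1 / real (k + 2)) - 1 / real (k + 2)) \<longlonglongrightarrow>
        ((v - 0) * ((1 - 0) * \<theta>) + (b - 0) * (1 - (1 - 0) * \<theta>) - 2 * 0) - 0"
      unfolding R_def t_def by (intro tendsto_intros)
    then show ?case
      using elim by (intro liminf_ge_limit[where r = "\<lambda>k. R (1 / real (k + 2)) - 1 / real (k + 2)"])
        (auto simp: b_def mult_ac)
  qed
qed

lemma path_rate_lower_edge:
  assumes F: "unit_cdf F" and \<alpha>: "0 < \<alpha>"
  shows "AE \<omega> in M. liminf_ge (path_rate \<alpha> \<omega>) (right_edge F)"
proof -
  have "AE \<omega> in M. liminf_ge (path_rate 1 \<omega>) 0"
    by (rule AE_I2) (auto simp: liminf_ge_def path_rate_def intro!: always_eventually order.trans[OF _ divide_nonneg_nonneg] lpp0_nonneg)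
  from path_rate_lower_concat[OF F \<alpha> _ _ _ _ this, of 0] \<alpha> show ?thesis by simp
qed

lemma path_rate_le_1: "limsup_le (path_rate \<alpha> \<omega>) 1"
proof -
  have "path_rate \<alpha> \<omega> m \<le> 1" for m
    using lpp0_le_rows[of "\<lambda>i j. \<epsilon> i j \<omega>" m] by (cases "m = 0") (auto simp: path_rate_def)
  then show ?thesis
    unfolding limsup_le_def by (auto intro!: always_eventually intro: add_increasing2 less_imp_le)
qed

end

section \<open>The critical values\<close>

text \<open>
  Turns comparisons with the critical values into comparisons with 1, covering the values 0 and infinity.
\<close>

lemma ennreal_inverse_le_iff:
  assumes "0 < \<alpha>"
  shows "ennreal \<alpha> \<le> inverse y \<longleftrightarrow> ennreal \<alpha> * y \<le> 1"
    and "inverse y \<le> ennreal \<alpha> \<longleftrightarrow> 1 \<le> ennreal \<alpha> * y"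
proof -
  have "(ennreal \<alpha> \<le> inverse y \<longleftrightarrow> ennreal \<alpha> * y \<le> 1) \<and> (inverse y \<le> ennreal \<alpha> \<longleftrightarrow> 1 \<le> ennreal \<alpha> * y)"
  proof (cases y)
    case (real r)
    show ?thesis
    proof (cases "r = 0")
      case True
      then show ?thesis using assms real by (simp add: top_unique)
    next
      case False
      then have r: "0 < r" using real by simp
      have "ennreal \<alpha> * y = ennreal (\<alpha> * r)" using real assms by (simp add: ennreal_mult)
      moreover have "inverse y = ennreal (inverse r)" using real r by (simp add: inverse_ennreal)
      ultimately show ?thesis
        using r assms by (simp add: inverse_eq_divide pos_divide_le_eq pos_le_divide_eq)
    qed
  next
    case top
    then show ?thesis using assms by (simp add: ennreal_mult_top top_unique)
  qed
  then show "ennreal \<alpha> \<le> inverse y \<longleftrightarrow> ennreal \<alpha> * y \<le> 1" "inverse y \<le> ennreal \<alpha> \<longleftrightarrow> 1 \<le> ennreal \<alpha> * y"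
    by auto
qed

lemma inverse_ennreal_antimono:
  "0 < d \<Longrightarrow> d \<le> d' \<Longrightarrow> inverse (ennreal d') \<le> inverse (ennreal d)"
  by (simp add: inverse_ennreal)

definition slope_mean :: "(real \<Rightarrow> real) \<Rightarrow> real \<Rightarrow> ennreal" where
  "slope_mean F a = dF_mean F (\<lambda>s. ennreal (s * (1 - s)) / ennreal ((a - s)\<^sup>2))"

definition ratio_mean :: "(real \<Rightarrow> real) \<Rightarrow> real \<Rightarrow> ennreal" where
  "ratio_mean F a = dF_mean F (\<lambda>s. ennreal s / ennreal (a - s))"

lemma slope_mean_eq:
  assumes F: "unit_cdf F" and a: "right_edge F < a"
  shows "slope_mean F a = ennreal (slope F a)"
proof -
  have "slope_mean F a = (\<integral>\<^sup>+ s. ennreal (s * (1 - s) / (a - s)\<^sup>2) \<partial>interval_measure F)"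
    unfolding slope_mean_def dF_mean_def
  proof (rule nn_integral_cong_AE)
    show "AE s in interval_measure F. ennreal (s * (1 - s)) / ennreal ((a - s)\<^sup>2) = ennreal (s * (1 - s) / (a - s)\<^sup>2)"
      using AE_interval_measure_support[OF F]
      by eventually_elim (use a right_edge(3)[OF F] in \<open>auto intro!: divide_ennreal\<close>)
  qed
  also have "\<dots> = ennreal (slope F a)"
    unfolding slope_def
  proof (rule nn_integral_eq_integral[OF integrable_slope[OF F a]])
    show "AE s in interval_measure F. 0 \<le> s * (1 - s) / (a - s)\<^sup>2"
      using AE_interval_measure_support[OF F]
      by eventually_elim (use a right_edge(3)[OF F] in auto)
  qed
  finally show ?thesis .
qed

lemma slope_nonneg:
  assumes F: "unit_cdf F" and a: "right_edge F < a"
  shows "0 \<le> slope F a"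
  unfolding slope_def
proof (rule integral_nonneg_AE)
  show "AE s in interval_measure F. 0 \<le> s * (1 - s) / (a - s)\<^sup>2"
    using AE_interval_measure_support[OF F] by eventually_elim (use a right_edge(3)[OF F] in auto)
qed

lemma slope_mean_mult_eq:
  assumes F: "unit_cdf F" and a: "right_edge F < a" and \<alpha>: "0 < \<alpha>"
  shows "ennreal \<alpha> * slope_mean F a = ennreal (\<alpha> * slope F a)"
  unfolding slope_mean_eq[OF F a] using \<alpha> slope_nonneg[OF F a] by (intro ennreal_mult[symmetric]) auto

lemma ratio_mean_eq:
  assumes F: "unit_cdf F" and a: "right_edge F < a" "a < 1" and \<alpha>: "0 \<le> \<alpha>"
  shows "ennreal (\<alpha> * (1 - a)) * ratio_mean F a = ennreal (\<alpha> * mean_queue F a)"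
proof -
  have "ennreal (1 - a) * ratio_mean F a = (\<integral>\<^sup>+ s. ennreal (1 - a) * (ennreal s / ennreal (a - s)) \<partial>interval_measure F)"
    unfolding ratio_mean_def dF_mean_def by (subst nn_integral_cmult) auto
  also have "\<dots> = (\<integral>\<^sup>+ s. ennreal (queue_mean a s) \<partial>interval_measure F)"
  proof (rule nn_integral_cong_AE)
    show "AE s in interval_measure F. ennreal (1 - a) * (ennreal s / ennreal (a - s)) = ennreal (queue_mean a s)"
      using AE_interval_measure_support[OF F]
    proof eventually_elim
      case (elim s)
      then have s: "0 \<le> s" "0 < a - s" using a by auto
      then have "ennreal (1 - a) * (ennreal s / ennreal (a - s)) = ennreal (1 - a) * ennreal (s / (a - s))"
        by (simp only: divide_ennreal)
      also have "\<dots> = ennreal ((1 - a) * (s / (a - s)))"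
        using s a by (intro ennreal_mult[symmetric]) auto
      finally show ?case by (simp add: queue_mean_def mult.commute)
    qed
  qed
  also have "\<dots> = ennreal (mean_queue F a)"
    unfolding mean_queue_def
  proof (rule nn_integral_eq_integral[OF integrable_queue_mean[OF F a]])
    show "AE s in interval_measure F. 0 \<le> queue_mean a s"
      using AE_interval_measure_support[OF F] by eventually_elim (use a queue_mean_nonneg in auto)
  qed
  finally have "ennreal (1 - a) * ratio_mean F a = ennreal (mean_queue F a)" .
  then have "ennreal \<alpha> * (ennreal (1 - a) * ratio_mean F a) = ennreal (\<alpha> * mean_queue F a)"
    using \<alpha> by (simp add: ennreal_mult')
  then show ?thesis using \<alpha> a by (simp add: ennreal_mult mult.assoc)
qed

text \<open>
  Monotone convergence for parameters decreasing to the right edge.  Inversion is continuous on the extended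
  nonnegative reals, so atoms at the right edge need no separate treatment.
\<close>

lemma edge_convergence:
  fixes h :: "real \<Rightarrow> real" and k :: nat
  assumes F: "unit_cdf F" and b: "right_edge F < 1" and [measurable]: "h \<in> borel_measurable borel"
  defines "a \<equiv> \<lambda>i. right_edge F + (1 - right_edge F) / real (i + 2)"
  shows "(\<lambda>i. dF_mean F (\<lambda>s. ennreal (h s) / ennreal ((a i - s) ^ k))) \<longlonglongrightarrow>
    dF_mean F (\<lambda>s. ennreal (h s) / ennreal ((right_edge F - s) ^ k))"
proof -
  let ?b = "right_edge F"
  let ?f = "\<lambda>i s. ennreal (h s) / ennreal ((a i - s) ^ k)"
  have a_lim: "a \<longlonglongrightarrow> ?b"
  proof -
    have "(\<lambda>i. ?b + (1 - ?b) * (1 / real (i + 2))) \<longlonglongrightarrow> ?b + (1 - ?b) * 0"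
      by (intro tendsto_intros LIMSEQ_ignore_initial_segment lim_1_over_n)
    then show ?thesis by (simp add: a_def)
  qed
  have a_gt: "?b < a i" for i using b by (simp add: a_def)
  have a_dec: "a (Suc i) \<le> a i" for i
    unfolding a_def using b by (intro add_left_mono divide_left_mono) auto
  have meas: "?f i \<in> borel_measurable (interval_measure F)" for i
    unfolding divide_ennreal_def by measurable
  have mono: "AE s in interval_measure F. ?f i s \<le> ?f (Suc i) s" for i
    using AE_interval_measure_support[OF F]
  proof eventually_elim
    case (elim s)
    have "0 < a (Suc i) - s" using elim a_gt[of "Suc i"] by simp
    moreover have "a (Suc i) - s \<le> a i - s" using a_dec by simp
    ultimately have "0 < (a (Suc i) - s) ^ k" "(a (Suc i) - s) ^ k \<le> (a i - s) ^ k"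
      by (auto intro!: power_mono)
    then have "inverse (ennreal ((a i - s) ^ k)) \<le> inverse (ennreal ((a (Suc i) - s) ^ k))"
      by (rule inverse_ennreal_antimono)
    then show ?case unfolding divide_ennreal_def by (rule mult_left_mono) simp
  qed
  have lim: "(\<lambda>i. ?f i s) \<longlonglongrightarrow> ennreal (h s) / ennreal ((?b - s) ^ k)" for s
  proof -
    have "(\<lambda>i. ennreal ((a i - s) ^ k)) \<longlonglongrightarrow> ennreal ((?b - s) ^ k)"
      by (intro tendsto_ennrealI tendsto_intros a_lim)
    then have "(\<lambda>i. inverse (ennreal ((a i - s) ^ k))) \<longlonglongrightarrow> inverse (ennreal ((?b - s) ^ k))"
      by (rule continuous_on_tendsto_compose[where f = inverse and s = UNIV,
            OF continuous_on_inverse_ennreal[OF continuous_on_id]]) auto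
    then show ?thesis unfolding divide_ennreal_def by (intro ennreal_tendsto_cmult) auto
  qed
  have "(\<integral>\<^sup>+ s. (SUP i. ?f i s) \<partial>interval_measure F) = (SUP i. integral\<^sup>N (interval_measure F) (?f i))"
    by (rule nn_integral_monotone_convergence_SUP_AE[where f = ?f, OF mono meas])
  moreover have "(\<integral>\<^sup>+ s. (SUP i. ?f i s) \<partial>interval_measure F) =
      (\<integral>\<^sup>+ s. ennreal (h s) / ennreal ((?b - s) ^ k) \<partial>interval_measure F)"
  proof (rule nn_integral_cong_AE)
    have "AE s in interval_measure F. \<forall>i. ?f i s \<le> ?f (Suc i) s"
      using mono by (simp add: AE_all_countable)
    then show "AE s in interval_measure F. (SUP i. ?f i s) = ennreal (h s) / ennreal ((?b - s) ^ k)"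
    proof eventually_elim
      case (elim s)
      then have "(\<lambda>i. ?f i s) \<longlonglongrightarrow> (SUP i. ?f i s)" by (intro LIMSEQ_SUP incseq_SucI) auto
      then show ?case using lim[of s] by (rule LIMSEQ_unique)
    qed
  qed
  moreover have "(\<lambda>i. integral\<^sup>N (interval_measure F) (?f i)) \<longlonglongrightarrow> (SUP i. integral\<^sup>N (interval_measure F) (?f i))"
    by (intro LIMSEQ_SUP incseq_SucI nn_integral_mono_AE mono)
  ultimately show ?thesis unfolding dF_mean_def by simp
qed

lemma edge_sequence:
  fixes b :: real
  assumes "b < 1"
  shows "(\<lambda>i. b + (1 - b) / real (i + 2)) \<longlonglongrightarrow> b" "b < b + (1 - b) / real (i + 2)" "b + (1 - b) / real (i + 2) < 1"
proof -
  have "(\<lambda>i. b + (1 - b) * (1 / real (i + 2))) \<longlonglongrightarrow> b + (1 - b) * 0"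
    by (intro tendsto_intros LIMSEQ_ignore_initial_segment lim_1_over_n)
  then show "(\<lambda>i. b + (1 - b) / real (i + 2)) \<longlonglongrightarrow> b" by simp
  show "b < b + (1 - b) / real (i + 2)" using assms by simp
  have "(1 - b) / real (i + 2) < (1 - b) / 1" using assms by (intro divide_strict_left_mono) auto
  then show "b + (1 - b) / real (i + 2) < 1" by simp
qed

text \<open>
  For \<open>s \<ge> 0\<close> and \<open>a < a'\<close> the quotient \<open>(a - s) / (a' - s)\<close> is at most \<open>a / a'\<close>.  This quantitative form of strict
  monotonicity holds also where the expectation is infinite.
\<close>

lemma slope_mean_scaled_antimono:
  assumes F: "unit_cdf F" and b: "right_edge F < 1" and a: "right_edge F \<le> a" "a < a'" "a' \<le> 1"
  shows "ennreal (a'\<^sup>2) * slope_mean F a' \<le> ennreal (a\<^sup>2) * slope_mean F a"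
proof -
  have a0: "0 \<le> a" using right_edge(2)[OF F] a by simp
  have "ennreal (a'\<^sup>2) * slope_mean F a' =
      (\<integral>\<^sup>+ s. ennreal (a'\<^sup>2) * (ennreal (s * (1 - s)) / ennreal ((a' - s)\<^sup>2)) \<partial>interval_measure F)"
    unfolding slope_mean_def dF_mean_def divide_ennreal_def by (subst nn_integral_cmult) auto
  also have "\<dots> \<le> (\<integral>\<^sup>+ s. ennreal (a\<^sup>2) * (ennreal (s * (1 - s)) / ennreal ((a - s)\<^sup>2)) \<partial>interval_measure F)"
  proof (rule nn_integral_mono_AE)
    show "AE s in interval_measure F. ennreal (a'\<^sup>2) * (ennreal (s * (1 - s)) / ennreal ((a' - s)\<^sup>2)) \<le>
        ennreal (a\<^sup>2) * (ennreal (s * (1 - s)) / ennreal ((a - s)\<^sup>2))"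
      using AE_interval_measure_support[OF F]
    proof eventually_elim
      case (elim s)
      show ?case
      proof (cases "s = a")
        case True
        show ?thesis
        proof (cases "s = 0")
          case True
          then show ?thesis by simp
        next
          case False
          have "0 < s * (1 - s)" using False elim b by simp
          then have "ennreal (s * (1 - s)) / ennreal ((a - s)\<^sup>2) = top"
            using \<open>s = a\<close> by (auto simp: divide_ennreal_def ennreal_mult_top)
          moreover have "0 < a\<^sup>2" using True False by simp
          ultimately show ?thesis by (simp add: ennreal_mult_top)
        qed
      next
        case False
        then have s: "0 \<le> s" "0 < a - s" "0 < a' - s" "s \<le> 1" using elim a by auto
        have "a' * (a - s) \<le> a * (a' - s)" using s a by (simp add: algebra_simps mult_right_mono)
        then have "(a' * (a - s))\<^sup>2 \<le> (a * (a' - s))\<^sup>2" using s a a0 by (intro power_mono) auto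
        then have le: "a'\<^sup>2 / (a' - s)\<^sup>2 \<le> a\<^sup>2 / (a - s)\<^sup>2"
          using s by (simp add: pos_divide_le_eq pos_le_divide_eq power_mult_distrib)
        have "s * (1 - s) * (a'\<^sup>2 / (a' - s)\<^sup>2) \<le> s * (1 - s) * (a\<^sup>2 / (a - s)\<^sup>2)"
          using le s by (intro mult_left_mono) auto
        then have "a'\<^sup>2 * (s * (1 - s) / (a' - s)\<^sup>2) \<le> a\<^sup>2 * (s * (1 - s) / (a - s)\<^sup>2)"
          by (simp add: mult_ac)
        then show ?thesis using s
          by (subst (1 2) divide_ennreal) (auto simp: ennreal_mult[symmetric])
      qed
    qed
  qed
  also have "\<dots> = ennreal (a\<^sup>2) * slope_mean F a"
    unfolding slope_mean_def dF_mean_def divide_ennreal_def by (subst nn_integral_cmult) auto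
  finally show ?thesis .
qed

lemma slope_mean_antimono:
  assumes F: "unit_cdf F" and b: "right_edge F < 1" and a: "right_edge F < a" "a \<le> a'" "a' \<le> 1"
  shows "slope_mean F a' \<le> slope_mean F a" "slope_mean F a \<le> slope_mean F (right_edge F)"
proof -
  have *: "slope_mean F x' \<le> slope_mean F x" if x: "right_edge F \<le> x" "x \<le> x'" "x' \<le> 1" "right_edge F < x'" for x x'
    unfolding slope_mean_def dF_mean_def
  proof (rule nn_integral_mono_AE)
    show "AE s in interval_measure F. ennreal (s * (1 - s)) / ennreal ((x' - s)\<^sup>2) \<le>
        ennreal (s * (1 - s)) / ennreal ((x - s)\<^sup>2)"
      using AE_interval_measure_support[OF F]
    proof eventually_elim
      case (elim s)
      have "inverse (ennreal ((x' - s)\<^sup>2)) \<le> inverse (ennreal ((x - s)\<^sup>2))"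
      proof (cases "x = s")
        case False
        then have "0 < x - s" "x - s \<le> x' - s" using elim x by auto
        then have "0 < (x - s)\<^sup>2" "(x - s)\<^sup>2 \<le> (x' - s)\<^sup>2" by (auto intro: power_mono)
        then show ?thesis by (rule inverse_ennreal_antimono)
      qed simp
      then show ?case unfolding divide_ennreal_def by (rule mult_left_mono) simp
    qed
  qed
  show "slope_mean F a' \<le> slope_mean F a" using a by (intro *) auto
  show "slope_mean F a \<le> slope_mean F (right_edge F)" using a by (intro *) auto
qed

lemma alpha_c_eq:
  assumes F: "unit_cdf F" and b: "right_edge F < 1"
  shows "alpha_c F = inverse (slope_mean F 1)"
proof -
  have "dF_mean F (\<lambda>s. ennreal s / ennreal (1 - s)) = slope_mean F 1"
    unfolding slope_mean_def dF_mean_def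
  proof (rule nn_integral_cong_AE)
    show "AE s in interval_measure F. ennreal s / ennreal (1 - s) = ennreal (s * (1 - s)) / ennreal ((1 - s)\<^sup>2)"
      using AE_interval_measure_support[OF F]
    proof eventually_elim
      case (elim s)
      then have "0 \<le> s" "0 < 1 - s" using b by auto
      then show ?case by (simp add: divide_ennreal power2_eq_square)
    qed
  qed
  then show ?thesis by (simp add: alpha_c_def)
qed

lemma alpha_c'_eq: "alpha_c' F = inverse (slope_mean F (right_edge F))"
  by (simp add: alpha_c'_def slope_mean_def)

text \<open>
  If \<open>slope_mean F\<close> had the same finite value at \<open>x < x'\<close>, scaled monotonicity would give \<open>x'\<^sup>2 \<le> x\<^sup>2\<close>.
\<close>

lemma unique_critical_parameter:
  assumes F: "unit_cdf F" and b: "right_edge F < 1" and \<alpha>: "0 < \<alpha>"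
    and a: "a \<in> {right_edge F..1}" "ennreal \<alpha> * slope_mean F a = 1"
    and a': "a' \<in> {right_edge F..1}" "ennreal \<alpha> * slope_mean F a' = 1"
  shows "a = a'"
proof -
  have no: False if x: "x \<in> {right_edge F..1}" "ennreal \<alpha> * slope_mean F x = 1"
      "x' \<in> {right_edge F..1}" "ennreal \<alpha> * slope_mean F x' = 1" "x < x'" for x x'
  proof -
    have "ennreal \<alpha> * (ennreal (x'\<^sup>2) * slope_mean F x') \<le> ennreal \<alpha> * (ennreal (x\<^sup>2) * slope_mean F x)"
      using x by (intro mult_left_mono slope_mean_scaled_antimono F b) auto
    then have "ennreal (x'\<^sup>2) * (ennreal \<alpha> * slope_mean F x') \<le> ennreal (x\<^sup>2) * (ennreal \<alpha> * slope_mean F x)"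
      by (simp only: mult.left_commute)
    then have "x'\<^sup>2 \<le> x\<^sup>2" unfolding x(2,4) by simp
    moreover have "x\<^sup>2 < x'\<^sup>2" using x right_edge(2)[OF F] by (intro power_strict_mono) auto
    ultimately show False by simp
  qed
  show ?thesis using no[OF a a'] no[OF a' a] by (cases a a' rule: linorder_cases) blast+
qed

text \<open>
  Only continuity away from the right edge is wanted, for the intermediate value theorem.
\<close>

lemma slope_lipschitz:
  assumes F: "unit_cdf F" and x: "right_edge F < d" "d \<le> x" "d \<le> y" "x \<le> 1" "y \<le> 1"
  shows "\<bar>slope F x - slope F y\<bar> \<le> 2 / (d - right_edge F) ^ 4 * \<bar>x - y\<bar>"
proof -
  let ?b = "right_edge F"
  let ?w = "\<lambda>a s. s * (1 - s) / (a - s)\<^sup>2"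
  let ?C = "2 / (d - ?b) ^ 4 * \<bar>x - y\<bar>"
  interpret real_distribution "interval_measure F" by (rule unit_cdf_real_distribution[OF F])
  have pt: "\<bar>?w x s - ?w y s\<bar> \<le> ?C" if s: "0 \<le> s" "s \<le> ?b" for s
  proof -
    have X: "d - ?b \<le> x - s" "d - ?b \<le> y - s" "x - s \<le> 1" "y - s \<le> 1" "0 < d - ?b" using x s by auto
    then have pos: "0 < x - s" "0 < y - s" by auto
    have "W / X\<^sup>2 - W / Y\<^sup>2 = W * ((Y - X) * (X + Y) / (X\<^sup>2 * Y\<^sup>2))" if "0 < X" "0 < Y" for W X Y :: real
      using that by (simp add: divide_simps) (simp add: power2_eq_square algebra_simps)
    note diff = this[OF pos, of "s * (1 - s)"]
    have "(y - s) - (x - s) = y - x" by simp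
    note eq = diff[unfolded this]
    have abs_eq: "\<bar>W * (u * Z / N)\<bar> = W * (Z * \<bar>u\<bar> / N)" if "0 \<le> W" "0 \<le> Z" "0 \<le> N" for W u Z N :: real
    proof -
      have "\<bar>W * (u * Z / N)\<bar> = \<bar>W\<bar> * (\<bar>u\<bar> * \<bar>Z\<bar> / \<bar>N\<bar>)" by (simp only: abs_mult abs_divide)
      then show ?thesis using that by (simp only: abs_of_nonneg mult.commute)
    qed
    have "\<bar>?w x s - ?w y s\<bar> = (s * (1 - s)) * (((x - s) + (y - s)) * \<bar>y - x\<bar> / ((x - s)\<^sup>2 * (y - s)\<^sup>2))"
      unfolding eq by (rule abs_eq) (use s x pos in auto)
    also have "\<dots> \<le> 1 * (2 * \<bar>y - x\<bar> / ((d - ?b)\<^sup>2 * (d - ?b)\<^sup>2))"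
    proof (rule mult_mono)
      show "s * (1 - s) \<le> 1" using s x by (intro mult_le_one) auto
      show "((x - s) + (y - s)) * \<bar>y - x\<bar> / ((x - s)\<^sup>2 * (y - s)\<^sup>2) \<le>
          2 * \<bar>y - x\<bar> / ((d - ?b)\<^sup>2 * (d - ?b)\<^sup>2)"
      proof (rule frac_le)
        show "((x - s) + (y - s)) * \<bar>y - x\<bar> \<le> 2 * \<bar>y - x\<bar>"
          using X(3,4) by (intro mult_right_mono) auto
        show "(d - ?b)\<^sup>2 * (d - ?b)\<^sup>2 \<le> (x - s)\<^sup>2 * (y - s)\<^sup>2"
          using X by (intro mult_mono power_mono) auto
      qed (use X(5) in auto)
      show "0 \<le> ((x - s) + (y - s)) * \<bar>y - x\<bar> / ((x - s)\<^sup>2 * (y - s)\<^sup>2)"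
        using pos by (intro divide_nonneg_nonneg mult_nonneg_nonneg) auto
    qed simp
    also have "\<dots> = ?C"
    proof -
      have "(d - ?b) ^ 4 = (d - ?b)\<^sup>2 * (d - ?b)\<^sup>2" by (simp only: power_add[symmetric]) simp
      then show ?thesis by (simp add: abs_minus_commute[of y x])
    qed
    finally show ?thesis .
  qed
  have i: "integrable (interval_measure F) (?w x)" "integrable (interval_measure F) (?w y)"
    using integrable_slope[OF F] x by auto
  have eq: "slope F x - slope F y = (\<integral>s. ?w x s - ?w y s \<partial>interval_measure F)"
    unfolding slope_def by (rule Bochner_Integration.integral_diff[OF i, symmetric])
  have "\<bar>slope F x - slope F y\<bar> \<le> (\<integral>s. \<bar>?w x s - ?w y s\<bar> \<partial>interval_measure F)"
    unfolding eq by (rule integral_abs_bound)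
  also have "\<dots> \<le> ?C"
  proof (rule integral_le_const)
    show "integrable (interval_measure F) (\<lambda>s. \<bar>?w x s - ?w y s\<bar>)"
      by (intro integrable_abs Bochner_Integration.integrable_diff i)
    show "AE s in interval_measure F. \<bar>?w x s - ?w y s\<bar> \<le> ?C"
      using AE_interval_measure_support[OF F]
    proof eventually_elim
      case (elim s)
      then show ?case by (intro pt) auto
    qed
  qed
  finally show ?thesis .
qed

text \<open>
  The expectation may be infinite at the right edge, but then it is larger than \<open>1 / \<alpha>\<close> already at some parameter
  above the edge, from where the intermediate value theorem applies.
\<close>

lemma ex_critical_parameter:
  assumes F: "unit_cdf F" and b: "right_edge F < 1" and \<alpha>: "0 < \<alpha>"
    and 1: "1 \<le> ennreal \<alpha> * slope_mean F (right_edge F)" "ennreal \<alpha> * slope_mean F 1 \<le> 1"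
  shows "\<exists>a\<in>{right_edge F..1}. ennreal \<alpha> * slope_mean F a = 1"
proof (cases "ennreal \<alpha> * slope_mean F (right_edge F) = 1")
  case True
  then show ?thesis using b by force
next
  case False
  let ?b = "right_edge F"
  let ?a = "\<lambda>i. ?b + (1 - ?b) / real (i + 2)"
  have "(\<lambda>i. slope_mean F (?a i)) \<longlonglongrightarrow> slope_mean F ?b"
    unfolding slope_mean_def by (rule edge_convergence[OF F b]) simp
  then have "(\<lambda>i. ennreal \<alpha> * slope_mean F (?a i)) \<longlonglongrightarrow> ennreal \<alpha> * slope_mean F ?b"
    by (intro ennreal_tendsto_cmult) auto
  moreover have "1 < ennreal \<alpha> * slope_mean F ?b" using 1(1) False by simp
  ultimately have "\<forall>\<^sub>F i in sequentially. 1 < ennreal \<alpha> * slope_mean F (?a i)"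
    by (rule order_tendstoD(1))
  then obtain i where i: "1 < ennreal \<alpha> * slope_mean F (?a i)" by (auto simp: eventually_sequentially)
  define d where "d = ?a i"
  have d: "?b < d" "d < 1" using edge_sequence(2,3)[OF b, of i] by (auto simp: d_def)
  note conv = slope_mean_mult_eq[OF F _ \<alpha>]
  have "continuous_on {d..1} (slope F)"
  proof (rule lipschitz_on_continuous_on)
    show "(2 / (d - ?b) ^ 4)-lipschitz_on {d..1} (slope F)"
      using slope_lipschitz[OF F d(1)] d by (intro lipschitz_onI) (auto simp: dist_real_def)
  qed
  then have "continuous_on {d..1} (\<lambda>x. \<alpha> * slope F x)" by (intro continuous_intros)
  moreover have "\<alpha> * slope F 1 \<le> 1" using 1(2) conv[OF b] by (simp flip: ennreal_1)
  moreover have "1 \<le> \<alpha> * slope F d"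
    using less_imp_le[OF i] unfolding d_def[symmetric] conv[OF d(1)] by simp
  ultimately have "\<exists>x\<ge>d. x \<le> 1 \<and> \<alpha> * slope F x = 1"
    using d by (intro IVT2') auto
  then obtain x where "d \<le> x" "x \<le> 1" "\<alpha> * slope F x = 1" by blast
  then show ?thesis using d by (intro bexI[of _ x]) (auto simp: conv)
qed

text \<open>
  In particular the mean vanishes together with the slope.
\<close>

lemma mean_queue_le_slope:
  assumes F: "unit_cdf F" and a: "right_edge F < a" "a < 1"
  shows "mean_queue F a \<le> slope F a"
  unfolding mean_queue_def slope_def
proof (rule integral_mono_AE[OF integrable_queue_mean[OF F a] integrable_slope[OF F a(1)]])
  show "AE s in interval_measure F. queue_mean a s \<le> s * (1 - s) / (a - s)\<^sup>2"
    using AE_interval_measure_support[OF F]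
  proof eventually_elim
    case (elim s)
    then have s: "0 \<le> s" "0 < a - s" "a - s \<le> 1" using a by auto
    have "(a - s)\<^sup>2 \<le> a - s" using s mult_left_mono[of "a - s" 1 "a - s"] by (simp add: power2_eq_square)
    then show ?case unfolding queue_mean_def using s a by (intro frac_le mult_left_mono) auto
  qed
qed

text \<open>
  Makes the expectation in the linear piece finite whenever that piece has positive length.
\<close>

lemma ratio_mean_le_slope_mean:
  assumes F: "unit_cdf F" and b: "right_edge F < 1"
  shows "ratio_mean F (right_edge F) \<le> slope_mean F (right_edge F)"
  unfolding ratio_mean_def slope_mean_def dF_mean_def
proof (rule nn_integral_mono_AE)
  let ?b = "right_edge F"
  show "AE s in interval_measure F. ennreal s / ennreal (?b - s) \<le> ennreal (s * (1 - s)) / ennreal ((?b - s)\<^sup>2)"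
    using AE_interval_measure_support[OF F]
  proof eventually_elim
    case (elim s)
    show ?case
    proof (cases "s = ?b")
      case True
      show ?thesis
      proof (cases "s = 0")
        case False
        then have "0 < s * (1 - s)" using elim b by simp
        then show ?thesis using True b by (auto simp: divide_ennreal_def ennreal_mult_top)
      qed simp
    next
      case False
      then have s: "0 \<le> s" "0 < ?b - s" using elim by auto
      have "s / (?b - s) = s * (?b - s) / (?b - s)\<^sup>2" using s by (simp add: power2_eq_square)
      also have "\<dots> \<le> s * (1 - s) / (?b - s)\<^sup>2"
        using s b by (intro divide_right_mono mult_left_mono) auto
      finally show ?thesis using s b by (simp add: divide_ennreal)
    qed
  qed
qed

section \<open>The limit\<close>

context random_environment_array
begin

definition rate_limit :: "real \<Rightarrow> real \<Rightarrow> bool" where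
  "rate_limit \<alpha> c \<longleftrightarrow> (AE \<omega> in M. path_rate \<alpha> \<omega> \<longlonglongrightarrow> c)"

lemma rate_limitI:
  assumes "AE \<omega> in M. liminf_ge (path_rate \<alpha> \<omega>) c" "AE \<omega> in M. limsup_le (path_rate \<alpha> \<omega>) c"
  shows "rate_limit \<alpha> c"
  using assms unfolding rate_limit_def by eventually_elim (rule tendsto_of_liminf_limsup)

text \<open>
  Almost sure limits are unique, which makes the values found in overlapping regimes agree without any computation.
\<close>

lemma rate_limit_unique:
  assumes "rate_limit \<alpha> c" "rate_limit \<alpha> c'"
  shows "c = c'"
proof -
  have "AE \<omega> in M. c = c'"
    using assms unfolding rate_limit_def by eventually_elim (rule LIMSEQ_unique)
  then show ?thesis by (simp add: AE_const)
qed

lemma rate_limit_nonneg: "rate_limit \<alpha> c \<Longrightarrow> 0 \<le> c"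
proof -
  assume "rate_limit \<alpha> c"
  then have "AE \<omega> in M. 0 \<le> c"
    unfolding rate_limit_def
  proof eventually_elim
    case (elim \<omega>)
    show ?case by (rule LIMSEQ_le_const[OF elim]) (simp add: path_rate_def lpp0_nonneg)
  qed
  then show ?thesis by (simp add: AE_const)
qed

text \<open>
  Concatenation with the critical direction \<open>1 / slope F a\<close> of \<open>a\<close>.  If the slope vanishes, the environment is
  almost surely 0 and the bound is trivial.
\<close>

lemma path_rate_lower_subcritical:
  assumes F: "unit_cdf F" and a: "right_edge F < a" "a < 1" and \<alpha>: "0 < \<alpha>"
    and sub: "\<alpha> * slope F a \<le> 1"
  shows "AE \<omega> in M. liminf_ge (path_rate \<alpha> \<omega>) (right_edge F + \<alpha> * mean_queue F a)"
proof (cases "slope F a = 0")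
  case True
  then have "mean_queue F a = 0"
    using mean_queue_le_slope[OF F a] mean_queue_nonneg[OF F a] by simp
  then show ?thesis using path_rate_lower_edge[OF F \<alpha>] by simp
next
  case False
  define g where "g = slope F a"
  have g: "0 < g" using False slope_nonneg[OF F a(1)] by (simp add: g_def)
  let ?v = "a + 1 / g * mean_queue F a"
  have "AE \<omega> in M. liminf_ge (path_rate (1 / g) \<omega>) ?v"
    using g by (intro path_rate_lower_critical[OF F a]) (auto simp: g_def)
  from path_rate_lower_concat[OF F \<alpha> _ _ _ _ this, of "\<alpha> * g"]
  have lower: "AE \<omega> in M. liminf_ge (path_rate \<alpha> \<omega>) (\<alpha> * g * ?v + (1 - \<alpha> * g) * right_edge F)"
    using g \<alpha> sub by (simp add: g_def)
  have le: "right_edge F + \<alpha> * mean_queue F a \<le> \<alpha> * g * ?v + (1 - \<alpha> * g) * right_edge F"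
  proof -
    have "0 \<le> \<alpha> * g * (a - right_edge F)" using \<alpha> g a by simp
    moreover have "\<alpha> * g * ?v = \<alpha> * g * a + \<alpha> * mean_queue F a" using g by (simp add: distrib_left)
    ultimately show ?thesis by (simp add: algebra_simps)
  qed
  show ?thesis using lower by eventually_elim (erule liminf_ge_mono[OF _ le])
qed

text \<open>
  In a wider array than the critical one for \<open>a\<close>, the critical path is still available and its rate is at least \<open>a\<close>.
\<close>

lemma path_rate_lower_supercritical:
  assumes F: "unit_cdf F" and a: "right_edge F < a" "a < 1" and \<alpha>: "0 < \<alpha>"
    and super: "1 \<le> \<alpha> * slope F a"
  shows "AE \<omega> in M. liminf_ge (path_rate \<alpha> \<omega>) a"
proof -
  define g where "g = slope F a"
  have g: "0 < g" using super \<alpha> slope_nonneg[OF F a(1)] by (cases "g = 0") (auto simp: g_def)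
  let ?v = "a + 1 / g * mean_queue F a"
  have "AE \<omega> in M. liminf_ge (path_rate (1 / g) \<omega>) ?v"
    using g by (intro path_rate_lower_critical[OF F a]) (auto simp: g_def)
  from path_rate_lower_concat[OF F \<alpha> _ _ _ _ this, of 1]
  have lower: "AE \<omega> in M. liminf_ge (path_rate \<alpha> \<omega>) ?v"
    using g super by (simp add: g_def pos_divide_le_eq)
  have le: "a \<le> ?v" using g mean_queue_nonneg[OF F a] by simp
  show ?thesis using lower by eventually_elim (erule liminf_ge_mono[OF _ le])
qed

lemma rate_limit_edge_1:
  assumes F: "unit_cdf F" and \<alpha>: "0 < \<alpha>" and b: "right_edge F = 1"
  shows "rate_limit \<alpha> 1"
  using path_rate_lower_edge[OF F \<alpha>] b by (intro rate_limitI) (auto simp: path_rate_le_1)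

text \<open>
  Every \<open>a < 1\<close> is supercritical, so the rate is at least every such \<open>a\<close>.
\<close>

lemma rate_limit_saturated:
  assumes F: "unit_cdf F" and \<alpha>: "0 < \<alpha>" and b: "right_edge F < 1"
    and super: "1 \<le> ennreal \<alpha> * slope_mean F 1"
  shows "rate_limit \<alpha> 1"
proof (rule rate_limitI)
  define r where "r i = 1 - (1 - right_edge F) * (1 / real (i + 2))" for i
  have r: "right_edge F < r i" "r i < 1" for i
    using edge_sequence(2,3)[OF b, of i] unfolding r_def by (simp_all only: times_divide_eq_right mult_1_right)
  have "AE \<omega> in M. liminf_ge (path_rate \<alpha> \<omega>) x" if x: "right_edge F < x" "x < 1" for x
  proof (rule path_rate_lower_supercritical[OF F x \<alpha>])
    have "ennreal \<alpha> * slope_mean F 1 \<le> ennreal \<alpha> * slope_mean F x"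
      using x by (intro mult_left_mono slope_mean_antimono(1)[OF F b]) auto
    with super have "1 \<le> ennreal \<alpha> * slope_mean F x" by (rule order.trans)
    then show "1 \<le> \<alpha> * slope F x" unfolding slope_mean_mult_eq[OF F x(1) \<alpha>] by simp
  qed
  from this[OF r] have "AE \<omega> in M. \<forall>i. liminf_ge (path_rate \<alpha> \<omega>) (r i)" by (simp only: AE_all_countable) blast
  then show "AE \<omega> in M. liminf_ge (path_rate \<alpha> \<omega>) 1"
  proof eventually_elim
    case (elim \<omega>)
    have "r \<longlonglongrightarrow> 1 - (1 - right_edge F) * 0"
      unfolding r_def[abs_def] by (intro tendsto_intros LIMSEQ_ignore_initial_segment lim_1_over_n)
    then have lim: "r \<longlonglongrightarrow> 1" by (simp only: mult_zero_right diff_zero)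
    show ?case by (rule liminf_ge_closed[OF _ lim]) (rule elim[rule_format])
  qed
  show "AE \<omega> in M. limsup_le (path_rate \<alpha> \<omega>) 1" by (rule AE_I2) (rule path_rate_le_1)
qed

lemma rate_limit_interior:
  assumes F: "unit_cdf F" and \<alpha>: "0 < \<alpha>" and a: "right_edge F < a" "a < 1"
    and crit: "ennreal \<alpha> * slope_mean F a = 1"
  shows "rate_limit \<alpha> (a + \<alpha> * mean_queue F a)"
proof (rule rate_limitI)
  have "\<alpha> * slope F a = 1"
    using crit unfolding slope_mean_mult_eq[OF F a(1) \<alpha>] by simp
  then show "AE \<omega> in M. liminf_ge (path_rate \<alpha> \<omega>) (a + \<alpha> * mean_queue F a)"
    by (rule path_rate_lower_critical[OF F a \<alpha>])
qed (rule path_rate_upper[OF F a \<alpha>])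

text \<open>
  The upper bound \<open>a + \<alpha> mean_queue F a\<close> and the subcritical lower bound \<open>right_edge F + \<alpha> mean_queue F a\<close> have the same
  limit as \<open>a\<close> decreases to the right edge.
\<close>

lemma rate_limit_flat:
  assumes F: "unit_cdf F" and \<alpha>: "0 < \<alpha>" and b: "right_edge F < 1"
    and sub: "ennreal \<alpha> * slope_mean F (right_edge F) \<le> 1"
  shows "\<exists>c. rate_limit \<alpha> c \<and> 0 \<le> c \<and>
    ennreal c = ennreal (right_edge F) + ennreal (\<alpha> * (1 - right_edge F)) * ratio_mean F (right_edge F)"
proof -
  let ?b = "right_edge F"
  let ?a = "\<lambda>i. ?b + (1 - ?b) / real (i + 2)"
  note a = edge_sequence[OF b]
  have "slope_mean F ?b < top"
    using sub \<alpha> by (cases "slope_mean F ?b") (auto simp: ennreal_mult_top top_unique)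
  then have fin: "ratio_mean F ?b < top"
    using ratio_mean_le_slope_mean[OF F b] by (rule le_less_trans[rotated])
  define r where "r = enn2real (ratio_mean F ?b)"
  have r: "ratio_mean F ?b = ennreal r" "0 \<le> r" using fin by (auto simp: r_def)
  define c where "c = ?b + \<alpha> * (1 - ?b) * r"
  have c0: "0 \<le> c" unfolding c_def using \<alpha> b r right_edge(2)[OF F] by (intro add_nonneg_nonneg) auto
  have "(\<lambda>i. dF_mean F (\<lambda>s. ennreal s / ennreal ((?a i - s) ^ 1))) \<longlonglongrightarrow> dF_mean F (\<lambda>s. ennreal s / ennreal ((?b - s) ^ 1))"
    by (rule edge_convergence[OF F b]) simp
  then have lim: "(\<lambda>i. ratio_mean F (?a i)) \<longlonglongrightarrow> ennreal r"
    unfolding r(1)[symmetric] ratio_mean_def by simp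
  have q: "mean_queue F (?a i) = (1 - ?a i) * enn2real (ratio_mean F (?a i))" for i
  proof -
    have "ennreal (1 * (1 - ?a i)) * ratio_mean F (?a i) = ennreal (1 * mean_queue F (?a i))"
      by (rule ratio_mean_eq[OF F a(2,3)]) simp
    then have "enn2real (ennreal (1 - ?a i) * ratio_mean F (?a i)) = mean_queue F (?a i)"
      using mean_queue_nonneg[OF F a(2,3), of i] by simp
    moreover have "0 \<le> 1 - ?a i" using a(3)[of i] by simp
    ultimately show ?thesis by (simp only: enn2real_mult enn2real_ennreal)
  qed
  have ml: "(\<lambda>i. mean_queue F (?a i)) \<longlonglongrightarrow> (1 - ?b) * r"
    unfolding q by (intro tendsto_mult tendsto_diff tendsto_const a(1) tendsto_enn2real lim r(2))
  have up: "(\<lambda>i. ?a i + \<alpha> * mean_queue F (?a i)) \<longlonglongrightarrow> c"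
    unfolding c_def mult.assoc by (intro tendsto_add tendsto_mult tendsto_const a(1) ml)
  have lo: "(\<lambda>i. ?b + \<alpha> * mean_queue F (?a i)) \<longlonglongrightarrow> c"
    unfolding c_def mult.assoc by (intro tendsto_add tendsto_mult tendsto_const ml)
  have "rate_limit \<alpha> c"
  proof (rule rate_limitI)
    have "AE \<omega> in M. liminf_ge (path_rate \<alpha> \<omega>) (?b + \<alpha> * mean_queue F (?a i))" for i
    proof (rule path_rate_lower_subcritical[OF F a(2,3) \<alpha>])
      have "ennreal (\<alpha> * slope F (?a i)) = ennreal \<alpha> * slope_mean F (?a i)"
        by (rule slope_mean_mult_eq[OF F a(2) \<alpha>, symmetric])
      also have "\<dots> \<le> ennreal \<alpha> * slope_mean F ?b"
        using a(3)[of i] by (intro mult_left_mono slope_mean_antimono(2)[OF F b a(2)]) auto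
      also have "\<dots> \<le> 1" by (rule sub)
      finally show "\<alpha> * slope F (?a i) \<le> 1" by (simp flip: ennreal_1)
    qed
    then have "AE \<omega> in M. \<forall>i. liminf_ge (path_rate \<alpha> \<omega>) (?b + \<alpha> * mean_queue F (?a i))"
      by (simp add: AE_all_countable)
    then show "AE \<omega> in M. liminf_ge (path_rate \<alpha> \<omega>) c"
      by eventually_elim (rule liminf_ge_closed[OF _ lo], blast)
    have "AE \<omega> in M. \<forall>i. limsup_le (path_rate \<alpha> \<omega>) (?a i + \<alpha> * mean_queue F (?a i))"
      unfolding AE_all_countable using path_rate_upper[OF F a(2,3) \<alpha>] by blast
    then show "AE \<omega> in M. limsup_le (path_rate \<alpha> \<omega>) c"
      by eventually_elim (rule limsup_le_closed[OF _ up], blast)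
  qed
  moreover have "ennreal c = ennreal ?b + ennreal (\<alpha> * (1 - ?b)) * ratio_mean F ?b"
    unfolding r(1) c_def using \<alpha> b r(2) right_edge(2)[OF F]
    by (simp add: ennreal_mult[symmetric] ennreal_plus[symmetric] del: ennreal_plus)
  ultimately show ?thesis using c0 by blast
qed

lemma rate_limit_middle:
  assumes F: "unit_cdf F" and \<alpha>: "0 < \<alpha>" and b: "right_edge F < 1"
    and a: "a \<in> {right_edge F..1}" and crit: "ennreal \<alpha> * slope_mean F a = 1"
  shows "\<exists>c. rate_limit \<alpha> c \<and> ennreal c = ennreal a + ennreal (\<alpha> * (1 - a)) * ratio_mean F a"
proof -
  consider "a = right_edge F" | "right_edge F < a" "a < 1" | "a = 1" using a by fastforce
  then show ?thesis
  proof cases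
    case 1
    then show ?thesis using rate_limit_flat[OF F \<alpha> b] crit by auto
  next
    case 2
    have "0 \<le> a" using 2 right_edge(2)[OF F] by simp
    then have "ennreal (a + \<alpha> * mean_queue F a) = ennreal a + ennreal (\<alpha> * (1 - a)) * ratio_mean F a"
      using \<alpha> mean_queue_nonneg[OF F 2] by (subst ratio_mean_eq[OF F 2]) auto
    then show ?thesis using rate_limit_interior[OF F \<alpha> 2 crit] by blast
  next
    case 3
    then show ?thesis using rate_limit_saturated[OF F \<alpha> b] crit by (intro exI[of _ 1]) auto
  qed
qed

lemma ex_rate_limit:
  assumes F: "unit_cdf F" and \<alpha>: "0 < \<alpha>"
  shows "\<exists>c. rate_limit \<alpha> c"
proof (cases "right_edge F < 1")
  case False
  then show ?thesis using rate_limit_edge_1[OF F \<alpha>] right_edge(3)[OF F] by fastforce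
next
  case b: True
  consider "ennreal \<alpha> * slope_mean F (right_edge F) \<le> 1" | "1 \<le> ennreal \<alpha> * slope_mean F 1"
    | "1 \<le> ennreal \<alpha> * slope_mean F (right_edge F)" "ennreal \<alpha> * slope_mean F 1 \<le> 1"
    using linear[of "ennreal \<alpha> * slope_mean F (right_edge F)" 1] linear[of "ennreal \<alpha> * slope_mean F 1" 1]
    by blast
  then show ?thesis
  proof cases
    case 1
    then show ?thesis using rate_limit_flat[OF F \<alpha> b] by blast
  next
    case 2
    then show ?thesis using rate_limit_saturated[OF F \<alpha> b] by blast
  next
    case 3
    then show ?thesis using ex_critical_parameter[OF F b \<alpha>] rate_limit_middle[OF F \<alpha> b] by blast
  qed
qed

end

theorem theorem1:
  fixes \<alpha> :: real
    and F :: "real \<Rightarrow> real"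
    and M :: "'w measure"
    and p :: "nat \<Rightarrow> 'w \<Rightarrow> real"
    and \<epsilon> :: "nat \<Rightarrow> nat \<Rightarrow> 'w \<Rightarrow> bool"
  assumes "0 < \<alpha>"
    and "unit_cdf F"
    and "random_environment_array M F p \<epsilon>"
  shows "\<exists>c::real. 0 \<le> c \<and>
    (AE \<omega> in M.
       (\<lambda>m. real (longest_path (\<lambda>i j. \<epsilon> i j \<omega>) m (nat \<lfloor>\<alpha> * real m\<rfloor>)) / real m)
         \<longlonglongrightarrow> c) \<and>
    (right_edge F = 1 \<longrightarrow> c = 1) \<and>
    (right_edge F < 1 \<longrightarrow>
       (ennreal \<alpha> \<le> alpha_c' F \<longrightarrow>
          ennreal c = ennreal (right_edge F) + ennreal (\<alpha> * (1 - right_edge F)) *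
            dF_mean F (\<lambda>s. ennreal s / ennreal (right_edge F - s))) \<and>
       (alpha_c' F \<le> ennreal \<alpha> \<and> ennreal \<alpha> \<le> alpha_c F \<longrightarrow>
          (\<exists>!a. a \<in> {right_edge F..1} \<and>
             ennreal \<alpha> * dF_mean F (\<lambda>s. ennreal (s * (1 - s)) / ennreal ((a - s)\<^sup>2)) = 1) \<and>
          (\<forall>a. a \<in> {right_edge F..1} \<and>
             ennreal \<alpha> * dF_mean F (\<lambda>s. ennreal (s * (1 - s)) / ennreal ((a - s)\<^sup>2)) = 1 \<longrightarrow>
             ennreal c = ennreal a + ennreal (\<alpha> * (1 - a)) *
               dF_mean F (\<lambda>s. ennreal s / ennreal (a - s)))) \<and>
       (alpha_c F \<le> ennreal \<alpha> \<longrightarrow> c = 1))"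
proof -
  note \<alpha> = assms(1) and F = assms(2)
  interpret random_environment_array M F p \<epsilon> by (rule assms(3))
  obtain c where c: "rate_limit \<alpha> c" using ex_rate_limit[OF F \<alpha>] by blast
  have uniq: "c' = c" if "rate_limit \<alpha> c'" for c' using rate_limit_unique[OF that c] .
  show ?thesis
    unfolding slope_mean_def[symmetric] ratio_mean_def[symmetric]
  proof (intro exI[of _ c] conjI impI allI)
    show "0 \<le> c" by (rule rate_limit_nonneg[OF c])
    show "AE \<omega> in M. (\<lambda>m. real (longest_path (\<lambda>i j. \<epsilon> i j \<omega>) m (nat \<lfloor>\<alpha> * real m\<rfloor>)) / real m) \<longlonglongrightarrow> c"
      using c unfolding rate_limit_def path_rate_def[abs_def] longest_path_eq_lpp0 .
    show "c = 1" if "right_edge F = 1" using uniq[OF rate_limit_edge_1[OF F \<alpha> that]] by simp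
  next
    assume b: "right_edge F < 1"
    show "ennreal c = ennreal (right_edge F) + ennreal (\<alpha> * (1 - right_edge F)) * ratio_mean F (right_edge F)"
      if "ennreal \<alpha> \<le> alpha_c' F"
      using rate_limit_flat[OF F \<alpha> b] uniq that unfolding alpha_c'_eq ennreal_inverse_le_iff[OF \<alpha>] by blast
    show "c = 1" if "alpha_c F \<le> ennreal \<alpha>"
      using uniq[OF rate_limit_saturated[OF F \<alpha> b]] that
      unfolding alpha_c_eq[OF F b] ennreal_inverse_le_iff[OF \<alpha>] by simp
    show "ennreal c = ennreal a + ennreal (\<alpha> * (1 - a)) * ratio_mean F a"
      if "a \<in> {right_edge F..1} \<and> ennreal \<alpha> * slope_mean F a = 1" for a
      using rate_limit_middle[OF F \<alpha> b, of a] that uniq by blast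
    assume "alpha_c' F \<le> ennreal \<alpha> \<and> ennreal \<alpha> \<le> alpha_c F"
    then have "\<exists>a\<in>{right_edge F..1}. ennreal \<alpha> * slope_mean F a = 1"
      unfolding alpha_c'_eq alpha_c_eq[OF F b] ennreal_inverse_le_iff[OF \<alpha>]
      by (intro ex_critical_parameter[OF F b \<alpha>]) auto
    then show "\<exists>!a. a \<in> {right_edge F..1} \<and> ennreal \<alpha> * slope_mean F a = 1"
      using unique_critical_parameter[OF F b \<alpha>] by blast
  qed
qed

end
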